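(* Let $(C,\oplus,0,\zeta^\oplus)$ be a small permutative category. The braid operad $\mathsf{Br}$ parametrizes braided ring category structures on $C$: there is a canonical bijective correspondence between $\mathsf{Cat}$-enriched multifunctors $\mathsf{Br}\to\mathsf{PermCat}^{\mathsf{su}}$ sending the unique object of $\mathsf{Br}$ to $C$, and data $(\otimes,1,\partial^l,\partial^r,\zeta^\otimes)$ making $(C,\oplus,0,\zeta^\oplus)$ into a braided ring category.
   Context: A permutative category is a symmetric strict monoidal category. The $\mathsf{Cat}$-enriched multicategory $\mathsf{PermCat}^{\mathsf{su}}$ has small permutative categories as objects. For $n\ge1$, its category of $n$-ary operations $(C_1,\dots,C_n)\to D$ has as objects the $n$-linear functors: functors $F:C_1\times\cdots\times C_n\to D$ with, for each $i$, a natural transformation $F^2_i:F(\dots,A_i,\dots)\oplus F(\dots,A_i',\dots)\to F(\dots,A_i\oplus A_i',\dots)$ (the other entries fixed), such that: $F=0$ if some entry is $0$ and $F=1_0$ if some entry is $1_0$; $F^2_i$ is an identity if any of the objects $A_j$ or $A'_i$ is $0$; each $F^2_i$ is associative, $F_i^2(F_i^2\oplus1)=F_i^2(1\oplus F_i^2)$; each $F^2_i$ is symmetric, $F(\dots,\zeta^\oplus,\dots)F^2_i=F^2_i\zeta^\oplus$; and for $i\ne k$, the two morphisms $F(A_i,A_k)\oplus F(A_i',A_k)\oplus F(A_i,A_k')\oplus F(A_i',A_k')\to F(A_i\oplus A_i',A_k\oplus A_k')$ given by $F^2_k(F^2_i\oplus F^2_i)$ and $F^2_i(F^2_k\oplus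 F^2_k)(1\oplus\zeta^\oplus\oplus1)$ agree. Its morphisms are the $n$-linear transformations: natural transformations that commute with all $F^2_i$ and are $1_0$ whenever some entry is $0$. The category of $0$-ary operations into $D$ is $D$. Composition is composition of functors, with the linearity constraint of $F\circ(G_1,\dots,G_n)$ in a variable of $G_j$ equal to $F(\dots,G_j^2,\dots)\circ F^2_j$; the symmetric groups permute the variables. The braid operad $\mathsf{Br}$ is the $\mathsf{Cat}$-enriched operad (one-object multicategory) whose $k$th category has object set the symmetric group $\Sigma_k$ and morphisms $\sigma\to\tau$ the braids $b\in B_k$ with underlying permutation $\tau\sigma^{-1}$, composed by multiplication of braids. $\Sigma_k$ acts by right multiplication on objects and leaves the underlying braids unchanged. Operadic composition is that of the associative operad on objects, $\gamma(\sigma;\tau_1,\dots,\tau_n)=\sigma\langle k_1,\dots,k_n\rangle\cdot(\tau_1\oplus\cdots\oplus\tau_n)$ (block permutation times block sum, $\tau_i\in\Sigma_{k_i}$), and on morphisms $b:\sigma\to\sigma'$, $b_i:\tau_i\to\tau_i'$ it is the block braid $b\langle k_{\sigma^{-1}(1)},\dots,k_{\sigma^{-1}(n)}\rangle$ multiplied with the juxtaposition $\bigoplus_{j=1}^n b_{\sigma^{-1}(j)}$. A ring category structure on $(C,\oplus,0,\zeta^\oplus)$ consists of a strict monoidal structure $(\otimes,1)$ on $C$ and natural transformations $\partial^l_{A,B,C}:(A\otimes C)\oplus(B\otimes C)\to(A\oplus B)\otimes C$ and $\partial^r_{A,B,C}:(A\otimes B)\oplus(A\otimes C)\to A\otimes(B\oplus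 C)$ such that (writing $AB$ for $A\otimes B$): $0A=0=A0$ on objects and $1_0\otimes f=1_0=f\otimes 1_0$ on morphisms; $\partial^l$ and $\partial^r$ are identities whenever one of the three objects is $0$; $\partial^l_{A,B,1}$ and $\partial^r_{1,A,B}$ are identities; $\partial^l_{B,A,C}\zeta^\oplus_{AC,BC}=(\zeta^\oplus_{A,B}\otimes1)\partial^l_{A,B,C}$ and $\partial^r_{A,C,B}\zeta^\oplus_{AB,AC}=(1\otimes\zeta^\oplus_{B,C})\partial^r_{A,B,C}$; $\partial^l_{A\oplus A',A'',B}(\partial^l_{A,A',B}\oplus1)=\partial^l_{A,A'\oplus A'',B}(1\oplus\partial^l_{A',A'',B})$ and $\partial^r_{A,B\oplus B',B''}(\partial^r_{A,B,B'}\oplus1)=\partial^r_{A,B,B'\oplus B''}(1\oplus\partial^r_{A,B',B''})$; $\partial^l_{A,B,CD}=(\partial^l_{A,B,C}\otimes1_D)\partial^l_{AC,BC,D}$, $\partial^r_{AB,C,D}=(1_A\otimes\partial^r_{B,C,D})\partial^r_{A,BC,BD}$, $(\partial^r_{A,B,C}\otimes1_D)\partial^l_{AB,AC,D}=(1_A\otimes\partial^l_{B,C,D})\partial^r_{A,BD,CD}$; and $\partial^r_{A\oplus B,C,D}(\partial^l_{A,B,C}\oplus\partial^l_{A,B,D})(1\oplus\zeta^\oplus_{AD,BC}\oplus1)=\partial^l_{A,B,C\oplus D}(\partial^r_{A,C,D}\oplus\partial^r_{B,C,D})$. A braided ring category is a ring category with a braiding $\zeta^\otimes$ making $(C,\otimes,1)$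 a braided strict monoidal category, such that $\zeta^\otimes_{A,0}=1_0=\zeta^\otimes_{0,A}$, $\zeta^\otimes_{A\oplus B,C}\partial^l_{A,B,C}=\partial^r_{C,A,B}(\zeta^\otimes_{A,C}\oplus\zeta^\otimes_{B,C})$ and $\zeta^\otimes_{A,B\oplus C}\partial^r_{A,B,C}=\partial^l_{B,C,A}(\zeta^\otimes_{A,B}\oplus\zeta^\otimes_{A,C})$. *)

theory Defs
  imports "HOL-Combinatorics.Combinatorics" "HOL-Library.FuncSet"
begin

section \<open>Small categories, functors, natural transformations\<close>

record ('o, 'm) category =
  ob :: "'o set"
  arr :: "'m set"
  src :: "'m \<Rightarrow> 'o"
  tgt :: "'m \<Rightarrow> 'o"
  idm :: "'o \<Rightarrow> 'm"
  cmp :: "'m \<Rightarrow> 'm \<Rightarrow> 'm"  (infixl \<open>\<cdot>\<index>\<close> 55)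

definition hom :: "('o, 'm, 'z) category_scheme \<Rightarrow> 'o \<Rightarrow> 'o \<Rightarrow> 'm set" where
  "hom C A B = {f \<in> arr C. src C f = A \<and> tgt C f = B}"

locale category =
  fixes C :: "('o, 'm, 'z) category_scheme" (structure)
  assumes src_closed: "f \<in> arr C \<Longrightarrow> src C f \<in> ob C"
    and tgt_closed: "f \<in> arr C \<Longrightarrow> tgt C f \<in> ob C"
    and idm_closed: "A \<in> ob C \<Longrightarrow> idm C A \<in> hom C A A"
    and cmp_closed: "\<lbrakk>f \<in> hom C A B; g \<in> hom C B D\<rbrakk> \<Longrightarrow> g \<cdot> f \<in> hom C A D"
    and cmp_idm_left: "f \<in> hom C A B \<Longrightarrow> idm C B \<cdot> f = f"
    and cmp_idm_right: "f \<in> hom C A B \<Longrightarrow> f \<cdot> idm C A = f"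
    and cmp_assoc: "\<lbrakk>f \<in> hom C A B; g \<in> hom C B D; h \<in> hom C D E\<rbrakk>
        \<Longrightarrow> h \<cdot> (g \<cdot> f) = (h \<cdot> g) \<cdot> f"

definition is_iso :: "('o, 'm, 'z) category_scheme \<Rightarrow> 'm \<Rightarrow> bool" where
  "is_iso C f \<longleftrightarrow> f \<in> arr C \<and>
     (\<exists>g \<in> hom C (tgt C f) (src C f).
        g \<cdot>\<^bsub>C\<^esub> f = idm C (src C f) \<and> f \<cdot>\<^bsub>C\<^esub> g = idm C (tgt C f))"

definition cat_prod ::
  "('a, 'f, 'y) category_scheme \<Rightarrow> ('b, 'g, 'z) category_scheme \<Rightarrow> ('a \<times> 'b, 'f \<times> 'g) category"
  (infixr \<open>\<times>\<^sub>c\<close> 80) where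
  "C \<times>\<^sub>c D =
    \<lparr>ob = ob C \<times> ob D,
     arr = arr C \<times> arr D,
     src = map_prod (src C) (src D),
     tgt = map_prod (tgt C) (tgt D),
     idm = map_prod (idm C) (idm D),
     cmp = (\<lambda>(g, g') (f, f'). (g \<cdot>\<^bsub>C\<^esub> f, g' \<cdot>\<^bsub>D\<^esub> f'))\<rparr>"

text \<open>The product of a finite list of categories; the product of \<open>[]\<close> is the terminal category.\<close>

definition cat_list_prod ::
  "('o, 'm, 'z) category_scheme list \<Rightarrow> ('o list, 'm list) category" where
  "cat_list_prod Cs =
    \<lparr>ob = listset (map ob Cs),
     arr = listset (map arr Cs),
     src = (\<lambda>fs. map2 src Cs fs),
     tgt = (\<lambda>fs. map2 tgt Cs fs),
     idm = (\<lambda>As. map2 idm Cs As),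
     cmp = (\<lambda>gs fs. map (\<lambda>(C, g, f). g \<cdot>\<^bsub>C\<^esub> f) (zip Cs (zip gs fs)))\<rparr>"

definition is_functor ::
  "('a, 'f, 'y) category_scheme \<Rightarrow> ('b, 'g, 'z) category_scheme \<Rightarrow> ('a \<Rightarrow> 'b) \<Rightarrow> ('f \<Rightarrow> 'g) \<Rightarrow> bool"
  where
  "is_functor C D Fo Fm \<longleftrightarrow>
     (\<forall>A \<in> ob C. Fo A \<in> ob D) \<and>
     (\<forall>f \<in> arr C. Fm f \<in> hom D (Fo (src C f)) (Fo (tgt C f))) \<and>
     (\<forall>A \<in> ob C. Fm (idm C A) = idm D (Fo A)) \<and>
     (\<forall>f \<in> arr C. \<forall>g \<in> arr C. src C g = tgt C f \<longrightarrow> Fm (g \<cdot>\<^bsub>C\<^esub> f) = Fm g \<cdot>\<^bsub>D\<^esub> Fm f)"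

text \<open>\<open>nat_trans C D Fo Fm Go Gm \<alpha>\<close>: the family \<open>\<alpha>\<close> is natural from \<open>(Fo, Fm)\<close> to \<open>(Go, Gm)\<close>,
  where both pairs are meant to be functors from \<open>C\<close> to \<open>D\<close>.\<close>

definition nat_trans ::
  "('a, 'f, 'y) category_scheme \<Rightarrow> ('b, 'g, 'z) category_scheme \<Rightarrow>
   ('a \<Rightarrow> 'b) \<Rightarrow> ('f \<Rightarrow> 'g) \<Rightarrow> ('a \<Rightarrow> 'b) \<Rightarrow> ('f \<Rightarrow> 'g) \<Rightarrow> ('a \<Rightarrow> 'g) \<Rightarrow> bool" where
  "nat_trans C D Fo Fm Go Gm \<alpha> \<longleftrightarrow>
     (\<forall>A \<in> ob C. \<alpha> A \<in> hom D (Fo A) (Go A)) \<and>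
     (\<forall>f \<in> arr C. \<alpha> (tgt C f) \<cdot>\<^bsub>D\<^esub> Fm f = Gm f \<cdot>\<^bsub>D\<^esub> \<alpha> (src C f))"


section \<open>Braided and symmetric strict monoidal structures, permutative categories\<close>

definition strict_monoidal ::
  "('o, 'm, 'z) category_scheme \<Rightarrow> ('o \<Rightarrow> 'o \<Rightarrow> 'o) \<Rightarrow> ('m \<Rightarrow> 'm \<Rightarrow> 'm) \<Rightarrow> 'o \<Rightarrow> bool" where
  "strict_monoidal C to tm e \<longleftrightarrow>
     is_functor (C \<times>\<^sub>c C) C (\<lambda>(A, B). to A B) (\<lambda>(f, g). tm f g) \<and>
     e \<in> ob C \<and>
     (\<forall>A \<in> ob C. \<forall>B \<in> ob C. \<forall>D \<in> ob C. to (to A B) D = to A (to B D)) \<and>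
     (\<forall>f \<in> arr C. \<forall>g \<in> arr C. \<forall>h \<in> arr C. tm (tm f g) h = tm f (tm g h)) \<and>
     (\<forall>A \<in> ob C. to e A = A \<and> to A e = A) \<and>
     (\<forall>f \<in> arr C. tm (idm C e) f = f \<and> tm f (idm C e) = f)"

definition is_braiding ::
  "('o, 'm, 'z) category_scheme \<Rightarrow> ('o \<Rightarrow> 'o \<Rightarrow> 'o) \<Rightarrow> ('m \<Rightarrow> 'm \<Rightarrow> 'm) \<Rightarrow>
   ('o \<Rightarrow> 'o \<Rightarrow> 'm) \<Rightarrow> bool" where
  "is_braiding C to tm z \<longleftrightarrow>
     nat_trans (C \<times>\<^sub>c C) C (\<lambda>(A, B). to A B) (\<lambda>(f, g). tm f g)
                          (\<lambda>(A, B). to B A) (\<lambda>(f, g). tm g f) (\<lambda>(A, B). z A B) \<and>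
     (\<forall>A \<in> ob C. \<forall>B \<in> ob C. is_iso C (z A B)) \<and>
     (\<forall>A \<in> ob C. \<forall>B \<in> ob C. \<forall>D \<in> ob C.
        z A (to B D) = tm (idm C B) (z A D) \<cdot>\<^bsub>C\<^esub> tm (z A B) (idm C D) \<and>
        z (to A B) D = tm (z A D) (idm C B) \<cdot>\<^bsub>C\<^esub> tm (idm C A) (z B D))"

record ('o, 'm) permcat = "('o, 'm) category" +
  osum :: "'o \<Rightarrow> 'o \<Rightarrow> 'o"  (infixr \<open>\<oplus>\<index>\<close> 65)
  msum :: "'m \<Rightarrow> 'm \<Rightarrow> 'm"  (infixr \<open>\<boxplus>\<index>\<close> 65)
  ozero :: "'o"  (\<open>\<zero>\<index>\<close>)
  zeta :: "'o \<Rightarrow> 'o \<Rightarrow> 'm"  (\<open>\<zeta>\<index>\<close>)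

locale permutative_category = category C
  for C :: "('o, 'm, 'z) permcat_scheme" (structure) +
  assumes sum_strict_monoidal: "strict_monoidal C (osum C) (msum C) \<zero>"
    and sum_braiding: "is_braiding C (osum C) (msum C) \<zeta>"
    and sum_symmetry: "\<lbrakk>A \<in> ob C; B \<in> ob C\<rbrakk> \<Longrightarrow> \<zeta> B A \<cdot> \<zeta> A B = idm C (A \<oplus> B)"


section \<open>Multilinear functors and multilinear transformations\<close>

text \<open>
  \<open>lin F i As A'\<close> is the component of \<open>F\<^sup>2\<^sub>i\<close> (with \<open>i\<close> counted from 0) at the tuple \<open>As\<close>, whose
  \<open>i\<close>th entry is the first summand \<open>A\<^sub>i\<close>, and the second summand \<open>A'\<close>.
  All functions are \<open>undefined\<close> outside their domains, so that equality of
  records is equality of multilinear functors.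
\<close>

record ('o, 'm) mlfun =
  obmap :: "'o list \<Rightarrow> 'o"
  armap :: "'m list \<Rightarrow> 'm"
  lin :: "nat \<Rightarrow> 'o list \<Rightarrow> 'o \<Rightarrow> 'm"

definition lin_dom :: "('o, 'm) permcat list \<Rightarrow> (nat \<times> 'o list \<times> 'o) set" where
  "lin_dom Cs = {(i, As, A'). i < length Cs \<and> As \<in> ob (cat_list_prod Cs) \<and> A' \<in> ob (Cs ! i)}"

locale multilinear_functor =
  fixes Cs :: "('o, 'm) permcat list"
    and D :: "('o, 'm) permcat" (structure)
    and F :: "('o, 'm) mlfun"
  assumes obmap_ext: "obmap F \<in> extensional (ob (cat_list_prod Cs))"
    and armap_ext: "armap F \<in> extensional (arr (cat_list_prod Cs))"
    and lin_ext: "(\<lambda>(i, As, A'). lin F i As A') \<in> extensional (lin_dom Cs)"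
    and functorial: "is_functor (cat_list_prod Cs) D (obmap F) (armap F)"
    and lin_natural: "i < length Cs \<Longrightarrow>
      nat_trans (cat_list_prod Cs \<times>\<^sub>c Cs ! i) D
        (\<lambda>(As, A'). obmap F As \<oplus> obmap F (As[i := A']))
        (\<lambda>(fs, f'). armap F fs \<boxplus> armap F (fs[i := f']))
        (\<lambda>(As, A'). obmap F (As[i := As ! i \<oplus>\<^bsub>Cs ! i\<^esub> A']))
        (\<lambda>(fs, f'). armap F (fs[i := fs ! i \<boxplus>\<^bsub>Cs ! i\<^esub> f']))
        (\<lambda>(As, A'). lin F i As A')"
    and obmap_zero: "\<lbrakk>As \<in> ob (cat_list_prod Cs); j < length Cs; As ! j = \<zero>\<^bsub>Cs ! j\<^esub>\<rbrakk>
      \<Longrightarrow> obmap F As = \<zero>"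
    and armap_zero: "\<lbrakk>fs \<in> arr (cat_list_prod Cs); j < length Cs; fs ! j = idm (Cs ! j) \<zero>\<^bsub>Cs ! j\<^esub>\<rbrakk>
      \<Longrightarrow> armap F fs = idm D \<zero>"
    and lin_zero: "\<lbrakk>(i, As, A') \<in> lin_dom Cs;
        (\<exists>j < length Cs. As ! j = \<zero>\<^bsub>Cs ! j\<^esub>) \<or> A' = \<zero>\<^bsub>Cs ! i\<^esub>\<rbrakk>
      \<Longrightarrow> lin F i As A' = idm D (obmap F (As[i := As ! i \<oplus>\<^bsub>Cs ! i\<^esub> A']))"
    and lin_assoc: "\<lbrakk>(i, As, A') \<in> lin_dom Cs; A'' \<in> ob (Cs ! i)\<rbrakk> \<Longrightarrow>
      lin F i (As[i := As ! i \<oplus>\<^bsub>Cs ! i\<^esub> A']) A'' \<cdot> (lin F i As A' \<boxplus> idm D (obmap F (As[i := A''])))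
      = lin F i As (A' \<oplus>\<^bsub>Cs ! i\<^esub> A'') \<cdot> (idm D (obmap F As) \<boxplus> lin F i (As[i := A']) A'')"
    and lin_sym: "(i, As, A') \<in> lin_dom Cs \<Longrightarrow>
      armap F ((map2 idm Cs As)[i := \<zeta>\<^bsub>Cs ! i\<^esub> (As ! i) A']) \<cdot> lin F i As A'
      = lin F i (As[i := A']) (As ! i) \<cdot> \<zeta> (obmap F As) (obmap F (As[i := A']))"
    and lin_two: "\<lbrakk>(i, As, A') \<in> lin_dom Cs; (k, As, B') \<in> lin_dom Cs; i \<noteq> k\<rbrakk> \<Longrightarrow>
      lin F k (As[i := As ! i \<oplus>\<^bsub>Cs ! i\<^esub> A']) B'
        \<cdot> (lin F i As A' \<boxplus> lin F i (As[k := B']) A')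
      = lin F i (As[k := As ! k \<oplus>\<^bsub>Cs ! k\<^esub> B']) A'
        \<cdot> (lin F k As B' \<boxplus> lin F k (As[i := A']) B')
        \<cdot> (idm D (obmap F As) \<boxplus> \<zeta> (obmap F (As[i := A'])) (obmap F (As[k := B']))
            \<boxplus> idm D (obmap F (As[i := A', k := B'])))"

locale multilinear_transformation =
  fixes Cs :: "('o, 'm) permcat list"
    and D :: "('o, 'm) permcat" (structure)
    and F G :: "('o, 'm) mlfun"
    and \<alpha> :: "'o list \<Rightarrow> 'm"
  assumes ext: "\<alpha> \<in> extensional (ob (cat_list_prod Cs))"
    and natural: "nat_trans (cat_list_prod Cs) D (obmap F) (armap F) (obmap G) (armap G) \<alpha>"
    and lin_compat: "(i, As, A') \<in> lin_dom Cs \<Longrightarrow>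
      \<alpha> (As[i := As ! i \<oplus>\<^bsub>Cs ! i\<^esub> A']) \<cdot> lin F i As A' = lin G i As A' \<cdot> (\<alpha> As \<boxplus> \<alpha> (As[i := A']))"
    and zero: "\<lbrakk>As \<in> ob (cat_list_prod Cs); j < length Cs; As ! j = \<zero>\<^bsub>Cs ! j\<^esub>\<rbrakk>
      \<Longrightarrow> \<alpha> As = idm D \<zero>"


section \<open>Cat-enriched multicategories and multifunctors\<close>

text \<open>
  The data of a \<open>Cat\<close>-enriched (symmetric) multicategory: \<open>mhom M xs y\<close> is the category of operations
  \<open>xs \<rightarrow> y\<close>; the suffixes 1 and 2 refer to the action on its objects and on its morphisms.
  \<open>mcomp1 M xss ys z p qs\<close> composes \<open>p : ys \<rightarrow> z\<close> with the list of the \<open>qs ! i : xss ! i \<rightarrow> ys ! i\<close>,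
  and \<open>mact1 M xs y \<rho>\<close> is the right action of the permutation \<open>\<rho>\<close>, with values in the category of
  operations \<open>(x\<^bsub>\<rho>(1)\<^esub>, \<dots>, x\<^bsub>\<rho>(n)\<^esub>) \<rightarrow> y\<close>.
\<close>

record ('x, 'p, 'q) multicategory =
  mob :: "'x set"
  mhom :: "'x list \<Rightarrow> 'x \<Rightarrow> ('p, 'q) category"
  munit :: "'x \<Rightarrow> 'p"
  mcomp1 :: "'x list list \<Rightarrow> 'x list \<Rightarrow> 'x \<Rightarrow> 'p \<Rightarrow> 'p list \<Rightarrow> 'p"
  mcomp2 :: "'x list list \<Rightarrow> 'x list \<Rightarrow> 'x \<Rightarrow> 'q \<Rightarrow> 'q list \<Rightarrow> 'q"
  mact1 :: "'x list \<Rightarrow> 'x \<Rightarrow> (nat \<Rightarrow> nat) \<Rightarrow> 'p \<Rightarrow> 'p"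
  mact2 :: "'x list \<Rightarrow> 'x \<Rightarrow> (nat \<Rightarrow> nat) \<Rightarrow> 'q \<Rightarrow> 'q"

record ('x, 'p, 'q, 'y, 'r, 's) mfun =
  fob :: "'x \<Rightarrow> 'y"
  fop1 :: "'x list \<Rightarrow> 'x \<Rightarrow> 'p \<Rightarrow> 'r"
  fop2 :: "'x list \<Rightarrow> 'x \<Rightarrow> 'q \<Rightarrow> 's"

locale multifunctor =
  fixes M :: "('x, 'p, 'q) multicategory"
    and N :: "('y, 'r, 's) multicategory"
    and F :: "('x, 'p, 'q, 'y, 'r, 's) mfun"
  assumes fob_ext: "fob F \<in> extensional (mob M)"
    and fop1_ext: "(\<lambda>(xs, y, p). fop1 F xs y p)
      \<in> extensional {(xs, y, p). xs \<in> lists (mob M) \<and> y \<in> mob M \<and> p \<in> ob (mhom M xs y)}"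
    and fop2_ext: "(\<lambda>(xs, y, a). fop2 F xs y a)
      \<in> extensional {(xs, y, a). xs \<in> lists (mob M) \<and> y \<in> mob M \<and> a \<in> arr (mhom M xs y)}"
    and fob_closed: "x \<in> mob M \<Longrightarrow> fob F x \<in> mob N"
    and functorial: "\<lbrakk>xs \<in> lists (mob M); y \<in> mob M\<rbrakk> \<Longrightarrow>
      is_functor (mhom M xs y) (mhom N (map (fob F) xs) (fob F y)) (fop1 F xs y) (fop2 F xs y)"
    and unit: "x \<in> mob M \<Longrightarrow> fop1 F [x] x (munit M x) = munit N (fob F x)"
    and comp1: "\<lbrakk>xss \<in> lists (lists (mob M)); ys \<in> lists (mob M); z \<in> mob M;
        length xss = length ys; length qs = length ys;
        p \<in> ob (mhom M ys z); \<forall>i < length ys. qs ! i \<in> ob (mhom M (xss ! i) (ys ! i))\<rbrakk> \<Longrightarrow>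
      fop1 F (concat xss) z (mcomp1 M xss ys z p qs)
      = mcomp1 N (map (map (fob F)) xss) (map (fob F) ys) (fob F z) (fop1 F ys z p)
          (map (\<lambda>i. fop1 F (xss ! i) (ys ! i) (qs ! i)) [0..<length ys])"
    and comp2: "\<lbrakk>xss \<in> lists (lists (mob M)); ys \<in> lists (mob M); z \<in> mob M;
        length xss = length ys; length bs = length ys;
        a \<in> arr (mhom M ys z); \<forall>i < length ys. bs ! i \<in> arr (mhom M (xss ! i) (ys ! i))\<rbrakk> \<Longrightarrow>
      fop2 F (concat xss) z (mcomp2 M xss ys z a bs)
      = mcomp2 N (map (map (fob F)) xss) (map (fob F) ys) (fob F z) (fop2 F ys z a)
          (map (\<lambda>i. fop2 F (xss ! i) (ys ! i) (bs ! i)) [0..<length ys])"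
    and act1: "\<lbrakk>xs \<in> lists (mob M); y \<in> mob M; \<rho> permutes {..<length xs}; p \<in> ob (mhom M xs y)\<rbrakk> \<Longrightarrow>
      fop1 F (permute_list \<rho> xs) y (mact1 M xs y \<rho> p)
      = mact1 N (map (fob F) xs) (fob F y) \<rho> (fop1 F xs y p)"
    and act2: "\<lbrakk>xs \<in> lists (mob M); y \<in> mob M; \<rho> permutes {..<length xs}; a \<in> arr (mhom M xs y)\<rbrakk> \<Longrightarrow>
      fop2 F (permute_list \<rho> xs) y (mact2 M xs y \<rho> a)
      = mact2 N (map (fob F) xs) (fob F y) \<rho> (fop2 F xs y a)"


section \<open>Positions in concatenated lists\<close>

text \<open>\<open>locate ns p\<close> is the block and the position inside this block of position \<open>p\<close> in a list
  subdivided into consecutive blocks of lengths \<open>ns\<close>.\<close>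

fun locate :: "nat list \<Rightarrow> nat \<Rightarrow> nat \<times> nat" where
  "locate [] p = (0, p)"
| "locate (n # ns) p = (if p < n then (0, p) else apfst Suc (locate ns (p - n)))"

fun chunks :: "nat list \<Rightarrow> 'a list \<Rightarrow> 'a list list" where
  "chunks [] xs = []"
| "chunks (n # ns) xs = take n xs # chunks ns (drop n xs)"


section \<open>The multicategory of permutative categories\<close>

text \<open>Multilinear transformations are recorded together with their source and target. For \<open>Cs = []\<close>,
  the category below consists of the functors from the terminal category to \<open>D\<close> and their
  transformations, i.e. of the objects and morphisms of \<open>D\<close>.\<close>

type_synonym ('o, 'm) mltrans = "('o, 'm) mlfun \<times> ('o list \<Rightarrow> 'm) \<times> ('o, 'm) mlfun"

definition ml_category ::
  "('o, 'm) permcat list \<Rightarrow> ('o, 'm) permcat \<Rightarrow> (('o, 'm) mlfun, ('o, 'm) mltrans) category" where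
  "ml_category Cs D =
    \<lparr>ob = {F. multilinear_functor Cs D F},
     arr = {(F, \<alpha>, G). multilinear_functor Cs D F \<and> multilinear_functor Cs D G \<and>
                       multilinear_transformation Cs D F G \<alpha>},
     src = (\<lambda>(F, \<alpha>, G). F),
     tgt = (\<lambda>(F, \<alpha>, G). G),
     idm = (\<lambda>F. (F, \<lambda>As \<in> ob (cat_list_prod Cs). idm D (obmap F As), F)),
     cmp = (\<lambda>(G, \<beta>, H) (F, \<alpha>, G'). (F, \<lambda>As \<in> ob (cat_list_prod Cs). \<beta> As \<cdot>\<^bsub>D\<^esub> \<alpha> As, H))\<rparr>"

definition ml_unit :: "('o, 'm) permcat \<Rightarrow> ('o, 'm) mlfun" where
  "ml_unit C =
    \<lparr>obmap = (\<lambda>As \<in> ob (cat_list_prod [C]). hd As),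
     armap = (\<lambda>fs \<in> arr (cat_list_prod [C]). hd fs),
     lin = (\<lambda>i As A'. if (i, As, A') \<in> lin_dom [C] then idm C (hd As \<oplus>\<^bsub>C\<^esub> A') else undefined)\<rparr>"

definition ml_comp ::
  "('o, 'm) permcat list list \<Rightarrow> ('o, 'm) permcat list \<Rightarrow> ('o, 'm) permcat \<Rightarrow>
   ('o, 'm) mlfun \<Rightarrow> ('o, 'm) mlfun list \<Rightarrow> ('o, 'm) mlfun" where
  "ml_comp Css Ds E F Gs =
    (let ns = map length Css; inner = (\<lambda>As. map2 obmap Gs (chunks ns As)) in
    \<lparr>obmap = (\<lambda>As \<in> ob (cat_list_prod (concat Css)). obmap F (inner As)),
     armap = (\<lambda>fs \<in> arr (cat_list_prod (concat Css)). armap F (map2 armap Gs (chunks ns fs))),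
     lin = (\<lambda>i As A'.
       if (i, As, A') \<in> lin_dom (concat Css) then
         let (j, l) = locate ns i; As\<^sub>j = chunks ns As ! j in
           armap F ((map2 idm Ds (inner As))[j := lin (Gs ! j) l As\<^sub>j A'])
             \<cdot>\<^bsub>E\<^esub> lin F j (inner As) (obmap (Gs ! j) (As\<^sub>j[l := A']))
       else undefined)\<rparr>)"

definition ml_comp2 ::
  "('o, 'm) permcat list list \<Rightarrow> ('o, 'm) permcat list \<Rightarrow> ('o, 'm) permcat \<Rightarrow>
   ('o, 'm) mltrans \<Rightarrow> ('o, 'm) mltrans list \<Rightarrow> ('o, 'm) mltrans" where
  "ml_comp2 Css Ds E = (\<lambda>(F, \<alpha>, F') bs.
    (let ns = map length Css; Gs = map fst bs; Gs' = map (snd \<circ> snd) bs; \<beta>s = map (fst \<circ> snd) bs in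
      (ml_comp Css Ds E F Gs,
       \<lambda>As \<in> ob (cat_list_prod (concat Css)).
         \<alpha> (map2 obmap Gs' (chunks ns As)) \<cdot>\<^bsub>E\<^esub> armap F (map2 (\<lambda>\<beta> As'. \<beta> As') \<beta>s (chunks ns As)),
       ml_comp Css Ds E F' Gs')))"

text \<open>The right action: \<open>(F\<rho>)(A\<^sub>1, \<dots>, A\<^sub>n) = F(A\<^bsub>\<rho>\<inverse>(1)\<^esub>, \<dots>, A\<^bsub>\<rho>\<inverse>(n)\<^esub>)\<close>; the \<open>i\<close>th
  variable of \<open>F\<rho>\<close> is the variable of \<open>F\<close> with index \<open>\<rho>(i)\<close>.\<close>

definition ml_act :: "('o, 'm) permcat list \<Rightarrow> (nat \<Rightarrow> nat) \<Rightarrow> ('o, 'm) mlfun \<Rightarrow> ('o, 'm) mlfun" where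
  "ml_act Cs \<rho> F =
    (let Bs = permute_list \<rho> Cs in
    \<lparr>obmap = (\<lambda>As \<in> ob (cat_list_prod Bs). obmap F (permute_list (inv \<rho>) As)),
     armap = (\<lambda>fs \<in> arr (cat_list_prod Bs). armap F (permute_list (inv \<rho>) fs)),
     lin = (\<lambda>i As A'. if (i, As, A') \<in> lin_dom Bs
                      then lin F (\<rho> i) (permute_list (inv \<rho>) As) A' else undefined)\<rparr>)"

definition ml_act2 ::
  "('o, 'm) permcat list \<Rightarrow> (nat \<Rightarrow> nat) \<Rightarrow> ('o, 'm) mltrans \<Rightarrow> ('o, 'm) mltrans" where
  "ml_act2 Cs \<rho> = (\<lambda>(F, \<alpha>, G).
    (ml_act Cs \<rho> F,
     \<lambda>As \<in> ob (cat_list_prod (permute_list \<rho> Cs)). \<alpha> (permute_list (inv \<rho>) As),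
     ml_act Cs \<rho> G))"

definition PermCat :: "(('o, 'm) permcat, ('o, 'm) mlfun, ('o, 'm) mltrans) multicategory" where
  "PermCat =
    \<lparr>mob = {C. permutative_category C},
     mhom = ml_category,
     munit = ml_unit,
     mcomp1 = ml_comp,
     mcomp2 = ml_comp2,
     mact1 = (\<lambda>Cs D. ml_act Cs),
     mact2 = (\<lambda>Cs D. ml_act2 Cs)\<rparr>"


section \<open>Braid groups\<close>

text \<open>
  \<open>B\<^sub>k\<close> is given by Artin's presentation. The letter \<open>(i, True)\<close> is the generator braiding the strands
  in positions \<open>i\<close> and \<open>i + 1\<close> (counted from 0), \<open>(i, False)\<close> is its inverse. As for permutations,
  in a product the right factor comes first.
\<close>

type_synonym braid_word = "(nat \<times> bool) list"

definition braid_words :: "nat \<Rightarrow> braid_word set" where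
  "braid_words k = lists {(i, e). Suc i < k}"

inductive braid_eq :: "nat \<Rightarrow> braid_word \<Rightarrow> braid_word \<Rightarrow> bool" for k where
  refl: "w \<in> braid_words k \<Longrightarrow> braid_eq k w w"
| sym: "braid_eq k v w \<Longrightarrow> braid_eq k w v"
| trans: "\<lbrakk>braid_eq k u v; braid_eq k v w\<rbrakk> \<Longrightarrow> braid_eq k u w"
| cancel: "\<lbrakk>u \<in> braid_words k; v \<in> braid_words k; Suc i < k\<rbrakk> \<Longrightarrow>
    braid_eq k (u @ [(i, e), (i, \<not> e)] @ v) (u @ v)"
| far: "\<lbrakk>u \<in> braid_words k; v \<in> braid_words k; Suc i < j; Suc j < k\<rbrakk> \<Longrightarrow>
    braid_eq k (u @ [(i, True), (j, True)] @ v) (u @ [(j, True), (i, True)] @ v)"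
| near: "\<lbrakk>u \<in> braid_words k; v \<in> braid_words k; Suc (Suc i) < k\<rbrakk> \<Longrightarrow>
    braid_eq k (u @ [(i, True), (Suc i, True), (i, True)] @ v)
               (u @ [(Suc i, True), (i, True), (Suc i, True)] @ v)"

type_synonym braid = "braid_word set"

definition braid_class :: "nat \<Rightarrow> braid_word \<Rightarrow> braid" where
  "braid_class k w = {v. braid_eq k w v}"

definition braids :: "nat \<Rightarrow> braid set" where
  "braids k = braid_words k // {(v, w). braid_eq k v w}"

definition braid_mult :: "nat \<Rightarrow> braid \<Rightarrow> braid \<Rightarrow> braid" where
  "braid_mult k b c = (\<Union>u \<in> b. \<Union>v \<in> c. braid_class k (u @ v))"

fun word_perm :: "braid_word \<Rightarrow> nat \<Rightarrow> nat" where
  "word_perm [] = id"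
| "word_perm ((i, e) # w) = transpose i (Suc i) \<circ> word_perm w"

definition braid_perm :: "braid \<Rightarrow> nat \<Rightarrow> nat" where
  "braid_perm b = the_elem (word_perm ` b)"

text \<open>Juxtaposition: the \<open>j\<close>th braid acts on the \<open>j\<close>th block of strands.\<close>

fun word_juxt :: "nat list \<Rightarrow> braid_word list \<Rightarrow> braid_word" where
  "word_juxt (k # ks) (w # ws) = w @ map (\<lambda>(i, e). (k + i, e)) (word_juxt ks ws)"
| "word_juxt _ _ = []"

definition braid_juxt :: "nat list \<Rightarrow> braid list \<Rightarrow> braid" where
  "braid_juxt ks bs = (\<Union>ws \<in> listset bs. braid_class (sum_list ks) (word_juxt ks ws))"

text \<open>
  Block braids: the \<open>i\<close>th strand is replaced by \<open>ks ! i\<close> parallel strands. \<open>cross_word m p q\<close> passes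
  the block of \<open>p\<close> strands starting in position \<open>m\<close> across the following block of \<open>q\<close> strands, using
  positive generators; its inverse takes blocks of sizes \<open>(q, p)\<close> to blocks of sizes \<open>(p, q)\<close>.
\<close>

definition cross_word :: "nat \<Rightarrow> nat \<Rightarrow> nat \<Rightarrow> braid_word" where
  "cross_word m p q = concat (map (\<lambda>s. map (\<lambda>t. (m + s + t, True)) (rev [0..<q])) [0..<p])"

definition inv_word :: "braid_word \<Rightarrow> braid_word" where
  "inv_word w = rev (map (\<lambda>(i, e). (i, \<not> e)) w)"

fun block_letter :: "nat list \<Rightarrow> nat \<times> bool \<Rightarrow> braid_word" where
  "block_letter ks (i, True) = cross_word (sum_list (take i ks)) (ks ! i) (ks ! Suc i)"
| "block_letter ks (i, False) = inv_word (cross_word (sum_list (take i ks)) (ks ! Suc i) (ks ! i))"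

fun block_word :: "nat list \<Rightarrow> braid_word \<Rightarrow> braid_word" where
  "block_word ks [] = []"
| "block_word ks (x # w) = block_letter (permute_list (inv (word_perm w)) ks) x @ block_word ks w"

definition block_braid :: "nat list \<Rightarrow> braid \<Rightarrow> braid" where
  "block_braid ks b = (\<Union>w \<in> b. braid_class (sum_list ks) (block_word ks w))"


section \<open>The braid operad\<close>

text \<open>\<open>block_perm \<sigma> ks\<close> is \<open>\<sigma>\<langle>k\<^sub>1, \<dots>, k\<^sub>n\<rangle>\<close>, moving the \<open>i\<close>th block to the \<open>\<sigma>(i)\<close>th place.\<close>

definition block_perm :: "(nat \<Rightarrow> nat) \<Rightarrow> nat list \<Rightarrow> nat \<Rightarrow> nat" where
  "block_perm \<sigma> ks p =
    (if p < sum_list ks then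
       let (i, l) = locate ks p in (\<Sum>j | j < length ks \<and> \<sigma> j < \<sigma> i. ks ! j) + l
     else p)"

definition block_sum :: "nat list \<Rightarrow> (nat \<Rightarrow> nat) list \<Rightarrow> nat \<Rightarrow> nat" where
  "block_sum ks \<tau>s p =
    (if p < sum_list ks then
       let (i, l) = locate ks p in sum_list (take i ks) + (\<tau>s ! i) l
     else p)"

definition br_comp :: "nat list \<Rightarrow> (nat \<Rightarrow> nat) \<Rightarrow> (nat \<Rightarrow> nat) list \<Rightarrow> nat \<Rightarrow> nat" where
  "br_comp ks \<sigma> \<tau>s = block_perm \<sigma> ks \<circ> block_sum ks \<tau>s"

type_synonym br_arr = "(nat \<Rightarrow> nat) \<times> braid \<times> (nat \<Rightarrow> nat)"

definition br_category :: "nat \<Rightarrow> (nat \<Rightarrow> nat, br_arr) category" where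
  "br_category k =
    \<lparr>ob = {\<sigma>. \<sigma> permutes {..<k}},
     arr = {(\<sigma>, b, \<tau>). \<sigma> permutes {..<k} \<and> \<tau> permutes {..<k} \<and>
                       b \<in> braids k \<and> braid_perm b = \<tau> \<circ> inv \<sigma>},
     src = (\<lambda>(\<sigma>, b, \<tau>). \<sigma>),
     tgt = (\<lambda>(\<sigma>, b, \<tau>). \<tau>),
     idm = (\<lambda>\<sigma>. (\<sigma>, braid_class k [], \<sigma>)),
     cmp = (\<lambda>(\<tau>, c, \<rho>) (\<sigma>, b, \<tau>'). (\<sigma>, braid_mult k c b, \<rho>))\<rparr>"

definition br_comp2 :: "nat list \<Rightarrow> br_arr \<Rightarrow> br_arr list \<Rightarrow> br_arr" where
  "br_comp2 ks = (\<lambda>(\<sigma>, b, \<sigma>') as.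
    (let ks' = permute_list (inv \<sigma>) ks; bs = permute_list (inv \<sigma>) (map (fst \<circ> snd) as) in
      (br_comp ks \<sigma> (map fst as),
       braid_mult (sum_list ks) (block_braid ks' b) (braid_juxt ks' bs),
       br_comp ks \<sigma>' (map (snd \<circ> snd) as))))"

definition Br :: "(unit, nat \<Rightarrow> nat, br_arr) multicategory" where
  "Br =
    \<lparr>mob = UNIV,
     mhom = (\<lambda>xs y. br_category (length xs)),
     munit = (\<lambda>x. id),
     mcomp1 = (\<lambda>xss ys z. br_comp (map length xss)),
     mcomp2 = (\<lambda>xss ys z. br_comp2 (map length xss)),
     mact1 = (\<lambda>xs y \<rho> \<sigma>. \<sigma> \<circ> \<rho>),
     mact2 = (\<lambda>xs y \<rho> (\<sigma>, b, \<tau>). (\<sigma> \<circ> \<rho>, b, \<tau> \<circ> \<rho>))\<rparr>"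


section \<open>Ring categories and braided ring categories\<close>

text \<open>\<open>dl R A B X\<close> and \<open>dr R A B X\<close> are \<open>\<partial>\<^sup>l\<^bsub>A,B,X\<^esub>\<close> and \<open>\<partial>\<^sup>r\<^bsub>A,B,X\<^esub>\<close>.\<close>

record ('o, 'm) ring_structure =
  otimes :: "'o \<Rightarrow> 'o \<Rightarrow> 'o"  (infixr \<open>\<otimes>\<index>\<close> 70)
  mtimes :: "'m \<Rightarrow> 'm \<Rightarrow> 'm"  (infixr \<open>\<boxtimes>\<index>\<close> 70)
  oone :: "'o"  (\<open>\<one>\<index>\<close>)
  dl :: "'o \<Rightarrow> 'o \<Rightarrow> 'o \<Rightarrow> 'm"
  dr :: "'o \<Rightarrow> 'o \<Rightarrow> 'o \<Rightarrow> 'm"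

record ('o, 'm) braided_ring_structure = "('o, 'm) ring_structure" +
  bra :: "'o \<Rightarrow> 'o \<Rightarrow> 'm"

locale ring_category = permutative_category C
  for C :: "('o, 'm) permcat" (structure) +
  fixes R :: "('o, 'm, 'z) ring_structure_scheme"
  assumes otimes_ext: "(\<lambda>(A, B). A \<otimes>\<^bsub>R\<^esub> B) \<in> extensional (ob C \<times> ob C)"
    and mtimes_ext: "(\<lambda>(f, g). f \<boxtimes>\<^bsub>R\<^esub> g) \<in> extensional (arr C \<times> arr C)"
    and dl_ext: "(\<lambda>(A, B, X). dl R A B X) \<in> extensional (ob C \<times> ob C \<times> ob C)"
    and dr_ext: "(\<lambda>(A, B, X). dr R A B X) \<in> extensional (ob C \<times> ob C \<times> ob C)"
    and times_strict_monoidal: "strict_monoidal C (otimes R) (mtimes R) \<one>\<^bsub>R\<^esub>"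
    and dl_natural: "nat_trans (C \<times>\<^sub>c C \<times>\<^sub>c C) C
        (\<lambda>(A, B, X). (A \<otimes>\<^bsub>R\<^esub> X) \<oplus> (B \<otimes>\<^bsub>R\<^esub> X)) (\<lambda>(f, g, h). (f \<boxtimes>\<^bsub>R\<^esub> h) \<boxplus> (g \<boxtimes>\<^bsub>R\<^esub> h))
        (\<lambda>(A, B, X). (A \<oplus> B) \<otimes>\<^bsub>R\<^esub> X) (\<lambda>(f, g, h). (f \<boxplus> g) \<boxtimes>\<^bsub>R\<^esub> h)
        (\<lambda>(A, B, X). dl R A B X)"
    and dr_natural: "nat_trans (C \<times>\<^sub>c C \<times>\<^sub>c C) C
        (\<lambda>(A, B, X). (A \<otimes>\<^bsub>R\<^esub> B) \<oplus> (A \<otimes>\<^bsub>R\<^esub> X)) (\<lambda>(f, g, h). (f \<boxtimes>\<^bsub>R\<^esub> g) \<boxplus> (f \<boxtimes>\<^bsub>R\<^esub> h))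
        (\<lambda>(A, B, X). A \<otimes>\<^bsub>R\<^esub> (B \<oplus> X)) (\<lambda>(f, g, h). f \<boxtimes>\<^bsub>R\<^esub> (g \<boxplus> h))
        (\<lambda>(A, B, X). dr R A B X)"
    and zero_otimes: "A \<in> ob C \<Longrightarrow> \<zero> \<otimes>\<^bsub>R\<^esub> A = \<zero>"
    and otimes_zero: "A \<in> ob C \<Longrightarrow> A \<otimes>\<^bsub>R\<^esub> \<zero> = \<zero>"
    and zero_mtimes: "f \<in> arr C \<Longrightarrow> idm C \<zero> \<boxtimes>\<^bsub>R\<^esub> f = idm C \<zero>"
    and mtimes_zero: "f \<in> arr C \<Longrightarrow> f \<boxtimes>\<^bsub>R\<^esub> idm C \<zero> = idm C \<zero>"
    and dl_zero: "\<lbrakk>A \<in> ob C; B \<in> ob C; X \<in> ob C; A = \<zero> \<or> B = \<zero> \<or> X = \<zero>\<rbrakk>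
      \<Longrightarrow> dl R A B X = idm C ((A \<oplus> B) \<otimes>\<^bsub>R\<^esub> X)"
    and dr_zero: "\<lbrakk>A \<in> ob C; B \<in> ob C; X \<in> ob C; A = \<zero> \<or> B = \<zero> \<or> X = \<zero>\<rbrakk>
      \<Longrightarrow> dr R A B X = idm C (A \<otimes>\<^bsub>R\<^esub> (B \<oplus> X))"
    and dl_one: "\<lbrakk>A \<in> ob C; B \<in> ob C\<rbrakk> \<Longrightarrow> dl R A B \<one>\<^bsub>R\<^esub> = idm C (A \<oplus> B)"
    and dr_one: "\<lbrakk>A \<in> ob C; B \<in> ob C\<rbrakk> \<Longrightarrow> dr R \<one>\<^bsub>R\<^esub> A B = idm C (A \<oplus> B)"
    and dl_sym: "\<lbrakk>A \<in> ob C; B \<in> ob C; X \<in> ob C\<rbrakk> \<Longrightarrow>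
      dl R B A X \<cdot> \<zeta> (A \<otimes>\<^bsub>R\<^esub> X) (B \<otimes>\<^bsub>R\<^esub> X) = (\<zeta> A B \<boxtimes>\<^bsub>R\<^esub> idm C X) \<cdot> dl R A B X"
    and dr_sym: "\<lbrakk>A \<in> ob C; B \<in> ob C; X \<in> ob C\<rbrakk> \<Longrightarrow>
      dr R A X B \<cdot> \<zeta> (A \<otimes>\<^bsub>R\<^esub> B) (A \<otimes>\<^bsub>R\<^esub> X) = (idm C A \<boxtimes>\<^bsub>R\<^esub> \<zeta> B X) \<cdot> dr R A B X"
    and dl_sum_assoc: "\<lbrakk>A \<in> ob C; A' \<in> ob C; A'' \<in> ob C; B \<in> ob C\<rbrakk> \<Longrightarrow>
      dl R (A \<oplus> A') A'' B \<cdot> (dl R A A' B \<boxplus> idm C (A'' \<otimes>\<^bsub>R\<^esub> B))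
      = dl R A (A' \<oplus> A'') B \<cdot> (idm C (A \<otimes>\<^bsub>R\<^esub> B) \<boxplus> dl R A' A'' B)"
    and dr_sum_assoc: "\<lbrakk>A \<in> ob C; B \<in> ob C; B' \<in> ob C; B'' \<in> ob C\<rbrakk> \<Longrightarrow>
      dr R A (B \<oplus> B') B'' \<cdot> (dr R A B B' \<boxplus> idm C (A \<otimes>\<^bsub>R\<^esub> B''))
      = dr R A B (B' \<oplus> B'') \<cdot> (idm C (A \<otimes>\<^bsub>R\<^esub> B) \<boxplus> dr R A B' B'')"
    and dl_otimes: "\<lbrakk>A \<in> ob C; B \<in> ob C; X \<in> ob C; Y \<in> ob C\<rbrakk> \<Longrightarrow>
      dl R A B (X \<otimes>\<^bsub>R\<^esub> Y) = (dl R A B X \<boxtimes>\<^bsub>R\<^esub> idm C Y) \<cdot> dl R (A \<otimes>\<^bsub>R\<^esub> X) (B \<otimes>\<^bsub>R\<^esub> X) Y"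
    and dr_otimes: "\<lbrakk>A \<in> ob C; B \<in> ob C; X \<in> ob C; Y \<in> ob C\<rbrakk> \<Longrightarrow>
      dr R (A \<otimes>\<^bsub>R\<^esub> B) X Y = (idm C A \<boxtimes>\<^bsub>R\<^esub> dr R B X Y) \<cdot> dr R A (B \<otimes>\<^bsub>R\<^esub> X) (B \<otimes>\<^bsub>R\<^esub> Y)"
    and dr_dl_otimes: "\<lbrakk>A \<in> ob C; B \<in> ob C; X \<in> ob C; Y \<in> ob C\<rbrakk> \<Longrightarrow>
      (dr R A B X \<boxtimes>\<^bsub>R\<^esub> idm C Y) \<cdot> dl R (A \<otimes>\<^bsub>R\<^esub> B) (A \<otimes>\<^bsub>R\<^esub> X) Y
      = (idm C A \<boxtimes>\<^bsub>R\<^esub> dl R B X Y) \<cdot> dr R A (B \<otimes>\<^bsub>R\<^esub> Y) (X \<otimes>\<^bsub>R\<^esub> Y)"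
    and dr_dl_sum: "\<lbrakk>A \<in> ob C; B \<in> ob C; X \<in> ob C; Y \<in> ob C\<rbrakk> \<Longrightarrow>
      dr R (A \<oplus> B) X Y \<cdot> (dl R A B X \<boxplus> dl R A B Y)
        \<cdot> (idm C (A \<otimes>\<^bsub>R\<^esub> X) \<boxplus> \<zeta> (A \<otimes>\<^bsub>R\<^esub> Y) (B \<otimes>\<^bsub>R\<^esub> X) \<boxplus> idm C (B \<otimes>\<^bsub>R\<^esub> Y))
      = dl R A B (X \<oplus> Y) \<cdot> (dr R A X Y \<boxplus> dr R B X Y)"

locale braided_ring_category = ring_category C R
  for C :: "('o, 'm) permcat" (structure)
    and R :: "('o, 'm, 'z) braided_ring_structure_scheme" +
  assumes bra_ext: "(\<lambda>(A, B). bra R A B) \<in> extensional (ob C \<times> ob C)"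
    and times_braiding: "is_braiding C (otimes R) (mtimes R) (bra R)"
    and bra_zero_right: "A \<in> ob C \<Longrightarrow> bra R A \<zero> = idm C \<zero>"
    and bra_zero_left: "A \<in> ob C \<Longrightarrow> bra R \<zero> A = idm C \<zero>"
    and bra_dl: "\<lbrakk>A \<in> ob C; B \<in> ob C; X \<in> ob C\<rbrakk> \<Longrightarrow>
      bra R (A \<oplus> B) X \<cdot> dl R A B X = dr R X A B \<cdot> (bra R A X \<boxplus> bra R B X)"
    and bra_dr: "\<lbrakk>A \<in> ob C; B \<in> ob C; X \<in> ob C\<rbrakk> \<Longrightarrow>
      bra R A (B \<oplus> X) \<cdot> dr R A B X = dl R B X A \<cdot> (bra R A B \<boxplus> bra R A X)"


section \<open>The braided ring category structure determined by a multifunctor\<close>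

text \<open>
  The product is the bilinear functor given by the unit element of \<open>\<Sigma>\<^sub>2\<close>, with its two linearity
  constraints as factorization morphisms; \<open>\<one>\<close> is the nullary operation given by \<open>\<Sigma>\<^sub>0\<close>; the
  braiding is the image of the generator of \<open>B\<^sub>2\<close>, a morphism from the identity to the transposition.
\<close>

definition braided_ring_of ::
  "(unit, nat \<Rightarrow> nat, br_arr, ('o, 'm) permcat, ('o, 'm) mlfun, ('o, 'm) mltrans) mfun \<Rightarrow>
   ('o, 'm) braided_ring_structure" where
  "braided_ring_of F =
    (let T = fop1 F [(), ()] () id;
         U = fop1 F [] () id;
         (_, \<beta>, _) = fop2 F [(), ()] () (id, braid_class 2 [(0, True)], transpose 0 1) in
    \<lparr>otimes = (\<lambda>A B. obmap T [A, B]),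
     mtimes = (\<lambda>f g. armap T [f, g]),
     oone = obmap U [],
     dl = (\<lambda>A B X. lin T 0 [A, X] B),
     dr = (\<lambda>A B X. lin T 1 [A, B] X),
     bra = (\<lambda>A B. \<beta> [A, B])\<rparr>)"

end

theory Submission
  imports Defs
begin

text \<open>
  A braided ring category is a permutative category with a braided strict monoidal structure that is
  bilinear with respect to \<open>\<oplus>\<close>, and \<open>Br\<close> is the operad of braided strict monoidal structures. The map of
  the theorem has an inverse because the objects of \<open>Br\<close> are generated, under composition and the
  actions of the symmetric groups, by the units of \<open>\<Sigma>\<^sub>0\<close> and \<open>\<Sigma>\<^sub>2\<close>, and the morphisms by the generator
  of \<open>B\<^sub>2\<close>, while the relations between
  these generators correspond to the axioms of a braided ring category.

  From a structure to a multifunctor. A permutation \<open>\<sigma>\<close> of \<open>k\<close> letters is sent to the \<open>k\<close>-fold product of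
  its arguments in the order given by \<open>\<sigma>\<close>. Its linearity constraint in a variable that has the product \<open>P\<close>
  on its left and the product \<open>S\<close> on its right is a morphism
  \<open>delta P A A' S : (P \<otimes> A \<otimes> S) \<oplus> (P \<otimes> A' \<otimes> S) \<rightarrow> P \<otimes> (A \<oplus> A') \<otimes> S\<close> composed of \<open>\<partial>\<^sup>l\<close> and \<open>\<partial>\<^sup>r\<close>. The axioms of
  a ring category say that \<open>delta\<close> is natural, associative and symmetric, that it can be computed in two
  steps when \<open>P\<close> and \<open>S\<close> are products (\<open>delta_comp\<close>), and that two constraints in different variables
  commute (\<open>delta_two\<close>); hence these products are multilinear functors (\<open>multilinear_Ten\<close>) and compose
  as the permutations do (\<open>ml_comp_Ten\<close>).

  A braid word acts on a product by braiding neighbouring factors. By the interchange law, by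
  naturality and by the hexagons this respects the relations of the braid group (\<open>ev_cong\<close>), and the axioms
  that relate the braiding to \<open>\<partial>\<^sup>l\<close> and \<open>\<partial>\<^sup>r\<close> make the action multilinear (\<open>ev_lin\<close>). A crossing of two
  blocks acts, by the hexagons, as the braiding of the products of the blocks. So a block braid acts as the
  original braid on the products of the blocks (\<open>ev_block_word\<close>), a juxtaposition acts as the product of the
  actions (\<open>ev_juxt\<close>), and the action is compatible with the composition of the operad (\<open>evT_comp2\<close>).

  From a multifunctor to a structure. The unit of \<open>\<Sigma>\<^sub>3\<close> is a composite of units in two ways, and the unit
  of \<open>\<Sigma>\<^sub>1\<close> is a composite of the units of \<open>\<Sigma>\<^sub>2\<close>, \<open>\<Sigma>\<^sub>1\<close> and \<open>\<Sigma>\<^sub>0\<close>. Comparing values and linearity constraints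
  of these composites gives the monoid axioms and the axioms on iterated factorization morphisms
  (\<open>T_assoc\<close>, \<open>T_unit\<close>); the other axioms of a ring category are the conditions on a bilinear functor. The
  crossing of one strand and a block of two strands, read once as a block braid and once letter by letter,
  gives the hexagons (\<open>bra_R_hexagon\<close>).

  Finally, a multifunctor is determined by its structure: its value at \<open>\<sigma>\<close> is the \<open>k\<close>-fold product
  (\<open>op_Ten\<close>), and its value at a generator of \<open>B\<^sub>k\<close> is forced because that generator is the juxtaposition of
  an identity, the generator of \<open>B\<^sub>2\<close> and an identity (\<open>cpt_letter\<close>).
\<close>

section \<open>Permuted and concatenated lists\<close>

text \<open>
  The entry in position \<open>p\<close> moves to position \<open>\<sigma> p\<close>. In this order the multilinear functor assigned to
  \<open>\<sigma>\<close> multiplies its arguments.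
\<close>

abbreviation place :: "(nat \<Rightarrow> nat) \<Rightarrow> 'a list \<Rightarrow> 'a list" where
  "place \<sigma> xs \<equiv> permute_list (inv \<sigma>) xs"

lemma permutes_bounds:
  fixes \<sigma> :: "nat \<Rightarrow> nat"
  assumes "\<sigma> permutes {..<n}"
  shows "inv \<sigma> permutes {..<n}" "\<sigma> p < n \<longleftrightarrow> p < n" "inv \<sigma> p < n \<longleftrightarrow> p < n"
    "inv \<sigma> (\<sigma> p) = p" "\<sigma> (inv \<sigma> p) = p" "\<sigma> p = \<sigma> q \<longleftrightarrow> p = q"
  using assms permutes_in_image[OF assms, of p] permutes_in_image[OF permutes_inv[OF assms], of p]
  by (auto simp: permutes_inv permutes_inverses permutes_inj inj_eq)

lemma place_nth:
  assumes "\<sigma> permutes {..<length xs}" "p < length xs"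
  shows "place \<sigma> xs ! \<sigma> p = xs ! p"
  using assms by (simp add: permute_list_nth permutes_bounds[OF assms(1)])

lemma place_eqI:
  assumes "\<sigma> permutes {..<length xs}" "length ys = length xs"
    "\<And>p. p < length xs \<Longrightarrow> ys ! \<sigma> p = xs ! p"
  shows "place \<sigma> xs = ys"
proof (rule nth_equalityI)
  fix q assume "q < length (place \<sigma> xs)"
  hence q: "q < length xs" by simp
  hence p: "inv \<sigma> q < length xs" by (simp add: permutes_bounds[OF assms(1)])
  show "place \<sigma> xs ! q = ys ! q"
    using assms(3)[OF p] q by (simp add: permute_list_nth permutes_bounds[OF assms(1)])
qed (use assms in simp)

lemma place_update:
  assumes "\<sigma> permutes {..<length xs}"
  shows "place \<sigma> (xs[i := a]) = (place \<sigma> xs)[\<sigma> i := a]"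
proof (rule place_eqI)
  fix p assume "p < length (xs[i := a])"
  thus "(place \<sigma> xs)[\<sigma> i := a] ! \<sigma> p = xs[i := a] ! p"
    using permutes_bounds(6)[OF assms, of i p] permutes_bounds(2)[OF assms, of p]
    by (cases "i = p") (simp_all add: place_nth[OF assms])
qed (use assms in auto)

lemma place_map:
  assumes "\<sigma> permutes {..<length xs}"
  shows "place \<sigma> (map f xs) = map f (place \<sigma> xs)"
  using assms by (intro permute_list_map permutes_inv)

lemma set_place [simp]:
  assumes "\<sigma> permutes {..<length xs}"
  shows "set (place \<sigma> xs) = set xs"
  using assms by (intro set_permute_list permutes_inv)

lemma place_comp:
  assumes "\<sigma> permutes {..<length xs}" "\<rho> permutes {..<length xs}"
  shows "place (\<sigma> \<circ> \<rho>) xs = place \<sigma> (place \<rho> xs)"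
proof -
  have "inv (\<sigma> \<circ> \<rho>) = inv \<rho> \<circ> inv \<sigma>"
    using assms by (intro o_inv_distrib) (auto intro: permutes_bij)
  thus ?thesis using assms by (simp add: permute_list_compose permutes_inv)
qed

lemma place_map2:
  assumes "\<sigma> permutes {..<length xs}" "length ys = length xs"
  shows "place \<sigma> (map2 f xs ys) = map2 f (place \<sigma> xs) (place \<sigma> ys)"
  using assms by (intro place_eqI) (auto simp: place_nth permutes_bounds[OF assms(1)])

text \<open>
  Equations between permutations that come from operadic composition are proved by comparing their
  effects on a list of distinct entries; this avoids computing with positions.
\<close>

lemma permutes_eqI_place:
  assumes "\<sigma> permutes {..<n}" "\<tau> permutes {..<n}" "place \<sigma> [0..<n] = place \<tau> [0..<n]"
  shows "\<sigma> = \<tau>"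
proof
  fix p
  show "\<sigma> p = \<tau> p"
  proof (cases "p < n")
    case True
    have "place \<sigma> [0..<n] ! \<sigma> p = p" using assms True by (subst place_nth) auto
    moreover have "place \<tau> [0..<n] ! \<sigma> p = inv \<tau> (\<sigma> p)"
      using True permutes_bounds(2)[OF assms(1)] permutes_bounds(3)[OF assms(2)]
      by (simp add: permute_list_def)
    ultimately have "inv \<tau> (\<sigma> p) = p" using assms(3) by simp
    thus ?thesis using permutes_bounds(5)[OF assms(2)] by metis
  qed (use assms in \<open>auto simp: permutes_def\<close>)
qed

lemma concat_chunks: "length xs = sum_list ks \<Longrightarrow> concat (chunks ks xs) = xs"
  by (induction ks arbitrary: xs) auto

lemma length_chunks [simp]: "length (chunks ks xs) = length ks"
  by (induction ks arbitrary: xs) auto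

lemma map_length_chunks: "length xs = sum_list ks \<Longrightarrow> map length (chunks ks xs) = ks"
  by (induction ks arbitrary: xs) auto

abbreviation offset :: "nat list \<Rightarrow> nat \<Rightarrow> nat" where
  "offset ks i \<equiv> sum_list (take i ks)"

lemma offset_less:
  "\<lbrakk>i < length ks; l < ks ! i\<rbrakk> \<Longrightarrow> offset ks i + l < sum_list (ks :: nat list)"
  using id_take_nth_drop[of i ks] by (metis add_less_cancel_left add.assoc sum_list.append sum_list.Cons trans_less_add1)

lemma locate_offset: "\<lbrakk>i < length ks; l < ks ! i\<rbrakk> \<Longrightarrow> locate ks (offset ks i + l) = (i, l)"
proof (induction ks arbitrary: i)
  case (Cons k ks)
  thus ?case by (cases i) (auto simp: add.assoc)
qed simp

lemma locate_bounds:
  assumes "p < sum_list ks"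
  obtains i l where "i < length ks" "l < ks ! i" "p = offset ks i + l"
  using assms
proof (induction ks arbitrary: p thesis)
  case (Cons k ks)
  show ?case
  proof (cases "p < k")
    case True
    thus ?thesis using Cons.prems(1)[of 0 p] by simp
  next
    case False
    then obtain i l where "i < length ks" "l < ks ! i" "p - k = offset ks i + l"
      using Cons.IH[of "p - k"] Cons.prems(2) by (metis add.commute less_diff_conv2 not_less sum_list.Cons)
    thus ?thesis using Cons.prems(1)[of "Suc i" l] False by simp
  qed
qed simp

lemma concat_split:
  assumes "i < length xss" "l < length (xss ! i)"
  shows "concat xss = (concat (take i xss) @ take l (xss ! i)) @ xss ! i ! l #
           (drop (Suc l) (xss ! i) @ concat (drop (Suc i) xss))"
proof -
  have "concat xss = concat (take i xss) @ xss ! i @ concat (drop (Suc i) xss)"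
    using id_take_nth_drop[OF assms(1)] by (metis concat.simps(2) concat_append)
  also have "xss ! i = take l (xss ! i) @ xss ! i ! l # drop (Suc l) (xss ! i)"
    using assms(2) by (rule id_take_nth_drop)
  finally show ?thesis by simp
qed

lemma length_concat_take: "length (concat (take i xss)) = offset (map length xss) i"
  by (simp add: length_concat take_map)

lemma
  assumes "i < length xss" "l < length (xss ! i)"
  defines "p \<equiv> offset (map length xss) i + l"
  shows concat_nth_offset: "concat xss ! p = xss ! i ! l"
    and concat_take_offset: "take p (concat xss) = concat (take i xss) @ take l (xss ! i)"
    and concat_drop_offset:
      "drop (Suc p) (concat xss) = drop (Suc l) (xss ! i) @ concat (drop (Suc i) xss)"
proof -
  have l: "length (concat (take i xss) @ take l (xss ! i)) = p"
    using assms by (simp add: length_concat_take)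
  note s = concat_split[OF assms(1,2)]
  show "concat xss ! p = xss ! i ! l"
    by (subst s, subst l[symmetric]) (rule nth_append_length)
  show "take p (concat xss) = concat (take i xss) @ take l (xss ! i)"
    unfolding s using assms(2) by (simp add: min.absorb2 flip: l)
  show "drop (Suc p) (concat xss) = drop (Suc l) (xss ! i) @ concat (drop (Suc i) xss)"
    by (subst s, subst l[symmetric]) simp
qed

section \<open>Composition of permutations in the operad\<close>

lemma br_comp_offset:
  assumes "\<sigma> permutes {..<length ks}" "length \<tau>s = length ks"
    "\<And>i. i < length ks \<Longrightarrow> \<tau>s ! i permutes {..<ks ! i}"
    and i: "i < length ks" "l < ks ! i"
  shows "br_comp ks \<sigma> \<tau>s (offset ks i + l) = offset (place \<sigma> ks) (\<sigma> i) + (\<tau>s ! i) l"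
proof -
  have t: "(\<tau>s ! i) l < ks ! i" using permutes_bounds(2)[OF assms(3)[OF i(1)]] i by simp
  have si: "\<sigma> i < length ks" using permutes_bounds(2)[OF assms(1)] i by simp
  have "br_comp ks \<sigma> \<tau>s (offset ks i + l) = (\<Sum>j | j < length ks \<and> \<sigma> j < \<sigma> i. ks ! j) + (\<tau>s ! i) l"
    using i t by (simp add: br_comp_def block_sum_def block_perm_def locate_offset offset_less)
  also have "(\<Sum>j | j < length ks \<and> \<sigma> j < \<sigma> i. ks ! j) = (\<Sum>q<\<sigma> i. ks ! inv \<sigma> q)"
    by (rule sum.reindex_bij_witness[of _ "inv \<sigma>" \<sigma>]) 
       (use si permutes_bounds(3)[OF assms(1)] in \<open>auto simp: permutes_bounds(4,5)[OF assms(1)]\<close>)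
  also have "\<dots> = offset (place \<sigma> ks) (\<sigma> i)"
    using si by (simp add: sum_list_sum_nth min_def atLeast0LessThan permute_list_def)
  finally show ?thesis .
qed

lemma
  assumes "\<sigma> permutes {..<length xss}" "length \<tau>s = length xss"
    "\<And>i. i < length xss \<Longrightarrow> \<tau>s ! i permutes {..<length (xss ! i)}"
  defines "yss \<equiv> place \<sigma> (map2 place \<tau>s xss)"
  shows br_comp_concat_nth: "p < length (concat xss) \<Longrightarrow>
      br_comp (map length xss) \<sigma> \<tau>s p < length (concat yss) \<and>
      concat yss ! br_comp (map length xss) \<sigma> \<tau>s p = concat xss ! p"
    and length_concat_yss: "length (concat yss) = length (concat xss)"
    and map_length_yss: "map length yss = place \<sigma> (map length xss)"
proof -
  have "map length (map2 place \<tau>s xss) = map length xss"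
    using assms(2) by (intro nth_equalityI) auto
  thus ml: "map length yss = place \<sigma> (map length xss)"
    unfolding yss_def using assms(1,2) by (metis place_map length_map map_fst_zip length_map)
  have "mset (place \<sigma> (map length xss)) = mset (map length xss)"
    using assms(1) by (intro mset_permute_list) (simp add: permutes_inv)
  thus len: "length (concat yss) = length (concat xss)"
    by (metis length_concat ml sum_mset_sum_list)
  fix p assume p: "p < length (concat xss)"
  then obtain i l where il: "i < length xss" "l < length (xss ! i)" "p = offset (map length xss) i + l"
    using locate_bounds[of p "map length xss"] by (auto simp: length_concat)
  have b: "br_comp (map length xss) \<sigma> \<tau>s p = offset (map length yss) (\<sigma> i) + (\<tau>s ! i) l"
    unfolding il(3) ml using assms il by (intro br_comp_offset) auto
  have si: "\<sigma> i < length yss" 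
    using il(1) assms(2) by (simp add: yss_def permutes_bounds[OF assms(1)])
  have y: "yss ! \<sigma> i = place (\<tau>s ! i) (xss ! i)"
    unfolding yss_def using il(1) assms(1,2) by (subst place_nth) auto
  have tl: "(\<tau>s ! i) l < length (yss ! \<sigma> i)"
    using il by (simp add: y permutes_bounds[OF assms(3)])
  show "br_comp (map length xss) \<sigma> \<tau>s p < length (concat yss) \<and>
      concat yss ! br_comp (map length xss) \<sigma> \<tau>s p = concat xss ! p"
    using offset_less[of "\<sigma> i" "map length yss" "(\<tau>s ! i) l"] si tl il place_nth[OF assms(3)[OF il(1)] il(2)]
    unfolding b by (simp add: length_concat concat_nth_offset y)
qed

text \<open>
  The rearranged list determines the original position of each entry, so \<open>br_comp\<close> is injective.
\<close>

lemma br_comp_permutes: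
  assumes "\<sigma> permutes {..<length ks}" "length \<tau>s = length ks"
    "\<And>i. i < length ks \<Longrightarrow> \<tau>s ! i permutes {..<ks ! i}"
  shows "br_comp ks \<sigma> \<tau>s permutes {..<sum_list ks}"
proof (rule bij_imp_permutes)
  let ?xss = "chunks ks [0..<sum_list ks]"
  have k: "map length ?xss = ks" "concat ?xss = [0..<sum_list ks]"
    by (simp_all add: map_length_chunks concat_chunks)
  have kn: "length (?xss ! i) = ks ! i" if "i < length ks" for i
    using that k(1) by (metis length_chunks nth_map)
  define ys where "ys = concat (place \<sigma> (map2 place \<tau>s ?xss))"
  have *: "br_comp ks \<sigma> \<tau>s p < sum_list ks \<and> ys ! br_comp ks \<sigma> \<tau>s p = p" if "p < sum_list ks" for p
    using br_comp_concat_nth[of \<sigma> ?xss \<tau>s p] length_concat_yss[of \<sigma> ?xss \<tau>s] assms that k kn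
    by (simp add: ys_def)
  have inj: "inj_on (br_comp ks \<sigma> \<tau>s) {..<sum_list ks}"
    by (rule inj_on_inverseI[of _ "\<lambda>q. ys ! q"]) (use * in auto)
  show "bij_betw (br_comp ks \<sigma> \<tau>s) {..<sum_list ks} {..<sum_list ks}"
    unfolding bij_betw_def using inj * by (intro conjI endo_inj_surj) auto
  fix p assume "p \<notin> {..<sum_list ks}"
  thus "br_comp ks \<sigma> \<tau>s p = p" by (simp add: br_comp_def block_sum_def block_perm_def)
qed

text \<open>
  On lists, composition in the associative operad first permutes the entries inside the blocks and then
  the blocks. All facts on \<open>br_comp\<close> needed below follow from this.
\<close>

lemma place_br_comp:
  assumes "\<sigma> permutes {..<length xss}" "length \<tau>s = length xss"
    "\<And>i. i < length xss \<Longrightarrow> \<tau>s ! i permutes {..<length (xss ! i)}"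
  shows "place (br_comp (map length xss) \<sigma> \<tau>s) (concat xss) = concat (place \<sigma> (map2 place \<tau>s xss))"
proof (rule place_eqI)
  show "br_comp (map length xss) \<sigma> \<tau>s permutes {..<length (concat xss)}"
    using br_comp_permutes[of \<sigma> "map length xss" \<tau>s] assms by (simp add: length_concat)
qed (use assms br_comp_concat_nth[of \<sigma> xss \<tau>s] length_concat_yss[of \<sigma> xss \<tau>s] in auto)

lemma br_comp_ids: "br_comp ks id (replicate (length ks) id) = id"
proof -
  let ?xss = "chunks ks [0..<sum_list ks]"
  have k: "map length ?xss = ks" "concat ?xss = [0..<sum_list ks]"
    by (simp_all add: map_length_chunks concat_chunks)
  have m: "map2 place (replicate (length ks) id) ?xss = ?xss"
    by (rule nth_equalityI) auto
  show ?thesis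
    using place_br_comp[of id ?xss "replicate (length ks) id"] k m
      br_comp_permutes[of id ks "replicate (length ks) id"]
    by (intro permutes_eqI_place[of _ "sum_list ks"]) (auto simp: permutes_id)
qed

section \<open>Braid words acting on lists\<close>

definition swap_at :: "nat \<Rightarrow> 'a list \<Rightarrow> 'a list" where
  "swap_at i xs = xs[i := xs ! Suc i, Suc i := xs ! i]"

text \<open>
  A braid word permutes the entries of a list, its last letter acting first; by \<open>wact_eq_place\<close> this is
  the effect of the underlying permutation. Recursion over the letters is what matches the action of words
  on products.
\<close>

fun wact :: "braid_word \<Rightarrow> 'a list \<Rightarrow> 'a list" where
  "wact [] xs = xs"
| "wact (x # w) xs = swap_at (fst x) (wact w xs)"

lemma braid_words_simps [simp]:
  "[] \<in> braid_words k"
  "x # w \<in> braid_words k \<longleftrightarrow> Suc (fst x) < k \<and> w \<in> braid_words k"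
  "u @ v \<in> braid_words k \<longleftrightarrow> u \<in> braid_words k \<and> v \<in> braid_words k"
  by (auto simp: braid_words_def)

lemma swap_at_append [simp]:
  "swap_at (length L) (L @ a # b # S) = L @ b # a # S"
  by (simp add: swap_at_def list_update_append nth_append)

lemma swap_at_Suc_append [simp]:
  "swap_at (Suc (length L)) (L @ c # a # b # S) = L @ c # b # a # S"
  using swap_at_append[of "L @ [c]" a b S] by simp

lemma split_two:
  assumes "Suc i < length xs"
  obtains L a b S where "xs = L @ a # b # S" "length L = i"
proof
  show "xs = take i xs @ xs ! i # xs ! Suc i # drop (Suc (Suc i)) xs"
    using assms by (metis Cons_nth_drop_Suc Suc_lessD append_take_drop_id)
qed (use assms in simp)

lemma length_swap_at [simp]: "length (swap_at i xs) = length xs"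
  by (simp add: swap_at_def)

lemma length_wact [simp]: "length (wact w xs) = length xs"
  by (induction w) auto

lemma set_swap_at [simp]: "Suc i < length xs \<Longrightarrow> set (swap_at i xs) = set xs"
  by (erule split_two) auto

lemma set_wact [simp]: "w \<in> braid_words (length xs) \<Longrightarrow> set (wact w xs) = set xs"
  by (induction w) auto

lemma wact_append: "wact (u @ v) xs = wact u (wact v xs)"
  by (induction u) auto

lemma map_swap_at: "Suc i < length xs \<Longrightarrow> map f (swap_at i xs) = swap_at i (map f xs)"
  by (simp add: swap_at_def map_update)

lemma map_wact: "w \<in> braid_words (length xs) \<Longrightarrow> map f (wact w xs) = wact w (map f xs)"
  by (induction w) (auto simp: map_swap_at)

lemma swap_at_eq_place:
  assumes "Suc i < length xs"
  shows "swap_at i xs = place (transpose i (Suc i)) xs"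
proof (rule place_eqI[symmetric])
  show "transpose i (Suc i) permutes {..<length xs}"
    using assms by (intro permutes_swap_id) auto
qed (use assms in \<open>auto simp: swap_at_def transpose_def nth_list_update\<close>)

lemma word_perm_simps [simp]: "word_perm (x # w) = transpose (fst x) (Suc (fst x)) \<circ> word_perm w"
  by (cases x) simp

lemma word_perm_permutes: "w \<in> braid_words k \<Longrightarrow> word_perm w permutes {..<k}"
  by (induction w) (auto intro!: permutes_compose permutes_swap_id permutes_id simp: permutes_id[unfolded id_def])

lemma wact_eq_place: "w \<in> braid_words (length xs) \<Longrightarrow> wact w xs = place (word_perm w) xs"
proof (induction w)
  case (Cons x w)
  hence "swap_at (fst x) (wact w xs) = place (transpose (fst x) (Suc (fst x))) (place (word_perm w) xs)"
    by (simp add: swap_at_eq_place)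
  also have "\<dots> = place (transpose (fst x) (Suc (fst x)) \<circ> word_perm w) xs"
    using Cons.prems by (intro place_comp[symmetric] word_perm_permutes permutes_swap_id) auto
  finally show ?case by (simp only: wact.simps word_perm_simps)
qed simp

lemma place_word_perm:
  assumes "\<sigma> permutes {..<k}" "w \<in> braid_words k" "length xs = k"
  shows "place (word_perm w \<circ> \<sigma>) xs = wact w (place \<sigma> xs)"
  using assms by (simp add: place_comp word_perm_permutes wact_eq_place)

lemma wact_nth:
  assumes "w \<in> braid_words (length xs)" "j < length xs"
  shows "wact w xs ! word_perm w j = xs ! j"
  using assms by (simp add: wact_eq_place place_nth word_perm_permutes)

lemma wact_update:
  assumes "w \<in> braid_words (length xs)"
  shows "wact w (xs[j := a]) = (wact w xs)[word_perm w j := a]"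
  using assms by (simp add: wact_eq_place place_update word_perm_permutes)

lemma word_perm_eqI:
  assumes "w \<in> braid_words k" "\<pi> permutes {..<k}" "wact w [0..<k] = place \<pi> [0..<k]"
  shows "word_perm w = \<pi>"
  using assms by (intro permutes_eqI_place[of _ k]) (simp_all add: word_perm_permutes wact_eq_place)

section \<open>Relations between braid words\<close>

lemma braid_eq_words: "braid_eq k u v \<Longrightarrow> u \<in> braid_words k \<and> v \<in> braid_words k"
  by (induction rule: braid_eq.induct) auto

lemma braid_eq_context:
  assumes "braid_eq k u v" "p \<in> braid_words k" "q \<in> braid_words k"
  shows "braid_eq k (p @ u @ q) (p @ v @ q)"
  using assms
proof (induction rule: braid_eq.induct)
  case (cancel u v i e)
  thus ?case using braid_eq.cancel[of "p @ u" k "v @ q" i e] by simp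
next
  case (far u v i j)
  thus ?case using braid_eq.far[of "p @ u" k "v @ q" i j] by simp
next
  case (near u v i)
  thus ?case using braid_eq.near[of "p @ u" k "v @ q" i] by simp
qed (auto intro: braid_eq.intros)

lemma braid_eq_append:
  assumes "braid_eq k u u'" "braid_eq k v v'"
  shows "braid_eq k (u @ v) (u' @ v')"
proof -
  note w = braid_eq_words[OF assms(1)] braid_eq_words[OF assms(2)]
  show ?thesis using braid_eq_context[OF assms(1), of "[]" v] braid_eq_context[OF assms(2), of u' "[]"] w
    by (auto intro: braid_eq.trans)
qed

lemma braid_eq_pre: "\<lbrakk>braid_eq k u v; p \<in> braid_words k\<rbrakk> \<Longrightarrow> braid_eq k (p @ u) (p @ v)"
  by (intro braid_eq_append braid_eq.refl)

lemma braid_eq_post: "\<lbrakk>braid_eq k u v; p \<in> braid_words k\<rbrakk> \<Longrightarrow> braid_eq k (u @ p) (v @ p)"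
  by (intro braid_eq_append braid_eq.refl)

lemmas braid_eq_trans [trans] = braid_eq.trans

lemma wact_cong: "\<lbrakk>braid_eq k u v; length xs = k\<rbrakk> \<Longrightarrow> wact u xs = wact v xs"
proof (induction arbitrary: xs rule: braid_eq.induct)
  case (cancel u v i e)
  then obtain L a b S where "wact v xs = L @ a # b # S" "length L = i"
    by (metis length_wact split_two)
  thus ?case by (auto simp: wact_append)
next
  case (far u v i j)
  thus ?case by (auto simp: wact_append swap_at_def list_update_swap)
next
  case (near u v i)
  have "wact [(i, True), (Suc i, True), (i, True)] ys = wact [(Suc i, True), (i, True), (Suc i, True)] ys"
    if len: "Suc (Suc i) < length ys" for ys :: "'a list"
  proof -
    obtain L a b S where ys: "ys = L @ a # b # S" "length L = i"
      by (rule split_two[OF Suc_lessD[OF len]])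
    then obtain c S' where "S = c # S'" using len by (cases S) auto
    thus ?thesis using ys by auto
  qed
  thus ?case using near by (simp only: wact_append length_wact)
qed auto

lemma word_perm_cong: "braid_eq k u v \<Longrightarrow> word_perm u = word_perm v"
  using braid_eq_words[of k u v] wact_cong[of k u v "[0..<k]"]
  by (intro word_perm_eqI[of u k]) (auto simp: word_perm_permutes wact_eq_place)

definition shift_word :: "nat \<Rightarrow> braid_word \<Rightarrow> braid_word" where
  "shift_word m = map (\<lambda>(i, e). (m + i, e))"

lemma shift_word_simps [simp]:
  "shift_word m [] = []"
  "shift_word m (x # w) = (m + fst x, snd x) # shift_word m w"
  "shift_word m (u @ v) = shift_word m u @ shift_word m v"
  by (auto simp: shift_word_def split: prod.split)

lemma shift_word_in: "\<lbrakk>w \<in> braid_words k; m + k \<le> n\<rbrakk> \<Longrightarrow> shift_word m w \<in> braid_words n"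
  by (induction w) auto

lemma braid_words_mono: "\<lbrakk>w \<in> braid_words k; k \<le> n\<rbrakk> \<Longrightarrow> w \<in> braid_words n"
  by (induction w) auto

lemma braid_eq_shift: 
  assumes "braid_eq k u v" "m + k \<le> n"
  shows "braid_eq n (shift_word m u) (shift_word m v)"
  using assms
proof (induction rule: braid_eq.induct)
  case (cancel u v i e)
  thus ?case using braid_eq.cancel[of "shift_word m u" n "shift_word m v" "m + i" e]
    by (simp add: shift_word_in)
next
  case (far u v i j)
  thus ?case using braid_eq.far[of "shift_word m u" n "shift_word m v" "m + i" "m + j"]
    by (simp add: shift_word_in)
next
  case (near u v i)
  thus ?case using braid_eq.near[of "shift_word m u" n "shift_word m v" "m + i"]
    by (simp add: shift_word_in)
qed (auto intro: braid_eq.intros shift_word_in)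

lemma shift_word_0: "shift_word 0 w = w"
  by (induction w) auto

lemma wact_append_left: "w \<in> braid_words (length xs) \<Longrightarrow> wact w (xs @ ys) = wact w xs @ ys"
  by (induction w) (auto simp: swap_at_def list_update_append nth_append)

lemma wact_shift: "w \<in> braid_words (length ys) \<Longrightarrow> wact (shift_word (length xs) w) (xs @ ys) = xs @ wact w ys"
  by (induction w) (auto simp: swap_at_def list_update_append nth_append)

lemma inv_word_simps [simp]:
  "inv_word [] = []"
  "inv_word (x # w) = inv_word w @ [(fst x, \<not> snd x)]"
  "inv_word (u @ v) = inv_word v @ inv_word u"
  by (auto simp: inv_word_def split: prod.split)

lemma inv_word_in [simp]: "inv_word w \<in> braid_words k \<longleftrightarrow> w \<in> braid_words k"
  by (induction w) auto

lemma inv_word_inv_word [simp]: "inv_word (inv_word w) = w"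
  by (induction w) auto

lemma inv_word_left: "w \<in> braid_words k \<Longrightarrow> braid_eq k (inv_word w @ w) []"
proof (induction w)
  case (Cons x w)
  hence "braid_eq k (inv_word w @ [(fst x, \<not> snd x), (fst x, \<not> \<not> snd x)] @ w) (inv_word w @ w)"
    by (intro braid_eq.cancel) auto
  thus ?case using Cons by (cases x) (auto intro: braid_eq.trans)
qed (auto intro: braid_eq.intros)

lemma inv_word_right: "w \<in> braid_words k \<Longrightarrow> braid_eq k (w @ inv_word w) []"
  using inv_word_left[of "inv_word w" k] by simp

section \<open>Block braids\<close>

text \<open>
  Two positive words that use disjoint ranges of strands commute; the bounds of the range make this
  condition easy to state.
\<close>

definition pos_word :: "nat \<Rightarrow> nat \<Rightarrow> braid_word \<Rightarrow> bool" where
  "pos_word m n w \<longleftrightarrow> (\<forall>x \<in> set w. m \<le> fst x \<and> Suc (fst x) < n \<and> snd x)"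

lemma pos_word_simps [simp]:
  "pos_word m n []" "pos_word m n (x # w) \<longleftrightarrow> m \<le> fst x \<and> Suc (fst x) < n \<and> snd x \<and> pos_word m n w"
  "pos_word m n (u @ v) \<longleftrightarrow> pos_word m n u \<and> pos_word m n v"
  by (auto simp: pos_word_def)

lemma pos_word_mono: "\<lbrakk>pos_word m n w; m' \<le> m; n \<le> n'\<rbrakk> \<Longrightarrow> pos_word m' n' w"
  by (auto simp: pos_word_def)

lemma pos_word_in: "\<lbrakk>pos_word m n w; n \<le> k\<rbrakk> \<Longrightarrow> w \<in> braid_words k"
  by (induction w) auto

text \<open>
  The relation \<open>far\<close> is assumed for positive letters only, which is enough: all words that have to be
  commuted are block crossings.
\<close>

lemma braid_eq_commute:
  assumes "pos_word l m u" "pos_word m n v" "n \<le> k" "m \<le> n"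
  shows "braid_eq k (u @ v) (v @ u)"
proof -
  have one: "braid_eq k (x # v) (v @ [x])" if "pos_word l m [x]" for x
    using assms(2)
  proof (induction v)
    case (Cons y v)
    have w: "v \<in> braid_words k" using Cons.prems assms by (auto intro: pos_word_in)
    have "braid_eq k ([] @ [(fst x, True), (fst y, True)] @ v) ([] @ [(fst y, True), (fst x, True)] @ v)"
      using Cons.prems assms that w by (intro braid_eq.far) auto
    moreover have "(fst x, True) = x" "(fst y, True) = y" using that Cons.prems by (auto simp: prod_eq_iff)
    ultimately have "braid_eq k (x # y # v) ([y] @ (x # v))" by simp
    also have "braid_eq k ([y] @ (x # v)) ([y] @ (v @ [x]))"
      using Cons assms by (intro braid_eq_pre) auto
    finally show ?case by simp
  qed (use that assms in \<open>auto intro: braid_eq.refl\<close>)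
  have wv: "v \<in> braid_words k" using assms by (auto intro: pos_word_in)
  show ?thesis using assms(1)
  proof (induction u)
    case (Cons x u)
    have wu: "u \<in> braid_words k" "[x] \<in> braid_words k"
      using Cons.prems assms by (auto intro: pos_word_in)
    have "braid_eq k ([x] @ (u @ v)) ([x] @ (v @ u))"
      using Cons wu by (intro braid_eq_pre) auto
    also have "[x] @ (v @ u) = (x # v) @ u" by simp
    also have "braid_eq k \<dots> ((v @ [x]) @ u)"
      using Cons.prems wu by (intro braid_eq_post one) auto
    finally show ?case by simp
  qed (use wv in \<open>auto intro: braid_eq.refl\<close>)
qed

text \<open>
  One strand in position \<open>m\<close> passing across the following block of \<open>q\<close> strands.
\<close>

definition row_word :: "nat \<Rightarrow> nat \<Rightarrow> braid_word" where
  "row_word m q = map (\<lambda>t. (m + t, True)) (rev [0..<q])"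

lemma row_word_simps [simp]:
  "row_word m 0 = []" "row_word m (Suc q) = (m + q, True) # row_word m q"
  by (simp_all add: row_word_def)

lemma row_word_add: "row_word m (q + r) = row_word (m + q) r @ row_word m q"
  by (induction r) (auto simp: add.assoc)

lemma cross_word_simps [simp]:
  "cross_word m 0 q = []" "cross_word m (Suc p) q = row_word m q @ cross_word (Suc m) p q"
proof -
  have "[0..<Suc p] = 0 # map Suc [0..<p]" by (simp add: upt_conv_Cons map_Suc_upt del: upt_Suc)
  thus "cross_word m (Suc p) q = row_word m q @ cross_word (Suc m) p q"
    by (simp add: cross_word_def row_word_def o_def del: upt_Suc)
qed (simp add: cross_word_def)

lemma pos_row_word: "pos_word m (Suc (m + q)) (row_word m q)"
  by (auto simp: pos_word_def row_word_def)

lemma pos_cross_word: "pos_word m (m + p + q) (cross_word m p q)"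
proof (induction p arbitrary: m)
  case (Suc p)
  show ?case using pos_row_word[of m q] Suc[of "Suc m"] 
    by (auto elim!: pos_word_mono)
qed simp

lemma cross_word_in: "m + p + q \<le> k \<Longrightarrow> cross_word m p q \<in> braid_words k"
  by (rule pos_word_in[OF pos_cross_word]) auto

lemma row_word_in: "m + q < k \<Longrightarrow> row_word m q \<in> braid_words k"
  by (rule pos_word_in[OF pos_row_word]) auto

text \<open>
  Each strand of the first block crosses the two other blocks one after the other. Sorting the letters
  by the second and the third block only needs commutations of distant letters.
\<close>

lemma cross_word_hexagon:
  assumes "m + p + q + r \<le> k"
  shows "braid_eq k (cross_word m p (q + r)) (cross_word (m + q) p r @ cross_word m p q)"
  using assms
proof (induction p arbitrary: m)
  case (Suc p)
  let ?R = "row_word (m + q) r" and ?Q = "row_word m q"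
    and ?X = "cross_word (Suc m + q) p r" and ?Y = "cross_word (Suc m) p q"
  have w: "?R \<in> braid_words k" "?Q \<in> braid_words k" "?X \<in> braid_words k" "?Y \<in> braid_words k"
    using Suc.prems by (auto intro!: row_word_in cross_word_in)
  have "braid_eq k (?R @ (?Q @ cross_word (Suc m) p (q + r))) (?R @ (?Q @ (?X @ ?Y)))"
    using w Suc.IH[of "Suc m"] Suc.prems by (intro braid_eq_pre) auto
  also have "?R @ (?Q @ (?X @ ?Y)) = ?R @ ((?Q @ ?X) @ ?Y)" by simp
  also have "braid_eq k \<dots> (?R @ ((?X @ ?Q) @ ?Y))"
    using w Suc.prems pos_cross_word[of "Suc m + q" p r] pos_row_word[of m q]
    by (intro braid_eq_pre braid_eq_post braid_eq_commute[of m "Suc (m + q)" _ "Suc m + q + p + r"]) auto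
  finally show ?case by (simp add: row_word_add)
qed (auto intro: braid_eq.refl)

text \<open>
  A strand slides over a crossing of the strands that it passes; this is where Artin's relation is used.
\<close>

lemma row_word_natural:
  assumes "Suc i < q" "m + q < k"
  shows "braid_eq k (row_word m q @ [(Suc (m + i), True)]) ((m + i, True) # row_word m q)"
proof -
  define r where "r = q - (i + 2)"
  hence q: "q = (i + 2) + r" using assms(1) by simp
  let ?A = "row_word (m + i + 2) r" and ?B = "row_word m i"
  let ?x = "(m + i, True)" and ?y = "(Suc (m + i), True)"
  have row: "row_word m q = ?A @ [?y, ?x] @ ?B"
    unfolding q by (subst row_word_add) (simp add: add.assoc)
  have w: "?A \<in> braid_words k" "?B \<in> braid_words k" "[?x] \<in> braid_words k" "[?y] \<in> braid_words k"
    using assms q by (auto intro!: row_word_in)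
  have "braid_eq k ((?A @ [?y, ?x]) @ (?B @ [?y])) ((?A @ [?y, ?x]) @ ([?y] @ ?B))"
    using assms q w pos_row_word[of m i]
    by (intro braid_eq_pre braid_eq_commute[of m "Suc (m + i)" _ k]) auto
  also have "\<dots> = ?A @ [?y, ?x, ?y] @ ?B" by simp
  also have "braid_eq k \<dots> (?A @ [?x, ?y, ?x] @ ?B)"
    using w assms by (intro braid_eq.sym[OF braid_eq.near]) auto
  also have "\<dots> = (?A @ [?x]) @ ([?y, ?x] @ ?B)" by simp
  also have "braid_eq k \<dots> (([?x] @ ?A) @ ([?y, ?x] @ ?B))"
    using assms q w pos_row_word[of "m + i + 2" r]
    by (intro braid_eq_post braid_eq.sym[OF braid_eq_commute[of "m + i" "m + i + 2" _ "Suc (m + i + 2 + r)"]]) auto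
  finally show ?thesis unfolding row by simp
qed

lemma cross_word_natural_letter:
  assumes "Suc i < q" "m + p + q \<le> k"
  shows "braid_eq k (cross_word m p q @ [(m + p + i, True)]) ((m + i, True) # cross_word m p q)"
  using assms(2)
proof (induction p arbitrary: m)
  case 0
  thus ?case using assms(1) by (auto intro!: braid_eq.refl)
next
  case (Suc p)
  let ?R = "row_word m q" and ?X = "cross_word (Suc m) p q"
  have w: "?R \<in> braid_words k" "?X \<in> braid_words k"
    using Suc.prems by (auto intro!: row_word_in cross_word_in)
  have "braid_eq k (?R @ (?X @ [(Suc m + p + i, True)])) (?R @ ((Suc m + i, True) # ?X))"
    using w Suc by (intro braid_eq_pre Suc.IH) auto
  also have "\<dots> = (?R @ [(Suc (m + i), True)]) @ ?X" by simp
  also have "braid_eq k \<dots> (((m + i, True) # ?R) @ ?X)"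
    using w Suc.prems assms(1) by (intro braid_eq_post row_word_natural) auto
  finally show ?case by simp
qed

lemma cross_word_natural:
  assumes "pos_word 0 q w" "m + p + q \<le> k"
  shows "braid_eq k (cross_word m p q @ shift_word (m + p) w) (shift_word m w @ cross_word m p q)"
  using assms(1)
proof (induction w)
  case Nil
  thus ?case using assms(2) by (auto intro!: braid_eq.refl cross_word_in)
next
  case (Cons x w)
  let ?X = "cross_word m p q"
  have w: "w \<in> braid_words q" "?X \<in> braid_words k" using Cons.prems assms(2)
    by (auto intro: pos_word_in cross_word_in)
  have wn: "shift_word n w \<in> braid_words k" if "n + q \<le> k" for n
    using w(1) that by (rule shift_word_in)
  have "braid_eq k ((?X @ [(m + p + fst x, True)]) @ shift_word (m + p) w)
         (((m + fst x, True) # ?X) @ shift_word (m + p) w)"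
    using Cons.prems assms(2) by (intro braid_eq_post cross_word_natural_letter wn) auto
  also have "\<dots> = [(m + fst x, True)] @ (?X @ shift_word (m + p) w)" by simp
  also have "braid_eq k \<dots> ([(m + fst x, True)] @ (shift_word m w @ ?X))"
    using Cons assms(2) by (intro braid_eq_pre) auto
  finally show ?case using Cons.prems by simp
qed

lemma shift_cross_word: "shift_word n (cross_word m p q) = cross_word (n + m) p q"
proof (induction p arbitrary: m)
  case (Suc p)
  have "shift_word n (row_word m q) = row_word (n + m) q" by (induction q) (auto simp: add.assoc)
  thus ?case using Suc[of "Suc m"] by simp
qed simp

text \<open>
  As in every braided monoidal category, the Yang-Baxter equation for blocks follows from one hexagon and
  naturality.
\<close>

lemma cross_word_yang_baxter:
  assumes "m + p + q + r \<le> k"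
  shows "braid_eq k (cross_word m q r @ cross_word (m + q) p r @ cross_word m p q)
                    (cross_word (m + r) p q @ cross_word m p r @ cross_word (m + p) q r)"
proof -
  have w: "cross_word m q r \<in> braid_words k" "cross_word (m + p) q r \<in> braid_words k"
    using assms by (auto intro!: cross_word_in)
  have "braid_eq k (cross_word m q r @ (cross_word (m + q) p r @ cross_word m p q))
                   (cross_word m q r @ cross_word m p (q + r))"
    using assms w by (intro braid_eq_pre braid_eq.sym[OF cross_word_hexagon]) auto
  also have "braid_eq k \<dots> (cross_word m p (q + r) @ cross_word (m + p) q r)"
    using cross_word_natural[of "q + r" "cross_word 0 q r" m p k] assms pos_cross_word[of 0 q r]
    by (simp add: shift_cross_word add.assoc braid_eq.sym)
  also have "braid_eq k (cross_word m p (q + r) @ cross_word (m + p) q r)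
       ((cross_word (m + r) p q @ cross_word m p r) @ cross_word (m + p) q r)"
    using assms w cross_word_hexagon[of m p r q k] by (intro braid_eq_post) (auto simp: add.commute)
  finally show ?thesis by simp
qed

lemma block_letter_split [simp]:
  "block_letter (L @ p # q # S) (length L, True) = cross_word (sum_list L) p q"
  "block_letter (L @ p # q # S) (length L, False) = inv_word (cross_word (sum_list L) q p)"
  by (simp_all add: nth_append)

lemma block_word_Cons:
  "\<lbrakk>length ks = n; w \<in> braid_words n\<rbrakk> \<Longrightarrow>
    block_word ks (x # w) = block_letter (wact w ks) x @ block_word ks w"
  by (simp add: wact_eq_place)

declare block_letter.simps [simp del] block_word.simps(2) [simp del]

lemma block_word_append:
  "\<lbrakk>length ks = n; u \<in> braid_words n; v \<in> braid_words n\<rbrakk> \<Longrightarrow>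
    block_word ks (u @ v) = block_word (wact v ks) u @ block_word ks v"
  by (induction u) (auto simp: block_word_Cons[of _ n] wact_append)

lemma sum_list_swap_at: "Suc i < length ks \<Longrightarrow> sum_list (swap_at i ks) = sum_list (ks :: nat list)"
  by (erule split_two) auto

lemma sum_list_wact: "w \<in> braid_words (length ks) \<Longrightarrow> sum_list (wact w ks) = sum_list (ks :: nat list)"
  by (induction w) (auto simp: sum_list_swap_at)

lemma block_letter_in:
  assumes "Suc (fst x) < length ks" "sum_list ks \<le> k"
  shows "block_letter ks x \<in> braid_words k"
proof -
  obtain L p q S where "ks = L @ p # q # S" "length L = fst x"
    by (rule split_two[OF assms(1)])
  thus ?thesis using assms(2) 
    by (cases x; cases "snd x") (auto intro!: cross_word_in)
qed

lemma block_word_in: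
  assumes "w \<in> braid_words (length ks)" "sum_list ks = k"
  shows "block_word ks w \<in> braid_words k"
  using assms by (induction w) (auto simp: block_word_Cons sum_list_wact intro!: block_letter_in)

lemma block_word_cancel:
  assumes "Suc i < length ks"
  shows "braid_eq (sum_list ks) (block_word ks [(i, e), (i, \<not> e)]) []"
proof -
  obtain L p q S where ks: "ks = L @ p # q # S" "length L = i"
    by (rule split_two[OF assms(1)])
  show ?thesis unfolding ks(1) ks(2)[symmetric]
    by (cases e) (auto simp: block_word_Cons intro!: inv_word_left inv_word_right cross_word_in)
qed

lemma block_word_far:
  assumes "Suc i < j" "Suc j < length ks"
  shows "braid_eq (sum_list ks) (block_word ks [(i, True), (j, True)]) (block_word ks [(j, True), (i, True)])"
proof -
  obtain K c d S where ks: "ks = K @ c # d # S" "length K = j"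
    by (rule split_two[OF assms(2)])
  have "Suc i < length K" using assms ks by simp
  then obtain L a b M where K: "K = L @ a # b # M" "length L = i"
    by (rule split_two)
  have j: "j = length (L @ a # b # M)" "j = length (L @ b # a # M)" using K ks by auto
  have sw: "swap_at j ks = L @ a # b # M @ d # c # S" 
    unfolding j(1) ks K using swap_at_append[of "L @ a # b # M" c d S] by simp
  have sw': "swap_at i ks = L @ b # a # M @ c # d # S"
    unfolding ks K(2)[symmetric] K(1) by simp
  have bl: "block_letter ks (i, True) = cross_word (sum_list L) a b"
       "block_letter (swap_at j ks) (i, True) = cross_word (sum_list L) a b"
    unfolding sw unfolding ks(1) K(2)[symmetric] K(1) by simp_all
  have bl': "block_letter ks (j, True) = cross_word (sum_list (L @ a # b # M)) c d"
       "block_letter (swap_at i ks) (j, True) = cross_word (sum_list (L @ a # b # M)) c d"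
    unfolding sw' using block_letter_split(1)[of "L @ a # b # M" c d S] 
      block_letter_split(1)[of "L @ b # a # M" c d S] ks K j by (simp_all add: add_ac)
  have "braid_eq (sum_list ks) (cross_word (sum_list L) a b @ cross_word (sum_list (L @ a # b # M)) c d)
    (cross_word (sum_list (L @ a # b # M)) c d @ cross_word (sum_list L) a b)"
    using pos_cross_word[of "sum_list L" a b] pos_cross_word[of "sum_list (L @ a # b # M)" c d]
    by (intro braid_eq_commute[of "sum_list L" "sum_list (L @ a # b # M)" _ "sum_list (L @ a # b # M) + c + d"])
       (auto simp: ks K elim: pos_word_mono)
  thus ?thesis using assms by (simp add: block_word_Cons bl bl')
qed

lemma block_word_near:
  assumes "Suc (Suc i) < length ks"
  shows "braid_eq (sum_list ks) (block_word ks [(i, True), (Suc i, True), (i, True)])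
           (block_word ks [(Suc i, True), (i, True), (Suc i, True)])"
proof -
  obtain L a b S' where ks': "ks = L @ a # b # S'" "length L = i"
    by (rule split_two[OF Suc_lessD[OF assms]])
  then obtain c S where ks: "ks = L @ a # b # c # S" using assms by (cases S') auto
  have bl: "block_letter (L @ x # y # z # S) (Suc (length L), True) = cross_word (sum_list L + x) y z" for x y z
    using block_letter_split(1)[of "L @ [x]" y z S] by simp
  show ?thesis unfolding ks ks'(2)[symmetric]
    using cross_word_yang_baxter[of "sum_list L" a b c]
    by (simp add: block_word_Cons bl)
qed

text \<open>
  Replacing strands by blocks turns the relations of \<open>B\<^sub>n\<close> into the cancellation of inverse words, the
  commutation of distant block crossings and the Yang-Baxter equation for blocks. So block braids are well
  defined.
\<close>

lemma block_word_cong: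
  "\<lbrakk>braid_eq n u v; length ks = n\<rbrakk> \<Longrightarrow>
    braid_eq (sum_list ks) (block_word ks u) (block_word ks v)"
proof (induction rule: braid_eq.induct)
  have ctx: "braid_eq (sum_list ks) (block_word ks (u @ a @ v)) (block_word ks (u @ b @ v))"
    if w: "u \<in> braid_words n" "v \<in> braid_words n" "braid_eq n a b" "length ks = n" and
      ab: "braid_eq (sum_list (wact v ks)) (block_word (wact v ks) a) (block_word (wact v ks) b)"
    for u v a b
  proof -
    have ab': "a \<in> braid_words n" "b \<in> braid_words n" "wact a (wact v ks) = wact b (wact v ks)"
      using braid_eq_words[OF w(3)] wact_cong[OF w(3), of "wact v ks"] w by auto
    show ?thesis
      using w ab' ab by (auto simp: block_word_append[of _ n] sum_list_wact wact_append
           intro!: braid_eq_pre braid_eq_post block_word_in)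
  qed
  {
    case (cancel u v i e)
    thus ?case using ctx[of u v "[(i, e), (i, \<not> e)]" "[]"] braid_eq.cancel[of "[]" n "[]" i e]
      by (simp add: block_word_cancel)
  next
    case (far u v i j)
    thus ?case using ctx[of u v "[(i, True), (j, True)]" "[(j, True), (i, True)]"]
        braid_eq.far[of "[]" n "[]" i j]
      by (simp add: block_word_far)
  next
    case (near u v i)
    thus ?case using ctx[of u v "[(i, True), (Suc i, True), (i, True)]" "[(Suc i, True), (i, True), (Suc i, True)]"]
        braid_eq.near[of "[]" n "[]" i]
      by (simp add: block_word_near)
  }
qed (auto intro: braid_eq.intros block_word_in)

lemma wact_inv_word: "w \<in> braid_words (length xs) \<Longrightarrow> wact (inv_word w) (wact w xs) = xs"
  using wact_cong[OF inv_word_left, of w "length xs" xs] by (simp add: wact_append)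

lemma wact_row_word: "wact (row_word (length L) (length Q)) (L @ a # Q @ S) = L @ Q @ a # S"
proof (induction Q arbitrary: S rule: rev_induct)
  case (snoc b Q)
  thus ?case using snoc[of "b # S"] swap_at_append[of "L @ Q" a b S] by simp
qed simp

lemma wact_cross_word:
  "wact (cross_word (length L) (length P) (length Q)) (L @ P @ Q @ S) = L @ Q @ P @ S"
proof (induction P arbitrary: L)
  case (Cons a P)
  thus ?case using Cons[of "L @ [a]"] wact_row_word[of L Q a "P @ S"] by (simp add: wact_append)
qed simp

lemma wact_block_letter:
  assumes "Suc (fst x) < length xss"
  shows "wact (block_letter (map length xss) x) (concat xss) = concat (swap_at (fst x) xss)"
proof -
  obtain L P Q S where xss: "xss = L @ P # Q # S" "length L = fst x"
    by (rule split_two[OF assms])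
  have sl: "sum_list (map length L) = length (concat L)" by (simp add: length_concat)
  have T: "block_letter (map length xss) (fst x, True) = cross_word (length (concat L)) (length P) (length Q)"
    and F: "block_letter (map length xss) (fst x, False) =
        inv_word (cross_word (length (concat L)) (length Q) (length P))"
    using block_letter_split[of "map length L" "length P" "length Q" "map length S"] xss
    by (simp_all add: sl)
  have sw: "swap_at (fst x) xss = L @ Q # P # S" using xss by (metis swap_at_append)
  show ?thesis
  proof (cases "snd x")
    case True
    hence "x = (fst x, True)" by (simp add: prod_eq_iff)
    hence "block_letter (map length xss) x = cross_word (length (concat L)) (length P) (length Q)"
      using T by metis
    thus ?thesis using wact_cross_word[of "concat L" P Q "concat S"] by (simp add: sw[unfolded xss(1)] xss(1))
  next
    case False
    hence "x = (fst x, False)" by (simp add: prod_eq_iff)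
    hence "block_letter (map length xss) x = inv_word (cross_word (length (concat L)) (length Q) (length P))"
      using F by metis
    thus ?thesis using wact_cross_word[of "concat L" Q P "concat S"] 
       wact_inv_word[of "cross_word (length (concat L)) (length Q) (length P)" "concat L @ Q @ P @ concat S"]
      by (simp add: sw[unfolded xss(1)] xss(1) cross_word_in)
  qed
qed

lemma wact_block_word:
  assumes "w \<in> braid_words (length xss)"
  shows "wact (block_word (map length xss) w) (concat xss) = concat (wact w xss)"
  using assms
proof (induction w)
  case (Cons x w)
  hence "wact w (map length xss) = map length (wact w xss)" by (simp add: map_wact)
  thus ?case using Cons
    by (simp add: block_word_Cons[of _ "length xss"] wact_append wact_block_letter)
qed simp

lemma word_juxt_Cons [simp]: "word_juxt (k # ks) (w # ws) = w @ shift_word k (word_juxt ks ws)"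
  by (simp add: shift_word_def)

declare word_juxt.simps(1) [simp del]

lemma word_juxt_in:
  "list_all2 (\<lambda>k w. w \<in> braid_words k) ks ws \<Longrightarrow> word_juxt ks ws \<in> braid_words (sum_list ks)"
  by (induction rule: list_all2_induct) (auto intro: braid_words_mono shift_word_in)

lemma wact_word_juxt:
  "list_all2 (\<lambda>xs w. w \<in> braid_words (length xs)) xss ws \<Longrightarrow>
    wact (word_juxt (map length xss) ws) (concat xss) = concat (map2 wact ws xss)"
proof (induction rule: list_all2_induct)
  case (Cons xs xss w ws)
  have "word_juxt (map length xss) ws \<in> braid_words (length (concat xss))"
    using Cons word_juxt_in[of "map length xss" ws] by (simp add: list_all2_map1 length_concat)
  thus ?case using Cons by (simp add: wact_append wact_append_left wact_shift)
qed simp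

lemma word_juxt_cong:
  assumes "length us = length ks" "length vs = length ks"
    "\<And>i. i < length ks \<Longrightarrow> braid_eq (ks ! i) (us ! i) (vs ! i)"
  shows "braid_eq (sum_list ks) (word_juxt ks us) (word_juxt ks vs)"
  using assms
proof (induction ks arbitrary: us vs)
  case (Cons k ks)
  obtain u us' v vs' where e: "us = u # us'" "vs = v # vs'"
    using Cons.prems by (metis Suc_length_conv length_Cons)
  have "braid_eq (sum_list ks) (word_juxt ks us') (word_juxt ks vs')"
    using Cons.prems(1,2) Cons.prems(3)[of "Suc _"] by (intro Cons.IH) (auto simp: e)
  moreover have "braid_eq k u v" using Cons.prems(3)[of 0] by (simp add: e)
  ultimately show ?case
    using braid_eq_shift[of k u v 0 "sum_list (k # ks)"] braid_eq_shift[of "sum_list ks" _ _ k "sum_list (k # ks)"]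
    by (simp add: e shift_word_0 braid_eq_append)
qed (auto intro: braid_eq.refl)

section \<open>Braids as classes of words\<close>

lemma in_braid_class [simp]: "w \<in> braid_class k v \<longleftrightarrow> braid_eq k v w"
  by (simp add: braid_class_def)

lemma braid_class_eqI: "braid_eq k u v \<Longrightarrow> braid_class k u = braid_class k v"
  by (auto simp: braid_class_def intro: braid_eq.trans braid_eq.sym)

lemma braids_iff: "b \<in> braids k \<longleftrightarrow> (\<exists>w \<in> braid_words k. b = braid_class k w)"
  by (auto simp: braids_def quotient_def braid_class_def)

lemma braid_class_closed: "w \<in> braid_words k \<Longrightarrow> braid_class k w \<in> braids k"
  by (auto simp: braids_iff)

text \<open>
  Multiplication, juxtaposition and block braids are unions of classes over all representatives. Such a
  union is one class as soon as all representatives lead to equivalent words.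
\<close>

lemma UN_classes:
  assumes "a \<in> A" "\<And>x. x \<in> A \<Longrightarrow> braid_eq k (f a) (f x)"
  shows "(\<Union>x \<in> A. braid_class k (f x)) = braid_class k (f a)"
  using assms braid_class_eqI[OF assms(2)] by blast

lemma braid_mult_class:
  assumes "u \<in> braid_words k" "v \<in> braid_words k"
  shows "braid_mult k (braid_class k u) (braid_class k v) = braid_class k (u @ v)"
proof -
  have "braid_mult k (braid_class k u) (braid_class k v) =
      (\<Union>x \<in> braid_class k u \<times> braid_class k v. braid_class k (fst x @ snd x))"
    unfolding braid_mult_def by force
  also have "\<dots> = braid_class k (fst (u, v) @ snd (u, v))"
    using assms by (intro UN_classes) (auto intro: braid_eq.refl braid_eq_append)
  finally show ?thesis by simp
qed

lemma braid_perm_class: "w \<in> braid_words k \<Longrightarrow> braid_perm (braid_class k w) = word_perm w"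
proof -
  assume "w \<in> braid_words k"
  hence "word_perm ` braid_class k w = {word_perm w}"
    by (auto simp: word_perm_cong image_iff intro!: bexI[of _ w] braid_eq.refl dest: word_perm_cong)
  thus ?thesis by (simp add: braid_perm_def)
qed

lemma block_braid_class:
  assumes "w \<in> braid_words n" "length ks = n" "sum_list ks = k"
  shows "block_braid ks (braid_class n w) = braid_class k (block_word ks w)"
  unfolding block_braid_def assms(3) using assms
  by (intro UN_classes) (auto intro: braid_eq.refl block_word_cong)

lemma in_listset: "xs \<in> listset As \<longleftrightarrow> length xs = length As \<and> (\<forall>i < length As. xs ! i \<in> As ! i)"
proof (induction As arbitrary: xs)
  case (Cons A As)
  show ?case by (cases xs) (auto simp: set_Cons_def Cons nth_Cons split: nat.splits)
qed simp

lemma braid_juxt_class: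
  assumes "length ws = length ks" "length bs = length ks" "sum_list ks = k"
    "\<And>i. i < length ks \<Longrightarrow> ws ! i \<in> braid_words (ks ! i) \<and> bs ! i = braid_class (ks ! i) (ws ! i)"
  shows "braid_juxt ks bs = braid_class k (word_juxt ks ws)"
  unfolding braid_juxt_def assms(3) using assms
  by (intro UN_classes) (auto simp: in_listset intro!: braid_eq.refl word_juxt_cong)

section \<open>Composition in the braid operad\<close>

text \<open>
  The target of a morphism of \<open>Br\<close> is determined by its source and its braid, so these are all morphisms
  (\<open>br_mor_arr\<close>, \<open>br_arr_cases\<close>).
\<close>

definition br_mor :: "nat \<Rightarrow> (nat \<Rightarrow> nat) \<Rightarrow> braid_word \<Rightarrow> br_arr" where
  "br_mor k \<sigma> w = (\<sigma>, braid_class k w, word_perm w \<circ> \<sigma>)"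

lemma br_category_simps [simp]:
  "ob (br_category k) = {\<sigma>. \<sigma> permutes {..<k}}"
  "src (br_category k) (\<sigma>, b, \<tau>) = \<sigma>"
  "tgt (br_category k) (\<sigma>, b, \<tau>) = \<tau>"
  "idm (br_category k) \<sigma> = br_mor k \<sigma> []"
  by (simp_all add: br_category_def br_mor_def)

lemma br_mor_arr:
  assumes "\<sigma> permutes {..<k}" "w \<in> braid_words k"
  shows "br_mor k \<sigma> w \<in> arr (br_category k)"
proof -
  have "word_perm w \<circ> \<sigma> \<circ> inv \<sigma> = word_perm w"
    using assms(1) by (simp add: comp_assoc permutes_inv_o(1))
  thus ?thesis using assms
    by (simp add: br_category_def br_mor_def braid_perm_class braid_class_closed word_perm_permutes permutes_compose)
qed

lemma br_arr_cases:
  assumes "a \<in> arr (br_category k)"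
  obtains \<sigma> w where "\<sigma> permutes {..<k}" "w \<in> braid_words k" "a = br_mor k \<sigma> w"
proof -
  obtain \<sigma> w \<tau> where a: "a = (\<sigma>, braid_class k w, \<tau>)" "\<sigma> permutes {..<k}" "w \<in> braid_words k"
      "word_perm w = \<tau> \<circ> inv \<sigma>"
    using assms by (auto simp: br_category_def braids_iff braid_perm_class)
  have "word_perm w \<circ> \<sigma> = \<tau>"
    unfolding a(4) using a(2) by (simp add: comp_assoc permutes_inv_o(2))
  thus ?thesis using that[of \<sigma> w] a by (simp add: br_mor_def)
qed

lemma br_mor_cmp:
  assumes "u \<in> braid_words k" "v \<in> braid_words k"
  shows "cmp (br_category k) (br_mor k (word_perm v \<circ> \<sigma>) u) (br_mor k \<sigma> v) = br_mor k \<sigma> (u @ v)"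
proof -
  have "word_perm (u @ v) = word_perm u \<circ> word_perm v" by (induction u) (auto simp: comp_assoc)
  thus ?thesis using assms by (simp add: br_category_def br_mor_def braid_mult_class comp_assoc)
qed

lemma br_mor_cong: "braid_eq k u v \<Longrightarrow> br_mor k \<sigma> u = br_mor k \<sigma> v"
  by (simp add: br_mor_def braid_class_eqI word_perm_cong)

lemma map2_wact_place:
  assumes "length ws = length xss" "length \<tau>s = length xss"
    "\<And>i. i < length xss \<Longrightarrow> \<tau>s ! i permutes {..<length (xss ! i)} \<and> ws ! i \<in> braid_words (length (xss ! i))"
  shows "map2 wact ws (map2 place \<tau>s xss) = map2 place (map2 (\<lambda>w \<tau>. word_perm w \<circ> \<tau>) ws \<tau>s) xss"
  using assms by (intro nth_equalityI) (auto simp: wact_eq_place place_comp word_perm_permutes)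

lemma
  assumes "\<sigma> permutes {..<length xss}" "length \<tau>s = length xss" "length ws = length xss"
    "\<And>i. i < length xss \<Longrightarrow> \<tau>s ! i permutes {..<length (xss ! i)} \<and> ws ! i \<in> braid_words (length (xss ! i))"
    "w \<in> braid_words (length xss)"
  defines "ks' \<equiv> place \<sigma> (map length xss)"
  defines "v \<equiv> block_word ks' w @ word_juxt ks' (place \<sigma> ws)"
  shows composite_word_in: "v \<in> braid_words (length (concat xss))"
      "word_juxt ks' (place \<sigma> ws) \<in> braid_words (length (concat xss))"
      "block_word ks' w \<in> braid_words (length (concat xss))"
    and wact_composite_word: "wact v (concat (place \<sigma> (map2 place \<tau>s xss))) =
      concat (place (word_perm w \<circ> \<sigma>) (map2 place (map2 (\<lambda>w \<tau>. word_perm w \<circ> \<tau>) ws \<tau>s) xss))"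
    and wact_composite_juxt: "wact (word_juxt ks' (place \<sigma> ws)) (concat (place \<sigma> (map2 place \<tau>s xss))) =
      concat (place \<sigma> (map2 place (map2 (\<lambda>w \<tau>. word_perm w \<circ> \<tau>) ws \<tau>s) xss))"
proof -
  let ?yss = "place \<sigma> (map2 place \<tau>s xss)"
  let ?zss = "map2 place (map2 (\<lambda>w \<tau>. word_perm w \<circ> \<tau>) ws \<tau>s) xss"
  have my: "map length ?yss = ks'" 
    unfolding ks'_def using assms(1-4) by (intro map_length_yss) auto
  have s: "sum_list ks' = length (concat xss)"
    using length_concat_yss[of \<sigma> xss \<tau>s] assms(1-4) my by (simp add: length_concat)
  have lk: "length ks' = length xss" by (simp add: ks'_def)
  have all: "list_all2 (\<lambda>xs w. w \<in> braid_words (length xs)) ?yss (place \<sigma> ws)"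
    unfolding list_all2_conv_all_nth
  proof (intro conjI allI impI)
    fix q assume "q < length ?yss"
    hence "q = \<sigma> (inv \<sigma> q)" "inv \<sigma> q < length xss"
      using permutes_bounds(3,5)[OF assms(1), of q] assms(2) by simp_all
    then obtain i where i: "q = \<sigma> i" "i < length xss" by blast
    show "place \<sigma> ws ! q \<in> braid_words (length (?yss ! q))"
      using assms(1-4) i(2) unfolding i(1) by (simp add: place_nth)
  qed (use assms in simp)
  have j: "word_juxt ks' (place \<sigma> ws) \<in> braid_words (sum_list ks')"
    unfolding my[symmetric] using all by (intro word_juxt_in) (simp add: list_all2_map1)
  have "wact (word_juxt ks' (place \<sigma> ws)) (concat ?yss) = concat (map2 wact (place \<sigma> ws) ?yss)"
    using wact_word_juxt[OF all] my by simp
  also have "map2 wact (place \<sigma> ws) ?yss = place \<sigma> (map2 wact ws (map2 place \<tau>s xss))"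
    using assms(1-3) by (simp add: place_map2)
  also have "map2 wact ws (map2 place \<tau>s xss) = ?zss"
    using assms(2-4) by (intro map2_wact_place) auto
  finally show J: "wact (word_juxt ks' (place \<sigma> ws)) (concat ?yss) = concat (place \<sigma> ?zss)" .
  have mz: "map length (place \<sigma> ?zss) = ks'"
    unfolding ks'_def using assms(1-4) 
    by (intro map_length_yss) (auto intro!: permutes_compose word_perm_permutes)
  have lz: "length (place \<sigma> ?zss) = length xss" using assms(2,3) by simp
  have "wact (block_word ks' w) (concat (place \<sigma> ?zss)) = concat (wact w (place \<sigma> ?zss))"
    using wact_block_word[of w "place \<sigma> ?zss"] assms(5) lz mz by simp
  also have "wact w (place \<sigma> ?zss) = place (word_perm w \<circ> \<sigma>) ?zss"
    using assms(1-3,5) by (simp add: wact_eq_place place_comp word_perm_permutes)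
  finally show "wact v (concat ?yss) = concat (place (word_perm w \<circ> \<sigma>) ?zss)"
    by (simp only: v_def wact_append J)
  have b: "block_word ks' w \<in> braid_words (sum_list ks')" using assms(5) lk by (simp add: block_word_in)
  show "v \<in> braid_words (length (concat xss))"
      "word_juxt ks' (place \<sigma> ws) \<in> braid_words (length (concat xss))"
      "block_word ks' w \<in> braid_words (length (concat xss))"
    using j b s by (simp_all add: v_def)
qed

text \<open>
  The composite of morphisms given by words is given by a word. Its underlying permutation is identified
  by its effect on a list of distinct entries, using that block words permute the blocks and juxtaposed words
  permute inside the blocks.
\<close>

lemma br_comp2_br_mor:
  assumes "\<sigma> permutes {..<length ks}" "w \<in> braid_words (length ks)"
    "length \<tau>s = length ks" "length ws = length ks" "length as = length ks"
    "\<And>i. i < length ks \<Longrightarrow> \<tau>s ! i permutes {..<ks ! i} \<and> ws ! i \<in> braid_words (ks ! i) \<and>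
       as ! i = br_mor (ks ! i) (\<tau>s ! i) (ws ! i)"
  defines "ks' \<equiv> place \<sigma> ks"
  defines "v \<equiv> block_word ks' w @ word_juxt ks' (place \<sigma> ws)"
  shows "br_comp2 ks (br_mor (length ks) \<sigma> w) as = br_mor (sum_list ks) (br_comp ks \<sigma> \<tau>s) v"
    and "v \<in> braid_words (sum_list ks)"
    and "word_perm v \<circ> br_comp ks \<sigma> \<tau>s =
      br_comp ks (word_perm w \<circ> \<sigma>) (map2 (\<lambda>w \<tau>. word_perm w \<circ> \<tau>) ws \<tau>s)"
proof -
  define xss where "xss = chunks ks [0..<sum_list ks]"
  have k: "map length xss = ks" "concat xss = [0..<sum_list ks]" "length xss = length ks"
    by (simp_all add: xss_def map_length_chunks concat_chunks)
  have kn: "length (xss ! i) = ks ! i" if "i < length ks" for i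
    using that k(1) by (metis length_map nth_map)
  let ?\<tau>s' = "map2 (\<lambda>w \<tau>. word_perm w \<circ> \<tau>) ws \<tau>s"
  have sums: "sum_list ks' = sum_list ks"
    unfolding ks'_def using assms(1) by (metis mset_permute_list permutes_inv sum_mset_sum_list)
  have ms: "map fst as = \<tau>s" "map (snd \<circ> snd) as = ?\<tau>s'"
    using assms by (auto intro!: nth_equalityI simp: br_mor_def)
  note comp = composite_word_in[of \<sigma> xss \<tau>s ws w] wact_composite_word[of \<sigma> xss \<tau>s ws w]
  show v: "v \<in> braid_words (sum_list ks)"
    using comp(1) assms k kn unfolding v_def ks'_def by simp
  have ll: "word_juxt ks' (place \<sigma> ws) \<in> braid_words (sum_list ks)" 
    "block_word ks' w \<in> braid_words (sum_list ks)" using v by (simp_all add: v_def)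
  have p1: "br_comp ks \<sigma> \<tau>s permutes {..<sum_list ks}"
    using assms by (intro br_comp_permutes) auto
  have pt: "word_perm (ws ! i) \<circ> \<tau>s ! i permutes {..<ks ! i}" if "i < length ks" for i
    using assms(6)[OF that] by (intro permutes_compose word_perm_permutes) auto
  have pw: "word_perm w \<circ> \<sigma> permutes {..<length ks}"
    using assms by (intro permutes_compose word_perm_permutes) auto
  have p2: "br_comp ks (word_perm w \<circ> \<sigma>) ?\<tau>s' permutes {..<sum_list ks}"
    using assms pt pw by (intro br_comp_permutes) auto
  show eq: "word_perm v \<circ> br_comp ks \<sigma> \<tau>s = br_comp ks (word_perm w \<circ> \<sigma>) ?\<tau>s'"
  proof (rule permutes_eqI_place[of _ "sum_list ks"])
    have "place (word_perm v \<circ> br_comp ks \<sigma> \<tau>s) (concat xss) = wact v (place (br_comp ks \<sigma> \<tau>s) (concat xss))"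
      using p1 v k by (simp add: place_comp word_perm_permutes wact_eq_place)
    also have "\<dots> = wact v (concat (place \<sigma> (map2 place \<tau>s xss)))"
      using place_br_comp[of \<sigma> xss \<tau>s] assms k kn by simp
    also have "\<dots> = concat (place (word_perm w \<circ> \<sigma>) (map2 place ?\<tau>s' xss))"
      using comp(4) assms k kn unfolding v_def ks'_def by simp
    also have "\<dots> = place (br_comp ks (word_perm w \<circ> \<sigma>) ?\<tau>s') (concat xss)"
      using place_br_comp[of "word_perm w \<circ> \<sigma>" xss ?\<tau>s'] assms k kn pw pt by simp
    finally show "place (word_perm v \<circ> br_comp ks \<sigma> \<tau>s) [0..<sum_list ks] =
       place (br_comp ks (word_perm w \<circ> \<sigma>) ?\<tau>s') [0..<sum_list ks]" using k by simp
  qed (use p1 p2 v in \<open>auto intro!: permutes_compose word_perm_permutes\<close>)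
  have juxt: "braid_juxt ks' (place \<sigma> (map (fst \<circ> snd) as)) = braid_class (sum_list ks) (word_juxt ks' (place \<sigma> ws))"
  proof (rule braid_juxt_class)
    fix q assume "q < length ks'"
    hence "q = \<sigma> (inv \<sigma> q)" "inv \<sigma> q < length ks"
      using permutes_bounds(3,5)[OF assms(1), of q] by (simp_all add: ks'_def)
    then obtain i where i: "q = \<sigma> i" "i < length ks" by blast
    show "place \<sigma> ws ! q \<in> braid_words (ks' ! q) \<and>
        place \<sigma> (map (fst \<circ> snd) as) ! q = braid_class (ks' ! q) (place \<sigma> ws ! q)"
      using assms i(2) unfolding i(1) by (simp add: place_nth br_mor_def)
  qed (use assms sums in auto)
  have block: "block_braid ks' (braid_class (length ks) w) = braid_class (sum_list ks) (block_word ks' w)"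
    using assms sums by (intro block_braid_class) auto
  show "br_comp2 ks (br_mor (length ks) \<sigma> w) as = br_mor (sum_list ks) (br_comp ks \<sigma> \<tau>s) v"
    using eq juxt block ms ll
    by (simp add: br_comp2_def br_mor_def Let_def braid_mult_class flip: ks'_def) (simp add: v_def)
qed

section \<open>Calculating in strict monoidal categories\<close>

context category
begin

lemma cat_simps [simp]:
  "A \<in> ob C \<Longrightarrow> idm C A \<in> arr C" "A \<in> ob C \<Longrightarrow> src C (idm C A) = A" "A \<in> ob C \<Longrightarrow> tgt C (idm C A) = A"
  "f \<in> arr C \<Longrightarrow> src C f \<in> ob C" "f \<in> arr C \<Longrightarrow> tgt C f \<in> ob C"
  "\<lbrakk>f \<in> arr C; g \<in> arr C; src C g = tgt C f\<rbrakk> \<Longrightarrow> g \<cdot> f \<in> arr C"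
  "\<lbrakk>f \<in> arr C; g \<in> arr C; src C g = tgt C f\<rbrakk> \<Longrightarrow> src C (g \<cdot> f) = src C f"
  "\<lbrakk>f \<in> arr C; g \<in> arr C; src C g = tgt C f\<rbrakk> \<Longrightarrow> tgt C (g \<cdot> f) = tgt C g"
  "\<lbrakk>f \<in> arr C; tgt C f = B\<rbrakk> \<Longrightarrow> idm C B \<cdot> f = f"
  "\<lbrakk>f \<in> arr C; src C f = B\<rbrakk> \<Longrightarrow> f \<cdot> idm C B = f"
  using idm_closed[of A] src_closed[of f] tgt_closed[of f] cmp_closed[of f "src C f" "tgt C f" g "tgt C g"]
    cmp_idm_left[of f "src C f" "tgt C f"] cmp_idm_right[of f "src C f" "tgt C f"]
  by (auto simp: hom_def)

lemma cmp_assoc': "\<lbrakk>f \<in> arr C; g \<in> arr C; h \<in> arr C; src C g = tgt C f; src C h = tgt C g\<rbrakk>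
    \<Longrightarrow> (h \<cdot> g) \<cdot> f = h \<cdot> (g \<cdot> f)"
  using cmp_assoc[of f "src C f" "tgt C f" g "tgt C g" h "tgt C h"] by (auto simp: hom_def)

lemma iso_cancel:
  assumes "g \<in> arr C" "h \<in> arr C" "f \<in> arr C" "f' \<in> arr C"
    "h \<cdot> g = idm C (src C g)" "src C h = tgt C g" "tgt C f = src C g" "tgt C f' = src C g"
    "src C f = src C f'" "g \<cdot> f = g \<cdot> f'"
  shows "f = f'"
proof -
  have "(h \<cdot> g) \<cdot> f = h \<cdot> (g \<cdot> f)" "(h \<cdot> g) \<cdot> f' = h \<cdot> (g \<cdot> f')"
    using assms(1-4,6-9) by (auto intro: cmp_assoc')
  hence "(h \<cdot> g) \<cdot> f = (h \<cdot> g) \<cdot> f'" using assms(10) by simp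
  thus ?thesis using assms(3,4,7,8) unfolding assms(5) by simp
qed

lemma inverse_unique:
  assumes "f \<in> arr C" "g \<in> arr C" "h \<in> arr C" "src C g = tgt C f" "src C h = tgt C f"
    "tgt C g = src C f" "tgt C h = src C f" "g \<cdot> f = idm C (src C f)" "f \<cdot> h = idm C (tgt C f)"
  shows "g = h"
proof -
  have "g = g \<cdot> (f \<cdot> h)" using assms by simp
  also have "\<dots> = (g \<cdot> f) \<cdot> h" using assms by (subst cmp_assoc') auto
  finally show ?thesis using assms by simp
qed

end

locale smon = category C
  for C :: "('o, 'm, 'z) category_scheme" (structure) +
  fixes to :: "'o \<Rightarrow> 'o \<Rightarrow> 'o" and tm :: "'m \<Rightarrow> 'm \<Rightarrow> 'm" and e :: "'o"
  assumes strict: "strict_monoidal C to tm e"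
begin

lemma to_simps [simp]:
  "\<lbrakk>A \<in> ob C; B \<in> ob C\<rbrakk> \<Longrightarrow> to A B \<in> ob C" "e \<in> ob C"
  "\<lbrakk>A \<in> ob C; B \<in> ob C; D \<in> ob C\<rbrakk> \<Longrightarrow> to (to A B) D = to A (to B D)"
  "A \<in> ob C \<Longrightarrow> to e A = A" "A \<in> ob C \<Longrightarrow> to A e = A"
  using strict by (auto simp: strict_monoidal_def is_functor_def cat_prod_def)

lemma tm_simps [simp]:
  "\<lbrakk>f \<in> arr C; g \<in> arr C\<rbrakk> \<Longrightarrow> tm f g \<in> arr C"
  "\<lbrakk>f \<in> arr C; g \<in> arr C\<rbrakk> \<Longrightarrow> src C (tm f g) = to (src C f) (src C g)"
  "\<lbrakk>f \<in> arr C; g \<in> arr C\<rbrakk> \<Longrightarrow> tgt C (tm f g) = to (tgt C f) (tgt C g)"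
  "\<lbrakk>f \<in> arr C; g \<in> arr C; h \<in> arr C\<rbrakk> \<Longrightarrow> tm (tm f g) h = tm f (tm g h)"
  "f \<in> arr C \<Longrightarrow> tm (idm C e) f = f" "f \<in> arr C \<Longrightarrow> tm f (idm C e) = f"
  "\<lbrakk>A \<in> ob C; B \<in> ob C\<rbrakk> \<Longrightarrow> tm (idm C A) (idm C B) = idm C (to A B)"
  using strict by (auto simp: strict_monoidal_def is_functor_def cat_prod_def hom_def)

lemma tm_cmp:
  "\<lbrakk>f \<in> arr C; g \<in> arr C; f' \<in> arr C; g' \<in> arr C; src C g = tgt C f; src C g' = tgt C f'\<rbrakk> \<Longrightarrow>
    tm g g' \<cdot> tm f f' = tm (g \<cdot> f) (g' \<cdot> f')"
  using strict by (auto simp: strict_monoidal_def is_functor_def cat_prod_def)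

text \<open>
  The braidings and linearity constraints below always occur in the middle of a longer product.
\<close>

definition wh :: "'o \<Rightarrow> 'm \<Rightarrow> 'o \<Rightarrow> 'm" where
  "wh P f S = tm (idm C P) (tm f (idm C S))"

lemma wh_simps [simp]:
  "\<lbrakk>f \<in> arr C; P \<in> ob C; S \<in> ob C\<rbrakk> \<Longrightarrow> wh P f S \<in> arr C"
  "\<lbrakk>f \<in> arr C; P \<in> ob C; S \<in> ob C\<rbrakk> \<Longrightarrow> src C (wh P f S) = to P (to (src C f) S)"
  "\<lbrakk>f \<in> arr C; P \<in> ob C; S \<in> ob C\<rbrakk> \<Longrightarrow> tgt C (wh P f S) = to P (to (tgt C f) S)"
  "\<lbrakk>A \<in> ob C; P \<in> ob C; S \<in> ob C\<rbrakk> \<Longrightarrow> wh P (idm C A) S = idm C (to P (to A S))"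
  "f \<in> arr C \<Longrightarrow> wh e f e = f"
  "\<lbrakk>f \<in> arr C; P \<in> ob C; S \<in> ob C; P' \<in> ob C; S' \<in> ob C\<rbrakk> \<Longrightarrow>
    wh P (wh P' f S') S = wh (to P P') f (to S' S)"
  by (simp_all add: wh_def flip: tm_simps(4,7))

lemma wh_cmp:
  "\<lbrakk>f \<in> arr C; g \<in> arr C; src C g = tgt C f; P \<in> ob C; S \<in> ob C\<rbrakk> \<Longrightarrow>
    wh P g S \<cdot> wh P f S = wh P (g \<cdot> f) S"
  by (simp add: wh_def tm_cmp)

lemma tm_interchange:
  assumes "f \<in> arr C" "g \<in> arr C"
  shows "tm f (idm C (tgt C g)) \<cdot> tm (idm C (src C f)) g = tm f g"
    "tm (idm C (tgt C f)) g \<cdot> tm f (idm C (src C g)) = tm f g"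
  using assms by (simp_all add: tm_cmp)

end

section \<open>Distributivity in a ring category\<close>

context ring_category
begin

sublocale sum: smon C "osum C" "msum C" "ozero C"
  by unfold_locales (rule sum_strict_monoidal)

sublocale ten: smon C "otimes R" "mtimes R" "oone R"
  by unfold_locales (rule times_strict_monoidal)

abbreviation ot (infixr \<open>\<star>\<close> 70) where "A \<star> B \<equiv> otimes R A B"
abbreviation mt (infixr \<open>\<diamondop>\<close> 70) where "f \<diamondop> g \<equiv> mtimes R f g"
abbreviation idC (\<open>\<iota>\<close>) where "\<iota> \<equiv> idm C"

lemma zeta_simps [simp]:
  "\<lbrakk>A \<in> ob C; B \<in> ob C\<rbrakk> \<Longrightarrow> \<zeta> A B \<in> arr C"
  "\<lbrakk>A \<in> ob C; B \<in> ob C\<rbrakk> \<Longrightarrow> src C (\<zeta> A B) = A \<oplus> B"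
  "\<lbrakk>A \<in> ob C; B \<in> ob C\<rbrakk> \<Longrightarrow> tgt C (\<zeta> A B) = B \<oplus> A"
  using sum_braiding by (auto simp: is_braiding_def nat_trans_def cat_prod_def hom_def)

lemma dl_simps [simp]:
  "\<lbrakk>A \<in> ob C; B \<in> ob C; X \<in> ob C\<rbrakk> \<Longrightarrow> dl R A B X \<in> arr C"
  "\<lbrakk>A \<in> ob C; B \<in> ob C; X \<in> ob C\<rbrakk> \<Longrightarrow> src C (dl R A B X) = (A \<star> X) \<oplus> (B \<star> X)"
  "\<lbrakk>A \<in> ob C; B \<in> ob C; X \<in> ob C\<rbrakk> \<Longrightarrow> tgt C (dl R A B X) = (A \<oplus> B) \<star> X"
  using dl_natural by (auto simp: nat_trans_def cat_prod_def hom_def)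

lemma dr_simps [simp]:
  "\<lbrakk>A \<in> ob C; B \<in> ob C; X \<in> ob C\<rbrakk> \<Longrightarrow> dr R A B X \<in> arr C"
  "\<lbrakk>A \<in> ob C; B \<in> ob C; X \<in> ob C\<rbrakk> \<Longrightarrow> src C (dr R A B X) = (A \<star> B) \<oplus> (A \<star> X)"
  "\<lbrakk>A \<in> ob C; B \<in> ob C; X \<in> ob C\<rbrakk> \<Longrightarrow> tgt C (dr R A B X) = A \<star> (B \<oplus> X)"
  using dr_natural by (auto simp: nat_trans_def cat_prod_def hom_def)

lemma dl_nat:
  "\<lbrakk>f \<in> arr C; g \<in> arr C; h \<in> arr C\<rbrakk> \<Longrightarrow>
    dl R (tgt C f) (tgt C g) (tgt C h) \<cdot> ((f \<diamondop> h) \<boxplus> (g \<diamondop> h)) =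
    ((f \<boxplus> g) \<diamondop> h) \<cdot> dl R (src C f) (src C g) (src C h)"
  using dl_natural by (auto simp: nat_trans_def cat_prod_def)

lemma dr_nat:
  "\<lbrakk>f \<in> arr C; g \<in> arr C; h \<in> arr C\<rbrakk> \<Longrightarrow>
    dr R (tgt C f) (tgt C g) (tgt C h) \<cdot> ((f \<diamondop> g) \<boxplus> (f \<diamondop> h)) =
    (f \<diamondop> (g \<boxplus> h)) \<cdot> dr R (src C f) (src C g) (src C h)"
  using dr_natural by (auto simp: nat_trans_def cat_prod_def)

lemmas zero_simps [simp] = zero_otimes otimes_zero zero_mtimes mtimes_zero

text \<open>
  The linearity constraint of a product in the variable between \<open>P\<close> and \<open>S\<close>. By the axiom
  \<open>dr_dl_otimes\<close>, using the two factorization morphisms in the other order gives the same morphism.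
\<close>

definition delta :: "'o \<Rightarrow> 'o \<Rightarrow> 'o \<Rightarrow> 'o \<Rightarrow> 'm" where
  "delta P A B S = (dr R P A B \<diamondop> \<iota> S) \<cdot> dl R (P \<star> A) (P \<star> B) S"

lemma delta_simps [simp]:
  assumes "P \<in> ob C" "A \<in> ob C" "B \<in> ob C" "S \<in> ob C"
  shows "delta P A B S \<in> arr C"
    "src C (delta P A B S) = (P \<star> A \<star> S) \<oplus> (P \<star> B \<star> S)"
    "tgt C (delta P A B S) = P \<star> (A \<oplus> B) \<star> S"
  using assms by (simp_all add: delta_def)

lemma delta_one:
  assumes "P \<in> ob C" "A \<in> ob C" "B \<in> ob C" "S \<in> ob C"
  shows "delta (oone R) A B S = dl R A B S" "delta P A B (oone R) = dr R P A B"
  using assms by (simp_all add: delta_def dr_one dl_one)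

lemma delta_zero:
  assumes "P \<in> ob C" "A \<in> ob C" "B \<in> ob C" "S \<in> ob C"
    "P = \<zero> \<or> A = \<zero> \<or> B = \<zero> \<or> S = \<zero>"
  shows "delta P A B S = \<iota> (P \<star> (A \<oplus> B) \<star> S)"
  using assms by (auto simp: delta_def dr_zero dl_zero)

lemma delta_natural:
  assumes "f \<in> arr C" "g \<in> arr C" "h \<in> arr C" "u \<in> arr C"
  shows "delta (tgt C f) (tgt C g) (tgt C h) (tgt C u) \<cdot> ((f \<diamondop> g \<diamondop> u) \<boxplus> (f \<diamondop> h \<diamondop> u)) =
    (f \<diamondop> (g \<boxplus> h) \<diamondop> u) \<cdot> delta (src C f) (src C g) (src C h) (src C u)" (is "?l = ?r")
proof -
  let ?D = "dr R (tgt C f) (tgt C g) (tgt C h)" and ?d = "dr R (src C f) (src C g) (src C h)"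
  let ?L = "dl R (tgt C f \<star> tgt C g) (tgt C f \<star> tgt C h) (tgt C u)"
  let ?l = "dl R (src C f \<star> src C g) (src C f \<star> src C h) (src C u)"
  have "(?D \<diamondop> \<iota> (tgt C u)) \<cdot> ?L \<cdot> ((f \<diamondop> g \<diamondop> u) \<boxplus> (f \<diamondop> h \<diamondop> u)) =
        (?D \<diamondop> \<iota> (tgt C u)) \<cdot> ((((f \<diamondop> g) \<boxplus> (f \<diamondop> h)) \<diamondop> u) \<cdot> ?l)"
    using assms dl_nat[of "f \<diamondop> g" "f \<diamondop> h" u] by (simp add: cmp_assoc')
  also have "\<dots> = ((?D \<cdot> ((f \<diamondop> g) \<boxplus> (f \<diamondop> h))) \<diamondop> u) \<cdot> ?l"
    using assms by (simp add: ten.tm_cmp flip: cmp_assoc')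
  also have "\<dots> = (((f \<diamondop> (g \<boxplus> h)) \<cdot> ?d) \<diamondop> (u \<cdot> \<iota> (src C u))) \<cdot> ?l"
    using assms by (simp add: dr_nat)
  also have "\<dots> = (f \<diamondop> (g \<boxplus> h) \<diamondop> u) \<cdot> ((?d \<diamondop> \<iota> (src C u)) \<cdot> ?l)"
    using assms ten.tm_cmp[of ?d "f \<diamondop> (g \<boxplus> h)" "\<iota> (src C u)" u] by (simp flip: cmp_assoc')
  finally show ?thesis by (simp add: delta_def)
qed

lemma delta_natural_mid:
  assumes "P \<in> ob C" "S \<in> ob C" "g \<in> arr C" "h \<in> arr C" "src C g = A" "src C h = B" "tgt C g = A'" "tgt C h = B'"
  shows "delta P A' B' S \<cdot> (ten.wh P g S \<boxplus> ten.wh P h S) = ten.wh P (g \<boxplus> h) S \<cdot> delta P A B S"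
  using assms delta_natural[of "\<iota> P" g h "\<iota> S"] by (simp add: ten.wh_def)

lemma delta_assoc:
  assumes "P \<in> ob C" "A \<in> ob C" "A' \<in> ob C" "A'' \<in> ob C" "S \<in> ob C"
  shows "delta P (A \<oplus> A') A'' S \<cdot> (delta P A A' S \<boxplus> \<iota> (P \<star> A'' \<star> S)) =
    delta P A (A' \<oplus> A'') S \<cdot> (\<iota> (P \<star> A \<star> S) \<boxplus> delta P A' A'' S)"
proof -
  have "delta P (A \<oplus> A') A'' S \<cdot> (delta P A A' S \<boxplus> \<iota> (P \<star> A'' \<star> S)) =
    (dr R P (A \<oplus> A') A'' \<diamondop> \<iota> S) \<cdot> (dl R (P \<star> (A \<oplus> A')) (P \<star> A'') S \<cdot>
      ((dr R P A A' \<diamondop> \<iota> S) \<boxplus> (\<iota> (P \<star> A'') \<diamondop> \<iota> S))) \<cdot> (dl R (P \<star> A) (P \<star> A') S \<boxplus> \<iota> (P \<star> A'' \<star> S))"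
    using assms by (simp add: delta_def cmp_assoc' sum.tm_cmp)
  also have "dl R (P \<star> (A \<oplus> A')) (P \<star> A'') S \<cdot> ((dr R P A A' \<diamondop> \<iota> S) \<boxplus> (\<iota> (P \<star> A'') \<diamondop> \<iota> S)) =
      ((dr R P A A' \<boxplus> \<iota> (P \<star> A'')) \<diamondop> \<iota> S) \<cdot> dl R (P \<star> A \<oplus> P \<star> A') (P \<star> A'') S"
    using assms dl_nat[of "dr R P A A'" "\<iota> (P \<star> A'')" "\<iota> S"] by simp
  also have "(dr R P (A \<oplus> A') A'' \<diamondop> \<iota> S) \<cdot> (((dr R P A A' \<boxplus> \<iota> (P \<star> A'')) \<diamondop> \<iota> S) \<cdot>
      dl R (P \<star> A \<oplus> P \<star> A') (P \<star> A'') S) \<cdot> (dl R (P \<star> A) (P \<star> A') S \<boxplus> \<iota> (P \<star> A'' \<star> S)) =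
    ((dr R P (A \<oplus> A') A'' \<diamondop> \<iota> S) \<cdot> ((dr R P A A' \<boxplus> \<iota> (P \<star> A'')) \<diamondop> \<iota> S)) \<cdot>
      (dl R (P \<star> A \<oplus> P \<star> A') (P \<star> A'') S \<cdot> (dl R (P \<star> A) (P \<star> A') S \<boxplus> \<iota> (P \<star> A'' \<star> S)))"
    using assms by (simp add: cmp_assoc')
  also have "(dr R P (A \<oplus> A') A'' \<diamondop> \<iota> S) \<cdot> ((dr R P A A' \<boxplus> \<iota> (P \<star> A'')) \<diamondop> \<iota> S) =
     (dr R P A (A' \<oplus> A'') \<diamondop> \<iota> S) \<cdot> ((\<iota> (P \<star> A) \<boxplus> dr R P A' A'') \<diamondop> \<iota> S)"
    using assms by (simp add: ten.tm_cmp dr_sum_assoc)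
  also have "dl R (P \<star> A \<oplus> P \<star> A') (P \<star> A'') S \<cdot> (dl R (P \<star> A) (P \<star> A') S \<boxplus> \<iota> (P \<star> A'' \<star> S)) =
     dl R (P \<star> A) (P \<star> A' \<oplus> P \<star> A'') S \<cdot> (\<iota> (P \<star> A \<star> S) \<boxplus> dl R (P \<star> A') (P \<star> A'') S)"
    using assms dl_sum_assoc[of "P \<star> A" "P \<star> A'" "P \<star> A''" S] by simp
  also have "((dr R P A (A' \<oplus> A'') \<diamondop> \<iota> S) \<cdot> ((\<iota> (P \<star> A) \<boxplus> dr R P A' A'') \<diamondop> \<iota> S)) \<cdot>
      (dl R (P \<star> A) (P \<star> A' \<oplus> P \<star> A'') S \<cdot> (\<iota> (P \<star> A \<star> S) \<boxplus> dl R (P \<star> A') (P \<star> A'') S)) =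
     (dr R P A (A' \<oplus> A'') \<diamondop> \<iota> S) \<cdot> (((\<iota> (P \<star> A) \<boxplus> dr R P A' A'') \<diamondop> \<iota> S) \<cdot>
      dl R (P \<star> A) (P \<star> A' \<oplus> P \<star> A'') S) \<cdot> (\<iota> (P \<star> A \<star> S) \<boxplus> dl R (P \<star> A') (P \<star> A'') S)"
    using assms by (simp add: cmp_assoc')
  also have "((\<iota> (P \<star> A) \<boxplus> dr R P A' A'') \<diamondop> \<iota> S) \<cdot> dl R (P \<star> A) (P \<star> A' \<oplus> P \<star> A'') S =
     dl R (P \<star> A) (P \<star> (A' \<oplus> A'')) S \<cdot> ((\<iota> (P \<star> A) \<diamondop> \<iota> S) \<boxplus> (dr R P A' A'' \<diamondop> \<iota> S))"
    using assms dl_nat[of "\<iota> (P \<star> A)" "dr R P A' A''" "\<iota> S"] by simp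
  also have "(dr R P A (A' \<oplus> A'') \<diamondop> \<iota> S) \<cdot> (dl R (P \<star> A) (P \<star> (A' \<oplus> A'')) S \<cdot>
      ((\<iota> (P \<star> A) \<diamondop> \<iota> S) \<boxplus> (dr R P A' A'' \<diamondop> \<iota> S))) \<cdot> (\<iota> (P \<star> A \<star> S) \<boxplus> dl R (P \<star> A') (P \<star> A'') S) =
      delta P A (A' \<oplus> A'') S \<cdot> (\<iota> (P \<star> A \<star> S) \<boxplus> delta P A' A'' S)"
    using assms by (simp add: delta_def cmp_assoc' sum.tm_cmp)
  finally show ?thesis .
qed

lemma delta_sym:
  assumes "P \<in> ob C" "A \<in> ob C" "A' \<in> ob C" "S \<in> ob C"
  shows "ten.wh P (\<zeta> A A') S \<cdot> delta P A A' S = delta P A' A S \<cdot> \<zeta> (P \<star> A \<star> S) (P \<star> A' \<star> S)"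
proof -
  have "delta P A' A S \<cdot> \<zeta> (P \<star> A \<star> S) (P \<star> A' \<star> S) =
      (dr R P A' A \<diamondop> \<iota> S) \<cdot> ((\<zeta> (P \<star> A) (P \<star> A') \<diamondop> \<iota> S) \<cdot> dl R (P \<star> A) (P \<star> A') S)"
    using assms dl_sym[of "P \<star> A" "P \<star> A'" S] by (simp add: delta_def cmp_assoc')
  also have "\<dots> = ((dr R P A' A \<cdot> \<zeta> (P \<star> A) (P \<star> A')) \<diamondop> \<iota> S) \<cdot> dl R (P \<star> A) (P \<star> A') S"
    using assms by (simp add: ten.tm_cmp flip: cmp_assoc')
  also have "\<dots> = (((\<iota> P \<diamondop> \<zeta> A A') \<cdot> dr R P A A') \<diamondop> (\<iota> S \<cdot> \<iota> S)) \<cdot> dl R (P \<star> A) (P \<star> A') S"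
    using assms by (simp add: dr_sym)
  also have "\<dots> = ten.wh P (\<zeta> A A') S \<cdot> delta P A A' S"
    using assms by (simp add: ten.wh_def delta_def cmp_assoc' del: cat_simps(9,10) flip: ten.tm_cmp)
  finally show ?thesis ..
qed

text \<open>
  The constraint between \<open>P \<otimes> P'\<close> and \<open>S' \<otimes> S\<close> can be computed in two steps, from the inside to the outside.
  This is the linearity constraint of a composite of multilinear functors, and it reduces most facts on
  \<open>delta\<close> to facts on \<open>\<partial>\<^sup>l\<close> and \<open>\<partial>\<^sup>r\<close>.
\<close>

lemma delta_comp:
  assumes "P \<in> ob C" "P' \<in> ob C" "A \<in> ob C" "B \<in> ob C" "S \<in> ob C" "S' \<in> ob C"
  shows "ten.wh P (delta P' A B S') S \<cdot> delta P (P' \<star> A \<star> S') (P' \<star> B \<star> S') S = delta (P \<star> P') A B (S' \<star> S)"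
proof -
  let ?d = "dr R P (P' \<star> A) (P' \<star> B)" and ?l = "dl R (P \<star> P' \<star> A \<star> S') (P \<star> P' \<star> B \<star> S') S"
  have "delta (P \<star> P') A B (S' \<star> S) = ((((\<iota> P \<diamondop> dr R P' A B) \<cdot> ?d) \<diamondop> \<iota> S') \<diamondop> \<iota> S) \<cdot>
      ((dl R (P \<star> P' \<star> A) (P \<star> P' \<star> B) S' \<diamondop> \<iota> S) \<cdot> ?l)"
    using assms by (simp add: delta_def dr_otimes dl_otimes)
  also have "\<dots> = (((((\<iota> P \<diamondop> dr R P' A B) \<cdot> ?d) \<diamondop> \<iota> S') \<cdot> dl R (P \<star> P' \<star> A) (P \<star> P' \<star> B) S') \<diamondop> \<iota> S) \<cdot> ?l"
    using assms by (simp add: ten.tm_cmp flip: cmp_assoc' del: ten.tm_simps(4))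
  also have "(((\<iota> P \<diamondop> dr R P' A B) \<cdot> ?d) \<diamondop> \<iota> S') \<cdot> dl R (P \<star> P' \<star> A) (P \<star> P' \<star> B) S' =
      (\<iota> P \<diamondop> dr R P' A B \<diamondop> \<iota> S') \<cdot> ((?d \<diamondop> \<iota> S') \<cdot> dl R (P \<star> P' \<star> A) (P \<star> P' \<star> B) S')"
    using assms ten.tm_cmp[of ?d "\<iota> P \<diamondop> dr R P' A B" "\<iota> S'" "\<iota> S'"] by (simp flip: cmp_assoc')
  also have "(?d \<diamondop> \<iota> S') \<cdot> dl R (P \<star> P' \<star> A) (P \<star> P' \<star> B) S' =
      (\<iota> P \<diamondop> dl R (P' \<star> A) (P' \<star> B) S') \<cdot> dr R P (P' \<star> A \<star> S') (P' \<star> B \<star> S')"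
    using assms dr_dl_otimes[of P "P' \<star> A" "P' \<star> B" S'] by simp
  also have "(\<iota> P \<diamondop> dr R P' A B \<diamondop> \<iota> S') \<cdot> ((\<iota> P \<diamondop> dl R (P' \<star> A) (P' \<star> B) S') \<cdot> dr R P (P' \<star> A \<star> S') (P' \<star> B \<star> S'))
     = (\<iota> P \<diamondop> delta P' A B S') \<cdot> dr R P (P' \<star> A \<star> S') (P' \<star> B \<star> S')"
    using assms by (simp add: delta_def ten.tm_cmp flip: cmp_assoc')
  also have "(((\<iota> P \<diamondop> delta P' A B S') \<cdot> dr R P (P' \<star> A \<star> S') (P' \<star> B \<star> S')) \<diamondop> \<iota> S) \<cdot> ?l =
     ((\<iota> P \<diamondop> delta P' A B S') \<diamondop> \<iota> S) \<cdot> ((dr R P (P' \<star> A \<star> S') (P' \<star> B \<star> S') \<diamondop> \<iota> S) \<cdot> ?l)"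
    using assms ten.tm_cmp[of "dr R P (P' \<star> A \<star> S') (P' \<star> B \<star> S')" "\<iota> P \<diamondop> delta P' A B S'" "\<iota> S" "\<iota> S"]
    by (simp flip: cmp_assoc' del: ten.tm_simps(4))
  finally show ?thesis using assms by (simp add: delta_def ten.wh_def)
qed

text \<open>
  For fixed \<open>P\<close> and \<open>S\<close>, the functor \<open>P \<otimes> - \<otimes> S\<close> with the constraint \<open>delta\<close> is lax symmetric monoidal with
  respect to \<open>\<oplus>\<close>. This lemma and the next one are general facts on such functors: the constraint for four
  summands does not depend on the bracketing and is compatible with exchanging the two middle summands.
\<close>

lemma delta_four_assoc:
  assumes o: "P \<in> ob C" "W \<in> ob C" "X \<in> ob C" "Y \<in> ob C" "Z \<in> ob C" "S \<in> ob C"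
  shows "delta P (W \<oplus> X) (Y \<oplus> Z) S \<cdot> (delta P W X S \<boxplus> delta P Y Z S) =
    delta P W (X \<oplus> Y \<oplus> Z) S \<cdot>
      (\<iota> (P \<star> W \<star> S) \<boxplus> (delta P (X \<oplus> Y) Z S \<cdot> (delta P X Y S \<boxplus> \<iota> (P \<star> Z \<star> S))))"
proof -
  have "delta P W X S \<boxplus> delta P Y Z S =
      (delta P W X S \<boxplus> \<iota> (P \<star> (Y \<oplus> Z) \<star> S)) \<cdot> (\<iota> (P \<star> W \<star> S) \<boxplus> \<iota> (P \<star> X \<star> S) \<boxplus> delta P Y Z S)"
    using o sum.tm_interchange(1)[of "delta P W X S" "delta P Y Z S"] by (simp flip: sum.tm_simps(4))
  hence "delta P (W \<oplus> X) (Y \<oplus> Z) S \<cdot> (delta P W X S \<boxplus> delta P Y Z S) =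
     (delta P (W \<oplus> X) (Y \<oplus> Z) S \<cdot> (delta P W X S \<boxplus> \<iota> (P \<star> (Y \<oplus> Z) \<star> S))) \<cdot>
       (\<iota> (P \<star> W \<star> S) \<boxplus> \<iota> (P \<star> X \<star> S) \<boxplus> delta P Y Z S)"
    using o by (simp add: cmp_assoc')
  also have "\<dots> = (delta P W (X \<oplus> Y \<oplus> Z) S \<cdot> (\<iota> (P \<star> W \<star> S) \<boxplus> delta P X (Y \<oplus> Z) S)) \<cdot>
       (\<iota> (P \<star> W \<star> S) \<boxplus> \<iota> (P \<star> X \<star> S) \<boxplus> delta P Y Z S)"
    using o by (simp add: delta_assoc)
  also have "\<dots> = delta P W (X \<oplus> Y \<oplus> Z) S \<cdot>
       (\<iota> (P \<star> W \<star> S) \<boxplus> (delta P X (Y \<oplus> Z) S \<cdot> (\<iota> (P \<star> X \<star> S) \<boxplus> delta P Y Z S)))"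
    using o by (simp add: cmp_assoc' sum.tm_cmp)
  finally show ?thesis using o by (simp add: delta_assoc)
qed

lemma delta_four_swap:
  assumes o: "P \<in> ob C" "W \<in> ob C" "X \<in> ob C" "Y \<in> ob C" "Z \<in> ob C" "S \<in> ob C"
  shows "ten.wh P (\<iota> W \<boxplus> \<zeta> X Y \<boxplus> \<iota> Z) S \<cdot> (delta P (W \<oplus> X) (Y \<oplus> Z) S \<cdot> (delta P W X S \<boxplus> delta P Y Z S)) =
    delta P (W \<oplus> Y) (X \<oplus> Z) S \<cdot> (delta P W Y S \<boxplus> delta P X Z S) \<cdot>
      (\<iota> (P \<star> W \<star> S) \<boxplus> \<zeta> (P \<star> X \<star> S) (P \<star> Y \<star> S) \<boxplus> \<iota> (P \<star> Z \<star> S))"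
proof -
  let ?M = "\<lambda>f. ten.wh P f S" and ?D = "\<lambda>X Y. delta P X Y S" and ?p = "\<lambda>X. P \<star> X \<star> S"
  let ?E = "?D (X \<oplus> Y) Z \<cdot> (?D X Y \<boxplus> \<iota> (?p Z))" and ?E' = "?D (Y \<oplus> X) Z \<cdot> (?D Y X \<boxplus> \<iota> (?p Z))"
  have "?M (\<zeta> X Y \<boxplus> \<iota> Z) \<cdot> ?E = (?M (\<zeta> X Y \<boxplus> \<iota> Z) \<cdot> ?D (X \<oplus> Y) Z) \<cdot> (?D X Y \<boxplus> \<iota> (?p Z))"
    using o by (simp add: cmp_assoc')
  also have "?M (\<zeta> X Y \<boxplus> \<iota> Z) \<cdot> ?D (X \<oplus> Y) Z = ?D (Y \<oplus> X) Z \<cdot> (?M (\<zeta> X Y) \<boxplus> \<iota> (?p Z))"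
    using o delta_natural_mid[of P S "\<zeta> X Y" "\<iota> Z" "X \<oplus> Y" Z "Y \<oplus> X" Z] by simp
  also have "(?D (Y \<oplus> X) Z \<cdot> (?M (\<zeta> X Y) \<boxplus> \<iota> (?p Z))) \<cdot> (?D X Y \<boxplus> \<iota> (?p Z)) =
      ?D (Y \<oplus> X) Z \<cdot> ((?D Y X \<cdot> \<zeta> (?p X) (?p Y)) \<boxplus> (\<iota> (?p Z) \<cdot> \<iota> (?p Z)))"
    using o by (simp add: cmp_assoc' sum.tm_cmp delta_sym)
  also have "\<dots> = ?E' \<cdot> (\<zeta> (?p X) (?p Y) \<boxplus> \<iota> (?p Z))"
    using o sum.tm_cmp[of "\<zeta> (?p X) (?p Y)" "?D Y X" "\<iota> (?p Z)" "\<iota> (?p Z)"] by (simp add: cmp_assoc')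
  finally have E: "?M (\<zeta> X Y \<boxplus> \<iota> Z) \<cdot> ?E = ?E' \<cdot> (\<zeta> (?p X) (?p Y) \<boxplus> \<iota> (?p Z))" .
  have "?M (\<iota> W \<boxplus> \<zeta> X Y \<boxplus> \<iota> Z) \<cdot> (?D (W \<oplus> X) (Y \<oplus> Z) \<cdot> (?D W X \<boxplus> ?D Y Z)) =
      (?M (\<iota> W \<boxplus> \<zeta> X Y \<boxplus> \<iota> Z) \<cdot> ?D W (X \<oplus> Y \<oplus> Z)) \<cdot> (\<iota> (?p W) \<boxplus> ?E)"
    using o by (simp add: delta_four_assoc cmp_assoc')
  also have "?M (\<iota> W \<boxplus> \<zeta> X Y \<boxplus> \<iota> Z) \<cdot> ?D W (X \<oplus> Y \<oplus> Z) =
      ?D W (Y \<oplus> X \<oplus> Z) \<cdot> (\<iota> (?p W) \<boxplus> ?M (\<zeta> X Y \<boxplus> \<iota> Z))"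
    using o delta_natural_mid[of P S "\<iota> W" "\<zeta> X Y \<boxplus> \<iota> Z" W "X \<oplus> Y \<oplus> Z" W "Y \<oplus> X \<oplus> Z"] by simp
  also have "(?D W (Y \<oplus> X \<oplus> Z) \<cdot> (\<iota> (?p W) \<boxplus> ?M (\<zeta> X Y \<boxplus> \<iota> Z))) \<cdot> (\<iota> (?p W) \<boxplus> ?E) =
      ?D W (Y \<oplus> X \<oplus> Z) \<cdot> (\<iota> (?p W) \<boxplus> (?M (\<zeta> X Y \<boxplus> \<iota> Z) \<cdot> ?E))"
    using o sum.tm_cmp[of "\<iota> (?p W)" "\<iota> (?p W)" ?E "?M (\<zeta> X Y \<boxplus> \<iota> Z)"] by (simp add: cmp_assoc')
  also have "\<dots> = (?D W (Y \<oplus> X \<oplus> Z) \<cdot> (\<iota> (?p W) \<boxplus> ?E')) \<cdot> (\<iota> (?p W) \<boxplus> \<zeta> (?p X) (?p Y) \<boxplus> \<iota> (?p Z))"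
    unfolding E using o sum.tm_cmp[of "\<iota> (?p W)" "\<iota> (?p W)" "\<zeta> (?p X) (?p Y) \<boxplus> \<iota> (?p Z)" ?E']
    by (simp add: cmp_assoc')
  also have "?D W (Y \<oplus> X \<oplus> Z) \<cdot> (\<iota> (?p W) \<boxplus> ?E') = ?D (W \<oplus> Y) (X \<oplus> Z) \<cdot> (?D W Y \<boxplus> ?D X Z)"
    using o by (simp add: delta_four_assoc)
  finally show ?thesis using o by (simp add: cmp_assoc')
qed

lemma zeta_mid_cancel:
  assumes "A \<in> ob C" "X \<in> ob C" "Y \<in> ob C" "B \<in> ob C"
  shows "(\<iota> A \<boxplus> \<zeta> Y X \<boxplus> \<iota> B) \<cdot> (\<iota> A \<boxplus> \<zeta> X Y \<boxplus> \<iota> B) = \<iota> (A \<oplus> X \<oplus> Y \<oplus> B)"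
  using assms by (simp add: sum.tm_cmp sum_symmetry)

text \<open>
  The axiom \<open>dr_dl_sum\<close> with a further factor \<open>Q\<close> between the two sums: \<open>dr_otimes\<close> moves \<open>Q\<close> to the right,
  where it becomes part of the summands of the second factor. The axiom is solved for its left hand side by means of
  the symmetry of \<open>\<zeta>\<close>.
\<close>

lemma dl_dr_two:
  assumes o: "A \<in> ob C" "A' \<in> ob C" "Q \<in> ob C" "B \<in> ob C" "B' \<in> ob C"
  shows "dr R ((A \<oplus> A') \<star> Q) B B' \<cdot> (dl R A A' (Q \<star> B) \<boxplus> dl R A A' (Q \<star> B')) =
    dl R A A' (Q \<star> (B \<oplus> B')) \<cdot> (dr R (A \<star> Q) B B' \<boxplus> dr R (A' \<star> Q) B B') \<cdot>
      (\<iota> (A \<star> Q \<star> B) \<boxplus> \<zeta> (A' \<star> Q \<star> B) (A \<star> Q \<star> B') \<boxplus> \<iota> (A' \<star> Q \<star> B'))"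
proof -
  let ?X = "Q \<star> B" and ?Y = "Q \<star> B'" and ?q = "dr R Q B B'"
  let ?z = "\<iota> (A \<star> ?X) \<boxplus> \<zeta> (A' \<star> ?X) (A \<star> ?Y) \<boxplus> \<iota> (A' \<star> ?Y)"
  let ?z' = "\<iota> (A \<star> ?X) \<boxplus> \<zeta> (A \<star> ?Y) (A' \<star> ?X) \<boxplus> \<iota> (A' \<star> ?Y)"
  let ?r = "dr R (A \<oplus> A') ?X ?Y" and ?ll = "dl R A A' ?X \<boxplus> dl R A A' ?Y"
  \<comment> \<open>\<open>?z'\<close> is the exchange in \<open>dr_dl_sum\<close>, and \<open>?z\<close> is its inverse\<close>
  have "dr R ((A \<oplus> A') \<star> Q) B B' \<cdot> ?ll = (\<iota> (A \<oplus> A') \<diamondop> ?q) \<cdot> ((?r \<cdot> ?ll) \<cdot> (?z' \<cdot> ?z))"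
    using o by (simp add: dr_otimes cmp_assoc' zeta_mid_cancel)
  also have "(?r \<cdot> ?ll) \<cdot> (?z' \<cdot> ?z) = (?r \<cdot> ?ll \<cdot> ?z') \<cdot> ?z"
    using o by (simp add: cmp_assoc' zeta_mid_cancel)
  also have "?r \<cdot> ?ll \<cdot> ?z' = dl R A A' (?X \<oplus> ?Y) \<cdot> (dr R A ?X ?Y \<boxplus> dr R A' ?X ?Y)"
    using o by (intro dr_dl_sum) auto
  also have "(\<iota> (A \<oplus> A') \<diamondop> ?q) \<cdot> (dl R A A' (?X \<oplus> ?Y) \<cdot> (dr R A ?X ?Y \<boxplus> dr R A' ?X ?Y) \<cdot> ?z) =
      ((\<iota> (A \<oplus> A') \<diamondop> ?q) \<cdot> dl R A A' (?X \<oplus> ?Y)) \<cdot> (dr R A ?X ?Y \<boxplus> dr R A' ?X ?Y) \<cdot> ?z"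
    using o by (simp add: cmp_assoc')
  also have "(\<iota> (A \<oplus> A') \<diamondop> ?q) \<cdot> dl R A A' (?X \<oplus> ?Y) = dl R A A' (Q \<star> (B \<oplus> B')) \<cdot> ((\<iota> A \<diamondop> ?q) \<boxplus> (\<iota> A' \<diamondop> ?q))"
    using o dl_nat[of "\<iota> A" "\<iota> A'" ?q] by simp
  also have "\<dots> \<cdot> (dr R A ?X ?Y \<boxplus> dr R A' ?X ?Y) = dl R A A' (Q \<star> (B \<oplus> B')) \<cdot> (dr R (A \<star> Q) B B' \<boxplus> dr R (A' \<star> Q) B B')"
    using o by (simp add: cmp_assoc' sum.tm_cmp dr_otimes)
  finally show ?thesis .
qed

text \<open>
  The exchange of constraints in two variables, separated by a product \<open>Q\<close>. Inside \<open>P \<otimes> - \<otimes> S\<close> this is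
  \<open>dl_dr_two\<close>; the constraint for four summands carries it to the whole product.
\<close>

lemma delta_two:
  assumes o: "P \<in> ob C" "A \<in> ob C" "A' \<in> ob C" "Q \<in> ob C" "B \<in> ob C" "B' \<in> ob C" "S \<in> ob C"
  shows "delta (P \<star> (A \<oplus> A') \<star> Q) B B' S \<cdot> (delta P A A' (Q \<star> B \<star> S) \<boxplus> delta P A A' (Q \<star> B' \<star> S)) =
    delta P A A' (Q \<star> (B \<oplus> B') \<star> S) \<cdot> (delta (P \<star> A \<star> Q) B B' S \<boxplus> delta (P \<star> A' \<star> Q) B B' S) \<cdot>
      (\<iota> (P \<star> A \<star> Q \<star> B \<star> S) \<boxplus> \<zeta> (P \<star> A' \<star> Q \<star> B \<star> S) (P \<star> A \<star> Q \<star> B' \<star> S) \<boxplus> \<iota> (P \<star> A' \<star> Q \<star> B' \<star> S))"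
proof -
  let ?M = "\<lambda>f. ten.wh P f S" and ?D = "\<lambda>X Y. delta P X Y S"
  let ?W = "A \<star> Q \<star> B" and ?X = "A' \<star> Q \<star> B" and ?Y = "A \<star> Q \<star> B'" and ?Z = "A' \<star> Q \<star> B'"
  let ?E = "A \<oplus> A'" and ?z = "\<iota> (A \<star> Q \<star> B) \<boxplus> \<zeta> (A' \<star> Q \<star> B) (A \<star> Q \<star> B') \<boxplus> \<iota> (A' \<star> Q \<star> B')"
  let ?rr = "dr R (A \<star> Q) B B' \<boxplus> dr R (A' \<star> Q) B B'"
  have d1: "delta (P \<star> ?E \<star> Q) B B' S = ?M (dr R (?E \<star> Q) B B') \<cdot> ?D (?E \<star> Q \<star> B) (?E \<star> Q \<star> B')"
    using o delta_comp[of P "?E \<star> Q" B B' S "oone R"] by (simp add: delta_one)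
  have d2: "delta P A A' (Q \<star> V \<star> S) = ?M (dl R A A' (Q \<star> V)) \<cdot> ?D (A \<star> Q \<star> V) (A' \<star> Q \<star> V)" if "V \<in> ob C" for V
    using o that delta_comp[of P "oone R" A A' S "Q \<star> V"] by (simp add: delta_one)
  have d3: "delta (P \<star> V \<star> Q) B B' S = ?M (dr R (V \<star> Q) B B') \<cdot> ?D (V \<star> Q \<star> B) (V \<star> Q \<star> B')" if "V \<in> ob C" for V
    using o that delta_comp[of P "V \<star> Q" B B' S "oone R"] by (simp add: delta_one)
  have "delta (P \<star> ?E \<star> Q) B B' S \<cdot> (delta P A A' (Q \<star> B \<star> S) \<boxplus> delta P A A' (Q \<star> B' \<star> S)) =
      ?M (dr R (?E \<star> Q) B B') \<cdot> (?D (?E \<star> Q \<star> B) (?E \<star> Q \<star> B') \<cdot>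
        (?M (dl R A A' (Q \<star> B)) \<boxplus> ?M (dl R A A' (Q \<star> B')))) \<cdot> (?D ?W ?X \<boxplus> ?D ?Y ?Z)"
    using o by (simp add: d1 d2 cmp_assoc' sum.tm_cmp)
  also have "?D (?E \<star> Q \<star> B) (?E \<star> Q \<star> B') \<cdot> (?M (dl R A A' (Q \<star> B)) \<boxplus> ?M (dl R A A' (Q \<star> B'))) =
      ?M (dl R A A' (Q \<star> B) \<boxplus> dl R A A' (Q \<star> B')) \<cdot> ?D (?W \<oplus> ?X) (?Y \<oplus> ?Z)"
    using o by (intro delta_natural_mid) auto
  also have "?M (dr R (?E \<star> Q) B B') \<cdot> (?M (dl R A A' (Q \<star> B) \<boxplus> dl R A A' (Q \<star> B')) \<cdot> ?D (?W \<oplus> ?X) (?Y \<oplus> ?Z)) \<cdot> (?D ?W ?X \<boxplus> ?D ?Y ?Z) =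
      ?M (dr R (?E \<star> Q) B B' \<cdot> (dl R A A' (Q \<star> B) \<boxplus> dl R A A' (Q \<star> B'))) \<cdot> (?D (?W \<oplus> ?X) (?Y \<oplus> ?Z) \<cdot> (?D ?W ?X \<boxplus> ?D ?Y ?Z))"
    using o by (simp add: cmp_assoc' flip: ten.wh_cmp)
  also have "dr R (?E \<star> Q) B B' \<cdot> (dl R A A' (Q \<star> B) \<boxplus> dl R A A' (Q \<star> B')) =
      dl R A A' (Q \<star> (B \<oplus> B')) \<cdot> ?rr \<cdot> ?z"
    by (rule dl_dr_two[OF o(2-6)])
  also have "?M (dl R A A' (Q \<star> (B \<oplus> B')) \<cdot> ?rr \<cdot> ?z) \<cdot> (?D (?W \<oplus> ?X) (?Y \<oplus> ?Z) \<cdot> (?D ?W ?X \<boxplus> ?D ?Y ?Z)) =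
      ?M (dl R A A' (Q \<star> (B \<oplus> B'))) \<cdot> (?M ?rr \<cdot> (?M ?z \<cdot> (?D (?W \<oplus> ?X) (?Y \<oplus> ?Z) \<cdot> (?D ?W ?X \<boxplus> ?D ?Y ?Z))))"
    using o by (simp add: cmp_assoc' flip: ten.wh_cmp)
  also have "?M ?z \<cdot> (?D (?W \<oplus> ?X) (?Y \<oplus> ?Z) \<cdot> (?D ?W ?X \<boxplus> ?D ?Y ?Z)) =
      ?D (?W \<oplus> ?Y) (?X \<oplus> ?Z) \<cdot> (?D ?W ?Y \<boxplus> ?D ?X ?Z) \<cdot>
       (\<iota> (P \<star> ?W \<star> S) \<boxplus> \<zeta> (P \<star> ?X \<star> S) (P \<star> ?Y \<star> S) \<boxplus> \<iota> (P \<star> ?Z \<star> S))"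
    using o by (intro delta_four_swap) auto
  also have "?M (dl R A A' (Q \<star> (B \<oplus> B'))) \<cdot> (?M ?rr \<cdot> (?D (?W \<oplus> ?Y) (?X \<oplus> ?Z) \<cdot> (?D ?W ?Y \<boxplus> ?D ?X ?Z) \<cdot>
       (\<iota> (P \<star> ?W \<star> S) \<boxplus> \<zeta> (P \<star> ?X \<star> S) (P \<star> ?Y \<star> S) \<boxplus> \<iota> (P \<star> ?Z \<star> S)))) =
     ?M (dl R A A' (Q \<star> (B \<oplus> B'))) \<cdot> (?M ?rr \<cdot> ?D (?W \<oplus> ?Y) (?X \<oplus> ?Z)) \<cdot> (?D ?W ?Y \<boxplus> ?D ?X ?Z) \<cdot>
       (\<iota> (P \<star> ?W \<star> S) \<boxplus> \<zeta> (P \<star> ?X \<star> S) (P \<star> ?Y \<star> S) \<boxplus> \<iota> (P \<star> ?Z \<star> S))"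
    using o by (simp add: cmp_assoc')
  also have "?M ?rr \<cdot> ?D (?W \<oplus> ?Y) (?X \<oplus> ?Z) = ?D (A \<star> Q \<star> (B \<oplus> B')) (A' \<star> Q \<star> (B \<oplus> B')) \<cdot>
      (?M (dr R (A \<star> Q) B B') \<boxplus> ?M (dr R (A' \<star> Q) B B'))"
    using o by (intro delta_natural_mid[symmetric]) auto
  also have "?M (dl R A A' (Q \<star> (B \<oplus> B'))) \<cdot> (?D (A \<star> Q \<star> (B \<oplus> B')) (A' \<star> Q \<star> (B \<oplus> B')) \<cdot>
      (?M (dr R (A \<star> Q) B B') \<boxplus> ?M (dr R (A' \<star> Q) B B'))) \<cdot> (?D ?W ?Y \<boxplus> ?D ?X ?Z) =
     delta P A A' (Q \<star> (B \<oplus> B') \<star> S) \<cdot> (delta (P \<star> A \<star> Q) B B' S \<boxplus> delta (P \<star> A' \<star> Q) B B' S)"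
    using o by (simp add: d2[of "B \<oplus> B'"] d3 cmp_assoc' sum.tm_cmp)
  finally show ?thesis using o by simp
qed

end

section \<open>Powers of a category\<close>

lemma ob_power [simp]:
  "As \<in> ob (cat_list_prod (replicate k C)) \<longleftrightarrow> length As = k \<and> set As \<subseteq> ob C"
  by (auto simp: cat_list_prod_def in_listset in_set_conv_nth subset_iff)

lemma arr_power [simp]:
  "fs \<in> arr (cat_list_prod (replicate k C)) \<longleftrightarrow> length fs = k \<and> set fs \<subseteq> arr C"
  by (auto simp: cat_list_prod_def in_listset in_set_conv_nth subset_iff)

lemma map2_replicate: "length xs = k \<Longrightarrow> map2 f (replicate k a) xs = map (f a) xs"
  by (intro nth_equalityI) auto

lemma power_simps [simp]:
  "length fs = k \<Longrightarrow> src (cat_list_prod (replicate k C)) fs = map (src C) fs"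
  "length fs = k \<Longrightarrow> tgt (cat_list_prod (replicate k C)) fs = map (tgt C) fs"
  "length As = k \<Longrightarrow> idm (cat_list_prod (replicate k C)) As = map (idm C) As"
  "\<lbrakk>length gs = k; length fs = k\<rbrakk> \<Longrightarrow> cmp (cat_list_prod (replicate k C)) gs fs = map2 (cmp C) gs fs"
  by (auto simp: cat_list_prod_def map2_replicate intro!: nth_equalityI)

lemma lin_dom_power [simp]:
  "(i, As, A') \<in> lin_dom (replicate k C) \<longleftrightarrow> i < k \<and> length As = k \<and> set As \<subseteq> ob C \<and> A' \<in> ob C"
  by (auto simp: lin_dom_def)

lemma set_update_subset: "\<lbrakk>set xs \<subseteq> S; a \<in> S\<rbrakk> \<Longrightarrow> set (xs[i := a]) \<subseteq> S"
  by (meson insert_subset order_trans set_update_subset_insert insert_subsetI)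

lemma split_one:
  assumes "i < length xs"
  obtains L a S where "xs = L @ a # S" "length L = i"
  using assms id_take_nth_drop[OF assms] by (metis length_take min.absorb4)

section \<open>Iterated products\<close>

context ring_category
begin

definition oten :: "'o list \<Rightarrow> 'o" where
  "oten As = foldr (otimes R) As (oone R)"

definition mten :: "'m list \<Rightarrow> 'm" where
  "mten fs = foldr (mtimes R) fs (\<iota> (oone R))"

lemma ten_simps [simp]:
  "oten [] = oone R" "oten (A # As) = A \<star> oten As"
  "mten [] = \<iota> (oone R)" "mten (f # fs) = f \<diamondop> mten fs"
  by (simp_all add: oten_def mten_def)

lemma oten_ob [simp]: "set As \<subseteq> ob C \<Longrightarrow> oten As \<in> ob C"
  by (induction As) auto

lemma mten_simps [simp]:
  "set fs \<subseteq> arr C \<Longrightarrow> mten fs \<in> arr C"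
  "set fs \<subseteq> arr C \<Longrightarrow> src C (mten fs) = oten (map (src C) fs)"
  "set fs \<subseteq> arr C \<Longrightarrow> tgt C (mten fs) = oten (map (tgt C) fs)"
  by (induction fs) auto

lemma set_map_ob [simp]:
  "set fs \<subseteq> arr C \<Longrightarrow> src C ` set fs \<subseteq> ob C" "set fs \<subseteq> arr C \<Longrightarrow> tgt C ` set fs \<subseteq> ob C"
  "set As \<subseteq> ob C \<Longrightarrow> \<iota> ` set As \<subseteq> arr C"
  by auto

lemma oten_append [simp]:
  "\<lbrakk>set As \<subseteq> ob C; set Bs \<subseteq> ob C\<rbrakk> \<Longrightarrow> oten (As @ Bs) = oten As \<star> oten Bs"
  by (induction As) auto

lemma mten_append [simp]:
  "\<lbrakk>set fs \<subseteq> arr C; set gs \<subseteq> arr C\<rbrakk> \<Longrightarrow> mten (fs @ gs) = mten fs \<diamondop> mten gs"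
  by (induction fs) auto

lemma mten_idm [simp]: "set As \<subseteq> ob C \<Longrightarrow> mten (map \<iota> As) = \<iota> (oten As)"
  by (induction As) auto

lemma mten_cmp:
  "\<lbrakk>length gs = length fs; set fs \<subseteq> arr C; set gs \<subseteq> arr C; map (src C) gs = map (tgt C) fs\<rbrakk> \<Longrightarrow>
    mten (map2 (cmp C) gs fs) = mten gs \<cdot> mten fs"
  by (induction gs fs rule: list_induct2) (auto simp: ten.tm_cmp)

lemma oten_concat: "\<forall>As \<in> set Ass. set As \<subseteq> ob C \<Longrightarrow> oten (concat Ass) = oten (map oten Ass)"
  by (induction Ass) (auto simp: UN_subset_iff)

lemma mten_concat: "\<forall>fs \<in> set fss. set fs \<subseteq> arr C \<Longrightarrow> mten (concat fss) = mten (map mten fss)"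
  by (induction fss) (auto simp: UN_subset_iff)

lemma oten_zero: "\<lbrakk>set As \<subseteq> ob C; \<zero> \<in> set As\<rbrakk> \<Longrightarrow> oten As = \<zero>"
  by (induction As) auto

lemma mten_zero: "\<lbrakk>set fs \<subseteq> arr C; \<iota> \<zero> \<in> set fs\<rbrakk> \<Longrightarrow> mten fs = \<iota> \<zero>"
  by (induction fs) auto

lemma mten_update_idm:
  assumes "j < length Bs" "set Bs \<subseteq> ob C" "d \<in> arr C"
  shows "mten ((map \<iota> Bs)[j := d]) = ten.wh (oten (take j Bs)) d (oten (drop (Suc j) Bs))"
  using assms(1)
proof (rule split_one)
  fix L a S assume s: "Bs = L @ a # S" "length L = j"
  hence "(map \<iota> Bs)[j := d] = map \<iota> L @ d # map \<iota> S"
    using list_update_length[of "map \<iota> L" "\<iota> a" "map \<iota> S" d] by simp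
  thus ?thesis using assms s by (auto simp: ten.wh_def)
qed

text \<open>
  The linearity constraint of the product in the variable of index \<open>j\<close>.
\<close>

definition linten :: "nat \<Rightarrow> 'o list \<Rightarrow> 'o \<Rightarrow> 'm" where
  "linten j As A' = delta (oten (take j As)) (As ! j) A' (oten (drop (Suc j) As))"

lemma linten_split: "length L = j \<Longrightarrow> linten j (L @ A # S) A' = delta (oten L) A A' (oten S)"
  by (auto simp: linten_def)

lemma linten_simps [simp]:
  assumes "j < length As" "set As \<subseteq> ob C" "A' \<in> ob C"
  shows "linten j As A' \<in> arr C" "src C (linten j As A') = oten As \<oplus> oten (As[j := A'])"
    "tgt C (linten j As A') = oten (As[j := As ! j \<oplus> A'])"
  using assms(1) by (rule split_one; use assms in \<open>force simp: linten_split\<close>)+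

lemma linten_natural:
  assumes "j < length fs" "set fs \<subseteq> arr C" "f' \<in> arr C"
  shows "linten j (map (tgt C) fs) (tgt C f') \<cdot> (mten fs \<boxplus> mten (fs[j := f'])) =
    mten (fs[j := fs ! j \<boxplus> f']) \<cdot> linten j (map (src C) fs) (src C f')"
  using assms(1)
proof (rule split_one)
  fix L a S assume s: "fs = L @ a # S" "length L = j"
  thus ?thesis using assms delta_natural[of "mten L" a f' "mten S"]
    by (auto simp: linten_split)
qed

lemma linten_zero:
  assumes "j < length As" "set As \<subseteq> ob C" "A' \<in> ob C" "\<zero> \<in> set As \<or> A' = \<zero>"
  shows "linten j As A' = \<iota> (oten (As[j := As ! j \<oplus> A']))"
  using assms(1)
proof (rule split_one)
  fix L a S assume s: "As = L @ a # S" "length L = j"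
  have "oten L = \<zero> \<or> a = \<zero> \<or> A' = \<zero> \<or> oten S = \<zero>"
    using assms s oten_zero[of L] oten_zero[of S] by auto
  thus ?thesis using assms s delta_zero[of "oten L" a A' "oten S"] by (auto simp: linten_split)
qed

lemma linten_assoc:
  assumes "j < length As" "set As \<subseteq> ob C" "A' \<in> ob C" "A'' \<in> ob C"
  shows "linten j (As[j := As ! j \<oplus> A']) A'' \<cdot> (linten j As A' \<boxplus> \<iota> (oten (As[j := A'']))) =
    linten j As (A' \<oplus> A'') \<cdot> (\<iota> (oten As) \<boxplus> linten j (As[j := A']) A'')"
  using assms(1)
proof (rule split_one)
  fix L a S assume s: "As = L @ a # S" "length L = j"
  thus ?thesis using assms delta_assoc[of "oten L" a A' A'' "oten S"] by (auto simp: linten_split)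
qed

lemma linten_sym:
  assumes "j < length As" "set As \<subseteq> ob C" "A' \<in> ob C"
  shows "mten ((map \<iota> As)[j := \<zeta> (As ! j) A']) \<cdot> linten j As A' =
    linten j (As[j := A']) (As ! j) \<cdot> \<zeta> (oten As) (oten (As[j := A']))"
  using assms(1)
proof (rule split_one)
  fix L a S assume s: "As = L @ a # S" "length L = j"
  thus ?thesis using assms delta_sym[of "oten L" a A' "oten S"]
    by (subst mten_update_idm) (auto simp: linten_split)
qed

lemma linten_two_less:
  assumes "j < k" "k < length As" "set As \<subseteq> ob C" "A' \<in> ob C" "B' \<in> ob C"
  shows "linten k (As[j := As ! j \<oplus> A']) B' \<cdot> (linten j As A' \<boxplus> linten j (As[k := B']) A') =
    linten j (As[k := As ! k \<oplus> B']) A' \<cdot> (linten k As B' \<boxplus> linten k (As[j := A']) B') \<cdot>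
      (\<iota> (oten As) \<boxplus> \<zeta> (oten (As[j := A'])) (oten (As[k := B'])) \<boxplus> \<iota> (oten (As[j := A', k := B'])))"
proof -
  obtain K b S where K: "As = K @ b # S" "length K = k"
    by (rule split_one[OF assms(2)])
  hence "j < length K" using assms(1) by simp
  then obtain L a M where L: "K = L @ a # M" "length L = j"
    by (rule split_one)
  have o: "oten L \<in> ob C" "oten M \<in> ob C" "oten S \<in> ob C" "a \<in> ob C" "b \<in> ob C"
     "set L \<subseteq> ob C" "set M \<subseteq> ob C" "set S \<subseteq> ob C"
    using assms K L by auto
  have k: "k = length (L @ x # M)" for x using K L by simp
  have up: "(L @ x # M @ y # S)[k := z] = L @ x # M @ z # S" "(L @ x # M @ y # S) ! k = y"
      "linten k (L @ x # M @ y # S) z = delta (oten (L @ x # M)) y z (oten S)" for x y z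
    unfolding k[of x] using list_update_length[of "L @ x # M" y S z] nth_append_length[of "L @ x # M" y S]
      linten_split[of "L @ x # M" _ y S z] by simp_all
  have uj: "(L @ x # M @ y # S)[j := z] = L @ z # M @ y # S" "(L @ x # M @ y # S) ! j = x"
      "linten j (L @ x # M @ y # S) z = delta (oten L) x z (oten (M @ y # S))" for x y z
    using L(2) by (auto simp: linten_split)
  have As: "As = L @ a # M @ b # S" using K L by simp
  show ?thesis unfolding As using assms(4,5) o delta_two[of "oten L" a A' "oten M" b B' "oten S"]
    by (simp add: up uj)
qed

text \<open>
  The condition is symmetric in \<open>j\<close> and \<open>k\<close> because the symmetry \<open>\<zeta>\<close> is its own inverse.
\<close>

lemma linten_two:
  assumes "j \<noteq> k" "j < length As" "k < length As" "set As \<subseteq> ob C" "A' \<in> ob C" "B' \<in> ob C"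
  shows "linten k (As[j := As ! j \<oplus> A']) B' \<cdot> (linten j As A' \<boxplus> linten j (As[k := B']) A') =
    linten j (As[k := As ! k \<oplus> B']) A' \<cdot> (linten k As B' \<boxplus> linten k (As[j := A']) B') \<cdot>
      (\<iota> (oten As) \<boxplus> \<zeta> (oten (As[j := A'])) (oten (As[k := B'])) \<boxplus> \<iota> (oten (As[j := A', k := B'])))"
proof (cases "j < k")
  case True
  thus ?thesis using assms by (intro linten_two_less)
next
  case False
  hence kj: "k < j" using assms(1) by simp
  have sw: "As[k := B', j := A'] = As[j := A', k := B']" using assms(1) by (simp add: list_update_swap)
  have s: "set (As[i := X]) \<subseteq> ob C" if "X \<in> ob C" for i X using assms(4) that by (rule set_update_subset)
  have n: "As ! j \<in> ob C" "As ! k \<in> ob C" using assms(2-4) by auto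
  let ?l = "linten j (As[k := As ! k \<oplus> B']) A' \<cdot> (linten k As B' \<boxplus> linten k (As[j := A']) B')"
  let ?r = "linten k (As[j := As ! j \<oplus> A']) B' \<cdot> (linten j As A' \<boxplus> linten j (As[k := B']) A')"
  let ?z = "\<iota> (oten As) \<boxplus> \<zeta> (oten (As[j := A'])) (oten (As[k := B'])) \<boxplus> \<iota> (oten (As[j := A', k := B']))"
  let ?z' = "\<iota> (oten As) \<boxplus> \<zeta> (oten (As[k := B'])) (oten (As[j := A'])) \<boxplus> \<iota> (oten (As[j := A', k := B']))"
  have eq: "?l = ?r \<cdot> ?z'"
    using linten_two_less[OF kj assms(2,4,6,5)] unfolding sw .
  have r: "?r \<in> arr C" "src C ?r = oten As \<oplus> oten (As[j := A']) \<oplus> oten (As[k := B']) \<oplus> oten (As[j := A', k := B'])"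
    using assms s n sw set_update_subset[OF s] by (simp_all add: list_update_swap)
  have "?l \<cdot> ?z = ?r \<cdot> (?z' \<cdot> ?z)"
    unfolding eq using r assms s set_update_subset[OF s] by (intro cmp_assoc') auto
  also have "\<dots> = ?r"
    using r assms s set_update_subset[OF s] by (simp add: zeta_mid_cancel)
  finally show ?thesis by simp
qed

text \<open>
  The multilinear functor assigned to the object \<open>\<sigma>\<close> of \<open>Br\<close>.
\<close>

definition Ten :: "nat \<Rightarrow> (nat \<Rightarrow> nat) \<Rightarrow> ('o, 'm) mlfun" where
  "Ten k \<sigma> =
    \<lparr>obmap = (\<lambda>As \<in> ob (cat_list_prod (replicate k C)). oten (place \<sigma> As)),
     armap = (\<lambda>fs \<in> arr (cat_list_prod (replicate k C)). mten (place \<sigma> fs)),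
     lin = (\<lambda>i As A'. if (i, As, A') \<in> lin_dom (replicate k C)
                      then linten (\<sigma> i) (place \<sigma> As) A' else undefined)\<rparr>"

lemma Ten_simps:
  "\<lbrakk>length As = k; set As \<subseteq> ob C\<rbrakk> \<Longrightarrow> obmap (Ten k \<sigma>) As = oten (place \<sigma> As)"
  "\<lbrakk>length fs = k; set fs \<subseteq> arr C\<rbrakk> \<Longrightarrow> armap (Ten k \<sigma>) fs = mten (place \<sigma> fs)"
  "\<lbrakk>i < k; length As = k; set As \<subseteq> ob C; A' \<in> ob C\<rbrakk> \<Longrightarrow> lin (Ten k \<sigma>) i As A' = linten (\<sigma> i) (place \<sigma> As) A'"
  by (simp_all add: Ten_def)

lemma multilinear_Ten:
  assumes \<sigma>: "\<sigma> permutes {..<k}"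
  shows "multilinear_functor (replicate k C) C (Ten k \<sigma>)"
proof -
  have pu: "place \<sigma> (xs[i := a]) = (place \<sigma> xs)[\<sigma> i := a]" if "length xs = k" for xs :: "'x list" and i a
    using that \<sigma> by (simp add: place_update)
  have pn: "place \<sigma> xs ! \<sigma> i = xs ! i" if "length xs = k" "i < k" for xs :: "'x list" and i
    using that \<sigma> by (simp add: place_nth)
  have ps: "set (place \<sigma> xs) = set xs" if "length xs = k" for xs :: "'x list"
    using that \<sigma> by simp
  have pm: "place \<sigma> (map f xs) = map f (place \<sigma> xs)" if "length xs = k" for xs :: "'x list" and f :: "'x \<Rightarrow> 'y"
    using that \<sigma> by (simp add: place_map)
  have si: "\<sigma> i < k \<longleftrightarrow> i < k" for i using permutes_bounds(2)[OF \<sigma>] .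
  have nth_in: "xs ! i \<in> S" if "i < k" "length xs = k" "set xs \<subseteq> S" for xs :: "'x list" and i S
    using that by auto
  note us = set_update_subset
  show ?thesis
  proof
  show "obmap (Ten k \<sigma>) \<in> extensional (ob (cat_list_prod (replicate k C)))"
    "armap (Ten k \<sigma>) \<in> extensional (arr (cat_list_prod (replicate k C)))"
    by (simp_all add: Ten_def)
  show "(\<lambda>(i, As, A'). lin (Ten k \<sigma>) i As A') \<in> extensional (lin_dom (replicate k C))"
    by (auto simp: Ten_def extensional_def)
  show "is_functor (cat_list_prod (replicate k C)) C (obmap (Ten k \<sigma>)) (armap (Ten k \<sigma>))"
    unfolding is_functor_def
  proof (intro conjI ballI impI)
    fix fs gs assume "fs \<in> arr (cat_list_prod (replicate k C))" "gs \<in> arr (cat_list_prod (replicate k C))"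
      and eq: "src (cat_list_prod (replicate k C)) gs = tgt (cat_list_prod (replicate k C)) fs"
    hence fs: "length fs = k" "set fs \<subseteq> arr C" "length gs = k" "set gs \<subseteq> arr C" by auto
    have eq': "map (src C) gs = map (tgt C) fs" using eq fs by simp
    have "set (map2 (cmp C) gs fs) \<subseteq> arr C"
      using fs list_eq_iff_nth_eq[THEN iffD1, OF eq'] by (force simp: set_zip subset_iff)
    moreover have "place \<sigma> (map2 (cmp C) gs fs) = map2 (cmp C) (place \<sigma> gs) (place \<sigma> fs)"
      using fs \<sigma> by (simp add: place_map2)
    moreover have "map (src C) (place \<sigma> gs) = map (tgt C) (place \<sigma> fs)"
      using fs eq' by (metis pm)
    ultimately show "armap (Ten k \<sigma>) (cmp (cat_list_prod (replicate k C)) gs fs) =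
        armap (Ten k \<sigma>) gs \<cdot> armap (Ten k \<sigma>) fs"
      using fs by (simp add: Ten_simps mten_cmp ps)
  qed (auto simp: Ten_simps hom_def pm ps)
  fix i assume "i < length (replicate k C)"
  hence i: "i < k" by simp
  show "nat_trans (cat_list_prod (replicate k C) \<times>\<^sub>c replicate k C ! i) C
        (\<lambda>(As, A'). obmap (Ten k \<sigma>) As \<oplus> obmap (Ten k \<sigma>) (As[i := A']))
        (\<lambda>(fs, f'). armap (Ten k \<sigma>) fs \<boxplus> armap (Ten k \<sigma>) (fs[i := f']))
        (\<lambda>(As, A'). obmap (Ten k \<sigma>) (As[i := As ! i \<oplus>\<^bsub>replicate k C ! i\<^esub> A']))
        (\<lambda>(fs, f'). armap (Ten k \<sigma>) (fs[i := fs ! i \<boxplus>\<^bsub>replicate k C ! i\<^esub> f']))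
        (\<lambda>(As, A'). lin (Ten k \<sigma>) i As A')"
    unfolding nat_trans_def
  proof (intro conjI ballI; clarsimp simp: cat_prod_def i)
    fix As A' assume "set As \<subseteq> ob C" "A' \<in> ob C" "k = length As"
    thus "lin (Ten (length As) \<sigma>) i As A' \<in>
      hom C (obmap (Ten (length As) \<sigma>) As \<oplus> obmap (Ten (length As) \<sigma>) (As[i := A'])) (obmap (Ten (length As) \<sigma>) (As[i := As ! i \<oplus> A']))"
      using i si[of i] ps[of As] linten_simps[of "\<sigma> i" "place \<sigma> As" A']
      by (simp add: Ten_simps hom_def us nth_in pu pn)
  next
    fix fs f' assume "set fs \<subseteq> arr C" "f' \<in> arr C" "k = length fs"
    thus "lin (Ten (length fs) \<sigma>) i (map (tgt C) fs) (tgt C f') \<cdot>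
       (armap (Ten (length fs) \<sigma>) fs \<boxplus> armap (Ten (length fs) \<sigma>) (fs[i := f'])) =
       armap (Ten (length fs) \<sigma>) (fs[i := fs ! i \<boxplus> f']) \<cdot> lin (Ten (length fs) \<sigma>) i (map (src C) fs) (src C f')"
      using i si[of i] linten_natural[of "\<sigma> i" "place \<sigma> fs" f'] ps[of fs]
      by (simp add: Ten_simps us nth_in pu ps si pn pm)
  qed
next
  fix As j assume "As \<in> ob (cat_list_prod (replicate k C))" "j < length (replicate k C)"
    "As ! j = \<zero>\<^bsub>replicate k C ! j\<^esub>"
  hence "length As = k" "set As \<subseteq> ob C" "\<zero> \<in> set As" by (auto simp: in_set_conv_nth)
  thus "obmap (Ten k \<sigma>) As = \<zero>" using \<sigma> by (simp add: Ten_simps oten_zero)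
next
  fix fs j assume "fs \<in> arr (cat_list_prod (replicate k C))" "j < length (replicate k C)"
    "fs ! j = idm (replicate k C ! j) \<zero>\<^bsub>replicate k C ! j\<^esub>"
  hence "length fs = k" "set fs \<subseteq> arr C" "\<iota> \<zero> \<in> set fs" by (auto simp: in_set_conv_nth)
  thus "armap (Ten k \<sigma>) fs = \<iota> \<zero>" using \<sigma> by (simp add: Ten_simps mten_zero)
next
  fix i As A' assume "(i, As, A') \<in> lin_dom (replicate k C)"
  hence i: "i < k" and As: "length As = k" "set As \<subseteq> ob C" "A' \<in> ob C" "As ! i \<in> ob C" by auto
  note b = i As and r = us ps pu pn si
  {
    assume "(\<exists>j < length (replicate k C). As ! j = \<zero>\<^bsub>replicate k C ! j\<^esub>) \<or> A' = \<zero>\<^bsub>replicate k C ! i\<^esub>"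
    hence "\<zero> \<in> set As \<or> A' = \<zero>" using b by (auto simp: in_set_conv_nth)
    thus "lin (Ten k \<sigma>) i As A' = \<iota> (obmap (Ten k \<sigma>) (As[i := As ! i \<oplus>\<^bsub>replicate k C ! i\<^esub> A']))"
      using b linten_zero[of "\<sigma> i" "place \<sigma> As" A'] by (simp add: Ten_simps r)
  next
    fix A'' assume "A'' \<in> ob (replicate k C ! i)"
    thus "lin (Ten k \<sigma>) i (As[i := As ! i \<oplus>\<^bsub>replicate k C ! i\<^esub> A']) A'' \<cdot>
        (lin (Ten k \<sigma>) i As A' \<boxplus> \<iota> (obmap (Ten k \<sigma>) (As[i := A'']))) =
      lin (Ten k \<sigma>) i As (A' \<oplus>\<^bsub>replicate k C ! i\<^esub> A'') \<cdot>
        (\<iota> (obmap (Ten k \<sigma>) As) \<boxplus> lin (Ten k \<sigma>) i (As[i := A']) A'')"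
      using b linten_assoc[of "\<sigma> i" "place \<sigma> As" A' A''] by (simp add: Ten_simps r)
  next
    have "map2 idm (replicate k C) As = map \<iota> As" using As by (simp add: map2_replicate)
    thus "armap (Ten k \<sigma>) ((map2 idm (replicate k C) As)[i := \<zeta>\<^bsub>replicate k C ! i\<^esub> (As ! i) A']) \<cdot> lin (Ten k \<sigma>) i As A' =
      lin (Ten k \<sigma>) i (As[i := A']) (As ! i) \<cdot> \<zeta> (obmap (Ten k \<sigma>) As) (obmap (Ten k \<sigma>) (As[i := A']))"
      using b linten_sym[of "\<sigma> i" "place \<sigma> As" A'] by (simp add: Ten_simps r pm)
  next
    fix l B' assume "(l, As, B') \<in> lin_dom (replicate k C)" "i \<noteq> l"
    hence l: "l < k" "B' \<in> ob C" "\<sigma> i \<noteq> \<sigma> l" "As ! l \<in> ob C" 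
      using permutes_bounds(6)[OF \<sigma>, of i l] As by auto
    thus "lin (Ten k \<sigma>) l (As[i := As ! i \<oplus>\<^bsub>replicate k C ! i\<^esub> A']) B' \<cdot>
        (lin (Ten k \<sigma>) i As A' \<boxplus> lin (Ten k \<sigma>) i (As[l := B']) A') =
      lin (Ten k \<sigma>) i (As[l := As ! l \<oplus>\<^bsub>replicate k C ! l\<^esub> B']) A' \<cdot>
        (lin (Ten k \<sigma>) l As B' \<boxplus> lin (Ten k \<sigma>) l (As[i := A']) B') \<cdot>
        (\<iota> (obmap (Ten k \<sigma>) As) \<boxplus> \<zeta> (obmap (Ten k \<sigma>) (As[i := A'])) (obmap (Ten k \<sigma>) (As[l := B'])) \<boxplus>
          \<iota> (obmap (Ten k \<sigma>) (As[i := A', l := B'])))"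
      using b linten_two[of "\<sigma> i" "\<sigma> l" "place \<sigma> As" A' B'] by (simp add: Ten_simps r)
  }
qed
qed

end

lemma concat_replicates: "concat (map (\<lambda>k. replicate k x) ks) = replicate (sum_list ks) x"
  by (induction ks) (auto simp: replicate_add)

lemma permute_replicate [simp]: "permute_list \<rho> (replicate k x) = replicate k x" if "\<rho> permutes {..<k}"
  using that by (intro nth_equalityI) (auto simp: permute_list_nth permutes_bounds[OF that])

definition places :: "(nat \<Rightarrow> nat) list \<Rightarrow> 'x list list \<Rightarrow> 'x list list" where
  "places \<tau>s xss = map2 place \<tau>s xss"

context ring_category
begin

section \<open>Composition of iterated products\<close>

text \<open>
  The constraint of the product of a concatenation is a composite of two constraints, by \<open>delta_comp\<close> with
  the inner products \<open>P'\<close>, \<open>S'\<close> taken inside the block and the outer ones over the other blocks.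
\<close>

lemma linten_concat:
  assumes q: "q < length Yss" "t < length (Yss ! q)" and ob: "\<forall>Ys \<in> set Yss. set Ys \<subseteq> ob C" "A' \<in> ob C"
  shows "linten (offset (map length Yss) q + t) (concat Yss) A' =
    mten ((map \<iota> (map oten Yss))[q := linten t (Yss ! q) A']) \<cdot>
      linten q (map oten Yss) (oten ((Yss ! q)[t := A']))"
proof -
  let ?Y = "Yss ! q"
  have Y: "set ?Y \<subseteq> ob C" using ob q by auto
  let ?P' = "oten (take t ?Y)" and ?S' = "oten (drop (Suc t) ?Y)"
  let ?P = "oten (take q (map oten Yss))" and ?S = "oten (drop (Suc q) (map oten Yss))"
  have sub: "set (take t ?Y) \<subseteq> ob C" "set (drop (Suc t) ?Y) \<subseteq> ob C"
    "\<forall>Ys \<in> set (take q Yss). set Ys \<subseteq> ob C" "\<forall>Ys \<in> set (drop (Suc q) Yss). set Ys \<subseteq> ob C"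
    using Y ob by (auto dest: in_set_takeD in_set_dropD)
  hence sub': "set (concat (take q Yss)) \<subseteq> ob C" "set (concat (drop (Suc q) Yss)) \<subseteq> ob C" by auto
  have P: "oten (concat (take q Yss)) = ?P" "oten (concat (drop (Suc q) Yss)) = ?S"
    using sub by (simp_all add: oten_concat take_map drop_map)
  have o: "?P \<in> ob C" "?S \<in> ob C" "?P' \<in> ob C" "?S' \<in> ob C" "?Y ! t \<in> ob C"
    using oten_ob[OF sub'(1)] oten_ob[OF sub'(2)] sub Y q by (auto simp: P)
  have "?Y = take t ?Y @ ?Y ! t # drop (Suc t) ?Y" using q(2) by (rule id_take_nth_drop)
  hence oY: "oten ?Y = ?P' \<star> ?Y ! t \<star> ?S'" 
    using sub o oten_append[of "take t ?Y" "?Y ! t # drop (Suc t) ?Y"] by simp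
  have oY': "oten (?Y[t := A']) = ?P' \<star> A' \<star> ?S'"
    using q(2) sub o ob(2) by (simp add: upd_conv_take_nth_drop)
  have d: "linten t ?Y A' \<in> arr C" using q Y ob by simp
  have so: "set (map oten Yss) \<subseteq> ob C" using ob by auto
  have "linten (offset (map length Yss) q + t) (concat Yss) A' = delta (?P \<star> ?P') (?Y ! t) A' (?S' \<star> ?S)"
    using q sub sub' by (simp add: linten_def concat_nth_offset concat_take_offset concat_drop_offset P)
  also have "\<dots> = ten.wh ?P (delta ?P' (?Y ! t) A' ?S') ?S \<cdot> delta ?P (oten ?Y) (oten (?Y[t := A'])) ?S"
    using o ob by (simp add: oY oY' delta_comp)
  also have "ten.wh ?P (delta ?P' (?Y ! t) A' ?S') ?S = mten ((map \<iota> (map oten Yss))[q := linten t ?Y A'])"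
    using q so d by (subst mten_update_idm) (auto simp: linten_def)
  also have "delta ?P (oten ?Y) (oten (?Y[t := A'])) ?S = linten q (map oten Yss) (oten (?Y[t := A']))"
    using q(1) by (simp add: linten_def)
  finally show ?thesis .
qed

lemma ml_comp_Ten:
  assumes \<sigma>: "\<sigma> permutes {..<length ks}" and \<tau>s: "length \<tau>s = length ks"
    "\<And>i. i < length ks \<Longrightarrow> \<tau>s ! i permutes {..<ks ! i}"
  shows "ml_comp (map (\<lambda>k. replicate k C) ks) (replicate (length ks) C) C (Ten (length ks) \<sigma>)
      (map2 Ten ks \<tau>s) = Ten (sum_list ks) (br_comp ks \<sigma> \<tau>s)" (is "?l = ?r")
proof -
  let ?n = "length ks" and ?N = "sum_list ks" and ?\<pi> = "br_comp ks \<sigma> \<tau>s"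
  have ln: "map length (map (\<lambda>k. replicate k C) ks) = ks" by (simp add: o_def)
  have Zn: "places \<tau>s (chunks ks xs) ! i = place (\<tau>s ! i) (chunks ks xs ! i)" "length (places \<tau>s (chunks ks xs)) = ?n"
    "i < ?n \<Longrightarrow> \<tau>s ! i permutes {..<length (chunks ks xs ! i)} \<and> length (chunks ks xs ! i) = ks ! i"
    if "i < ?n" "length xs = ?N" for i and xs :: "'x list"
  proof -
    have "length (chunks ks xs ! i) = ks ! i" using map_length_chunks[OF that(2)] that(1) by (metis length_chunks nth_map)
    thus "places \<tau>s (chunks ks xs) ! i = place (\<tau>s ! i) (chunks ks xs ! i)" "length (places \<tau>s (chunks ks xs)) = ?n"
      "i < ?n \<Longrightarrow> \<tau>s ! i permutes {..<length (chunks ks xs ! i)} \<and> length (chunks ks xs ! i) = ks ! i"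
      using that \<tau>s by (auto simp: places_def)
  qed
  have lZ: "length (places \<tau>s (chunks ks xs)) = ?n" for xs :: "'x list" using \<tau>s by (simp add: places_def)
  have sc: "set (chunks ks xs ! i) \<subseteq> set xs" if "i < ?n" "length xs = ?N" for i and xs :: "'x list"
    using concat_chunks[OF that(2)] that(1) by (metis length_chunks nth_mem set_concat Union_upper image_eqI)
  have sZ: "set (places \<tau>s (chunks ks xs) ! i) \<subseteq> set xs" if "i < ?n" "length xs = ?N" for i and xs :: "'x list"
    using sc[OF that] Zn(1)[OF that] Zn(3)[OF that that(1)] by (metis set_place)
  have sc': "set (chunks ks xs ! i) \<subseteq> S" "set (places \<tau>s (chunks ks xs) ! i) \<subseteq> S"
    if "i < ?n" "length xs = ?N" "set xs \<subseteq> S" for i S and xs :: "'x list"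
    by (rule order_trans[OF sc[OF that(1,2)] that(3)], rule order_trans[OF sZ[OF that(1,2)] that(3)])
  have sZ': "\<forall>ys \<in> set (place \<sigma> (places \<tau>s (chunks ks xs))). set ys \<subseteq> S" 
    if "length xs = ?N" "set xs \<subseteq> S" for S and xs :: "'x list"
  proof
    fix ys assume "ys \<in> set (place \<sigma> (places \<tau>s (chunks ks xs)))"
    hence "ys \<in> set (places \<tau>s (chunks ks xs))" using \<sigma> lZ[of xs] by simp
    then obtain i where "i < ?n" "ys = places \<tau>s (chunks ks xs) ! i" using lZ[of xs] by (metis in_set_conv_nth)
    thus "set ys \<subseteq> S" using sc'(2)[OF _ that] by simp
  qed
  have pc: "place ?\<pi> xs = concat (place \<sigma> (places \<tau>s (chunks ks xs)))" if "length xs = ?N" for xs :: "'x list"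
    using place_br_comp[of \<sigma> "chunks ks xs" \<tau>s] that \<sigma> \<tau>s Zn(3)[OF _ that]
    by (simp add: concat_chunks map_length_chunks places_def)
  have ob: "map2 obmap (map2 Ten ks \<tau>s) (chunks ks As) = map oten (places \<tau>s (chunks ks As))"
    if "length As = ?N" "set As \<subseteq> ob C" for As
    using that Zn(1,3)[OF _ that(1)] sc'(1)[OF _ that] \<tau>s
    by (intro nth_equalityI) (auto simp: Ten_simps lZ)
  have ar: "map2 armap (map2 Ten ks \<tau>s) (chunks ks fs) = map mten (places \<tau>s (chunks ks fs))"
    if "length fs = ?N" "set fs \<subseteq> arr C" for fs
    using that Zn(1,3)[OF _ that(1)] sc'(1)[OF _ that] \<tau>s
    by (intro nth_equalityI) (auto simp: Ten_simps lZ)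
  have so: "set (map oten (places \<tau>s (chunks ks As))) \<subseteq> ob C" if "length As = ?N" "set As \<subseteq> ob C" for As
    using sc'(2)[OF _ that] lZ[of As] by (auto simp: set_conv_nth intro!: oten_ob)
  have sa: "set (map mten (places \<tau>s (chunks ks fs))) \<subseteq> arr C" if "length fs = ?N" "set fs \<subseteq> arr C" for fs
    using sc'(2)[OF _ that] lZ[of fs] by (auto simp: set_conv_nth intro!: mten_simps)
  show ?thesis
  proof (rule mlfun.equality)
    show "obmap ?l = obmap ?r"
    proof
      fix As show "obmap ?l As = obmap ?r As"
      proof (cases "As \<in> ob (cat_list_prod (replicate ?N C))")
        case True
        hence As: "length As = ?N" "set As \<subseteq> ob C" by auto
        have "obmap ?l As = oten (place \<sigma> (map oten (places \<tau>s (chunks ks As))))"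
          unfolding ml_comp_def Let_def ln concat_replicates
          using As so[OF As] lZ[of As] by (simp add: ob Ten_simps del: set_map)
        also have "\<dots> = obmap ?r As"
          using As \<sigma> sZ'[of As] lZ[of As] by (simp add: Ten_simps pc oten_concat place_map)
        finally show ?thesis .
      qed (simp add: ml_comp_def Let_def Ten_def concat_replicates del: ob_power arr_power lin_dom_power)
    qed
    show "armap ?l = armap ?r"
    proof
      fix fs show "armap ?l fs = armap ?r fs"
      proof (cases "fs \<in> arr (cat_list_prod (replicate ?N C))")
        case True
        hence fs: "length fs = ?N" "set fs \<subseteq> arr C" by auto
        have "armap ?l fs = mten (place \<sigma> (map mten (places \<tau>s (chunks ks fs))))"
          unfolding ml_comp_def Let_def ln concat_replicates
          using fs sa[OF fs] lZ[of fs] by (simp add: ar Ten_simps del: set_map)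
        also have "\<dots> = armap ?r fs"
          using fs \<sigma> sZ'[of fs] lZ[of fs] by (simp add: Ten_simps pc mten_concat place_map)
        finally show ?thesis .
      qed (simp add: ml_comp_def Let_def Ten_def concat_replicates del: ob_power arr_power lin_dom_power)
    qed
    show "lin ?l = lin ?r"
    proof (intro ext)
      fix i As A' show "lin ?l i As A' = lin ?r i As A'"
      proof (cases "(i, As, A') \<in> lin_dom (replicate ?N C)")
        case True
        hence i: "i < ?N" and As: "length As = ?N" "set As \<subseteq> ob C" and A': "A' \<in> ob C" by auto
        obtain j l where jl: "j < ?n" "l < ks ! j" "i = offset ks j + l"
          by (rule locate_bounds[OF i])
        have loc: "locate ks i = (j, l)" unfolding jl(3) using jl by (intro locate_offset)
        let ?Z = "places \<tau>s (chunks ks As)" and ?B = "chunks ks As ! j" and ?Yss = "place \<sigma> (places \<tau>s (chunks ks As))"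
          and ?t = "(\<tau>s ! j) l"
        note z = Zn[OF jl(1) As(1)] lZ[of As]
        have B: "length ?B = ks ! j" "set ?B \<subseteq> ob C" "\<tau>s ! j permutes {..<length ?B}"
          using z(3)[OF jl(1)] sc[OF jl(1) As(1)] As by auto
        have sj: "\<sigma> j < ?n" using jl permutes_bounds(2)[OF \<sigma>] by simp
        have t: "?t < ks ! j" using jl B permutes_bounds(2)[OF B(3)] by simp
        have Y: "?Yss ! \<sigma> j = place (\<tau>s ! j) ?B" using \<sigma> z jl by (simp add: place_nth)
        let ?d = "linten ?t (place (\<tau>s ! j) ?B) A'" and ?u = "oten (place (\<tau>s ! j) (?B[l := A']))"
        have d: "?d \<in> arr C" using B t A' by simp
        have "set (?B[l := A']) \<subseteq> ob C" using B A' by (intro set_update_subset)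
        hence u: "?u \<in> ob C" "place (\<tau>s ! j) (?B[l := A']) = (place (\<tau>s ! j) ?B)[?t := A']"
          using place_update[OF B(3)] set_place[of "\<tau>s ! j" "?B[l := A']"] B(3)
          by (simp_all only: oten_ob length_list_update)
        have linB: "lin (map2 Ten ks \<tau>s ! j) l ?B A' = ?d" "obmap (map2 Ten ks \<tau>s ! j) (?B[l := A']) = ?u"
          using jl \<tau>s(1) B A' by (simp_all add: Ten_simps set_update_subset)
        have sets: "set ((map \<iota> (map oten ?Z))[j := ?d]) \<subseteq> arr C"
          using so[OF As] d by (intro set_update_subset) auto
        have "lin ?l i As A' = armap (Ten ?n \<sigma>) ((map \<iota> (map oten ?Z))[j := ?d]) \<cdot> lin (Ten ?n \<sigma>) j (map oten ?Z) ?u"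
          unfolding ml_comp_def Let_def ln concat_replicates using i As A' z
          by (simp add: loc ob linB map2_replicate)
        also have "lin (Ten ?n \<sigma>) j (map oten ?Z) ?u = linten (\<sigma> j) (map oten ?Yss) ?u"
          using jl so[OF As] u z \<sigma> by (simp add: Ten_simps place_map)
        also have "armap (Ten ?n \<sigma>) ((map \<iota> (map oten ?Z))[j := ?d]) = mten ((map \<iota> (map oten ?Yss))[\<sigma> j := ?d])"
          using sets z \<sigma> by (simp add: Ten_simps place_update place_map del: map_map)
        also have "\<dots> \<cdot> linten (\<sigma> j) (map oten ?Yss) ?u =
           linten (offset (map length ?Yss) (\<sigma> j) + ?t) (concat ?Yss) A'"
          using linten_concat[of "\<sigma> j" ?Yss ?t A'] sj z t Y B A' sZ'[OF As] u by simp
        also have "map length ?Yss = place \<sigma> ks"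
          using map_length_yss[of \<sigma> "chunks ks As" \<tau>s] \<sigma> \<tau>s Zn(3)[OF _ As(1)] As by (simp add: places_def map_length_chunks)
        also have "offset (place \<sigma> ks) (\<sigma> j) + ?t = ?\<pi> i"
          unfolding jl(3) using \<sigma> \<tau>s jl by (subst br_comp_offset) auto
        also have "linten (?\<pi> i) (concat ?Yss) A' = lin ?r i As A'"
          using i As A' by (simp add: Ten_simps pc)
        finally show ?thesis .
      qed (simp add: ml_comp_def Let_def Ten_def concat_replicates del: ob_power arr_power lin_dom_power)
    qed
  qed simp
qed

lemma ml_act_Ten:
  assumes "\<sigma> permutes {..<k}" "\<rho> permutes {..<k}"
  shows "ml_act (replicate k C) \<rho> (Ten k \<sigma>) = Ten k (\<sigma> \<circ> \<rho>)"
  using assms permutes_bounds(2)[OF assms(2)]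
  by (auto simp: ml_act_def Ten_def place_comp Let_def fun_eq_iff)

lemma ml_unit_Ten: "ml_unit C = Ten (Suc 0) id"
proof -
  have "cat_list_prod [C] = cat_list_prod (replicate (Suc 0) C)" "lin_dom [C] = lin_dom (replicate (Suc 0) C)" by simp_all
  hence "ml_unit C = \<lparr>obmap = (\<lambda>As \<in> ob (cat_list_prod (replicate (Suc 0) C)). hd As),
     armap = (\<lambda>fs \<in> arr (cat_list_prod (replicate (Suc 0) C)). hd fs),
     lin = (\<lambda>i As A'. if (i, As, A') \<in> lin_dom (replicate (Suc 0) C) then idm C (hd As \<oplus>\<^bsub>C\<^esub> A') else undefined)\<rparr>"
    by (simp add: ml_unit_def)
  also have "\<dots> = Ten (Suc 0) id"
    by (auto simp del: replicate.simps simp: Ten_def fun_eq_iff restrict_def length_Suc_conv linten_def delta_one dr_one)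
  finally show ?thesis .
qed

end

section \<open>Braid words act on iterated products\<close>

context smon
begin

text \<open>
  Morphisms in disjoint places of a product commute; this is the interchange law.
\<close>

lemma wh_far:
  assumes "x \<in> arr C" "y \<in> arr C" "P \<in> ob C" "M \<in> ob C" "S \<in> ob C"
  shows "wh P x (to M (to (tgt C y) S)) \<cdot> wh (to P (to (src C x) M)) y S =
    wh (to P (to (tgt C x) M)) y S \<cdot> wh P x (to M (to (src C y) S))"
  using assms tm_interchange[of "tm (idm C P) (tm x (idm C M))" "tm y (idm C S)"]
  by (simp add: wh_def flip: tm_simps(7))

lemma wh_tm:
  assumes "x \<in> arr C" "P \<in> ob C" "S \<in> ob C" "A \<in> ob C"
  shows "wh P (tm x (idm C A)) S = wh P x (to A S)" "wh P (tm (idm C A) x) S = wh (to P A) x S"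
  using assms by (simp_all add: wh_def flip: tm_simps(7))

end

context braided_ring_category
begin

lemma bra_simps [simp]:
  "\<lbrakk>A \<in> ob C; B \<in> ob C\<rbrakk> \<Longrightarrow> bra R A B \<in> arr C"
  "\<lbrakk>A \<in> ob C; B \<in> ob C\<rbrakk> \<Longrightarrow> src C (bra R A B) = A \<star> B"
  "\<lbrakk>A \<in> ob C; B \<in> ob C\<rbrakk> \<Longrightarrow> tgt C (bra R A B) = B \<star> A"
  using times_braiding by (auto simp: is_braiding_def nat_trans_def cat_prod_def hom_def)

lemma bra_natural:
  "\<lbrakk>f \<in> arr C; g \<in> arr C\<rbrakk> \<Longrightarrow> bra R (tgt C f) (tgt C g) \<cdot> (f \<diamondop> g) = (g \<diamondop> f) \<cdot> bra R (src C f) (src C g)"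
  using times_braiding by (auto simp: is_braiding_def nat_trans_def cat_prod_def)

lemma bra_hexagon:
  assumes "A \<in> ob C" "B \<in> ob C" "D \<in> ob C"
  shows "bra R A (B \<star> D) = (\<iota> B \<diamondop> bra R A D) \<cdot> (bra R A B \<diamondop> \<iota> D)"
    "bra R (A \<star> B) D = (bra R A D \<diamondop> \<iota> B) \<cdot> (\<iota> A \<diamondop> bra R B D)"
  using times_braiding assms by (auto simp: is_braiding_def)

definition ibra :: "'o \<Rightarrow> 'o \<Rightarrow> 'm" where
  "ibra A B = (SOME g. g \<in> hom C (B \<star> A) (A \<star> B) \<and>
     g \<cdot> bra R A B = \<iota> (A \<star> B) \<and> bra R A B \<cdot> g = \<iota> (B \<star> A))"

lemma ibra_simps [simp]:
  assumes "A \<in> ob C" "B \<in> ob C"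
  shows "ibra A B \<in> arr C" "src C (ibra A B) = B \<star> A" "tgt C (ibra A B) = A \<star> B"
    "ibra A B \<cdot> bra R A B = \<iota> (A \<star> B)" "bra R A B \<cdot> ibra A B = \<iota> (B \<star> A)"
proof -
  have "is_iso C (bra R A B)" using times_braiding assms by (auto simp: is_braiding_def)
  hence "\<exists>g. g \<in> hom C (B \<star> A) (A \<star> B) \<and> g \<cdot> bra R A B = \<iota> (A \<star> B) \<and> bra R A B \<cdot> g = \<iota> (B \<star> A)"
    using assms by (auto simp: is_iso_def)
  from someI_ex[OF this, folded ibra_def]
  show "ibra A B \<in> arr C" "src C (ibra A B) = B \<star> A" "tgt C (ibra A B) = A \<star> B"
    "ibra A B \<cdot> bra R A B = \<iota> (A \<star> B)" "bra R A B \<cdot> ibra A B = \<iota> (B \<star> A)"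
    by (auto simp: hom_def)
qed

lemma ibra_eqI:
  assumes "A \<in> ob C" "B \<in> ob C" "g \<in> arr C" "src C g = B \<star> A" "tgt C g = A \<star> B"
    "g \<cdot> bra R A B = \<iota> (A \<star> B)"
  shows "ibra A B = g"
  using assms by (intro inverse_unique[of "bra R A B" g "ibra A B", symmetric]) auto

text \<open>
  Positive and negative letters both exchange two neighbouring factors; treating them uniformly avoids
  most case distinctions on the sign.
\<close>

definition lbra :: "bool \<Rightarrow> 'o \<Rightarrow> 'o \<Rightarrow> 'm" where
  "lbra e A B = (if e then bra R A B else ibra B A)"

lemma lbra_simps [simp]:
  assumes "A \<in> ob C" "B \<in> ob C"
  shows "lbra e A B \<in> arr C" "src C (lbra e A B) = A \<star> B" "tgt C (lbra e A B) = B \<star> A"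
    "lbra e B A \<cdot> lbra (\<not> e) A B = \<iota> (A \<star> B)"
  using assms by (auto simp: lbra_def)

text \<open>
  Transports naturality and compatibility with \<open>delta\<close> from the braiding to its inverse.
\<close>

lemma iso_square:
  assumes "f \<in> arr C" "f' \<in> arr C" "g \<in> arr C" "g' \<in> arr C" "d \<in> arr C" "d' \<in> arr C"
    and "src C f = tgt C d" "src C d' = tgt C g" "src C g = src C d" "tgt C d' = tgt C f"
    and "src C f' = tgt C f" "tgt C f' = src C f" "src C g' = tgt C g" "tgt C g' = src C g"
    and "f' \<cdot> f = \<iota> (src C f)" "g \<cdot> g' = \<iota> (tgt C g)"
    and sq: "f \<cdot> d = d' \<cdot> g"
  shows "f' \<cdot> d' = d \<cdot> g'"
proof -
  have "f' \<cdot> d' = f' \<cdot> (d' \<cdot> (g \<cdot> g'))" using assms by simp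
  also have "\<dots> = f' \<cdot> ((d' \<cdot> g) \<cdot> g')" using assms(1-14) by (simp add: cmp_assoc')
  also have "\<dots> = (f' \<cdot> f) \<cdot> (d \<cdot> g')" using assms(1-14) by (simp add: cmp_assoc' flip: sq)
  finally show ?thesis using assms by simp
qed

lemma lbra_natural:
  assumes "f \<in> arr C" "g \<in> arr C"
  shows "lbra e (tgt C f) (tgt C g) \<cdot> (f \<diamondop> g) = (g \<diamondop> f) \<cdot> lbra e (src C f) (src C g)"
proof (cases e)
  case False
  thus ?thesis using assms bra_natural[of g f]
      iso_square[of "bra R (tgt C g) (tgt C f)" "ibra (tgt C g) (tgt C f)" "bra R (src C g) (src C f)"
        "ibra (src C g) (src C f)" "g \<diamondop> f" "f \<diamondop> g"]
    by (simp add: lbra_def)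
qed (use assms bra_natural in \<open>simp add: lbra_def\<close>)

lemma lbra_zero:
  assumes "A \<in> ob C"
  shows "lbra e A \<zero> = \<iota> \<zero>" "lbra e \<zero> A = \<iota> \<zero>"
proof -
  have "ibra A \<zero> = \<iota> \<zero>" "ibra \<zero> A = \<iota> \<zero>"
    using assms by (auto intro!: ibra_eqI simp: bra_zero_left bra_zero_right)
  thus "lbra e A \<zero> = \<iota> \<zero>" "lbra e \<zero> A = \<iota> \<zero>"
    using assms by (auto simp: lbra_def bra_zero_left bra_zero_right)
qed

text \<open>
  The two axioms relating the braiding to \<open>\<partial>\<^sup>l\<close> and \<open>\<partial>\<^sup>r\<close>, inside a longer product: the position of the
  variable changes from one side of \<open>B\<close> to the other.
\<close>

lemma bra_delta:
  assumes o: "P \<in> ob C" "A \<in> ob C" "A' \<in> ob C" "B \<in> ob C" "S \<in> ob C"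
  shows "ten.wh P (bra R (A \<oplus> A') B) S \<cdot> delta P A A' (B \<star> S) =
      delta (P \<star> B) A A' S \<cdot> (ten.wh P (bra R A B) S \<boxplus> ten.wh P (bra R A' B) S)"
    "ten.wh P (bra R B (A \<oplus> A')) S \<cdot> delta (P \<star> B) A A' S =
      delta P A A' (B \<star> S) \<cdot> (ten.wh P (bra R B A) S \<boxplus> ten.wh P (bra R B A') S)"
proof -
  let ?w = "\<lambda>f. ten.wh P f S"
  have d1: "delta P A A' (B \<star> S) = ?w (dl R A A' B) \<cdot> delta P (A \<star> B) (A' \<star> B) S"
    using o delta_comp[of P "oone R" A A' S B] by (simp add: delta_one)
  have d2: "delta (P \<star> B) A A' S = ?w (dr R B A A') \<cdot> delta P (B \<star> A) (B \<star> A') S"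
    using o delta_comp[of P B A A' S "oone R"] by (simp add: delta_one)
  have "?w (bra R (A \<oplus> A') B) \<cdot> delta P A A' (B \<star> S) = ?w (bra R (A \<oplus> A') B \<cdot> dl R A A' B) \<cdot> delta P (A \<star> B) (A' \<star> B) S"
    using o by (simp add: d1 cmp_assoc' flip: ten.wh_cmp)
  also have "\<dots> = ?w (dr R B A A') \<cdot> (?w (bra R A B \<boxplus> bra R A' B) \<cdot> delta P (A \<star> B) (A' \<star> B) S)"
    using o by (simp add: bra_dl cmp_assoc' flip: ten.wh_cmp)
  also have "?w (bra R A B \<boxplus> bra R A' B) \<cdot> delta P (A \<star> B) (A' \<star> B) S =
      delta P (B \<star> A) (B \<star> A') S \<cdot> (?w (bra R A B) \<boxplus> ?w (bra R A' B))"
    using o by (intro delta_natural_mid[symmetric]) auto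
  finally show "?w (bra R (A \<oplus> A') B) \<cdot> delta P A A' (B \<star> S) =
      delta (P \<star> B) A A' S \<cdot> (?w (bra R A B) \<boxplus> ?w (bra R A' B))"
    using o by (simp add: d2 cmp_assoc')
  have "?w (bra R B (A \<oplus> A')) \<cdot> delta (P \<star> B) A A' S = ?w (bra R B (A \<oplus> A') \<cdot> dr R B A A') \<cdot> delta P (B \<star> A) (B \<star> A') S"
    using o by (simp add: d2 cmp_assoc' flip: ten.wh_cmp)
  also have "\<dots> = ?w (dl R A A' B) \<cdot> (?w (bra R B A \<boxplus> bra R B A') \<cdot> delta P (B \<star> A) (B \<star> A') S)"
    using o by (simp add: bra_dr cmp_assoc' flip: ten.wh_cmp)
  also have "?w (bra R B A \<boxplus> bra R B A') \<cdot> delta P (B \<star> A) (B \<star> A') S =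
      delta P (A \<star> B) (A' \<star> B) S \<cdot> (?w (bra R B A) \<boxplus> ?w (bra R B A'))"
    using o by (intro delta_natural_mid[symmetric]) auto
  finally show "?w (bra R B (A \<oplus> A')) \<cdot> delta (P \<star> B) A A' S =
      delta P A A' (B \<star> S) \<cdot> (?w (bra R B A) \<boxplus> ?w (bra R B A'))"
    using o by (simp add: d1 cmp_assoc')
qed

lemma lbra_delta:
  assumes o: "P \<in> ob C" "A \<in> ob C" "A' \<in> ob C" "B \<in> ob C" "S \<in> ob C"
  shows "ten.wh P (lbra e (A \<oplus> A') B) S \<cdot> delta P A A' (B \<star> S) =
      delta (P \<star> B) A A' S \<cdot> (ten.wh P (lbra e A B) S \<boxplus> ten.wh P (lbra e A' B) S)" (is ?a)
    and "ten.wh P (lbra e B (A \<oplus> A')) S \<cdot> delta (P \<star> B) A A' S =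
      delta P A A' (B \<star> S) \<cdot> (ten.wh P (lbra e B A) S \<boxplus> ten.wh P (lbra e B A') S)" (is ?b)
proof -
  have "?a \<and> ?b"
  proof (cases e)
    case False
    have ?a unfolding lbra_def using False o
      by (simp, intro iso_square[OF _ _ _ _ _ _ _ _ _ _ _ _ _ _ _ _ bra_delta(2)])
         (simp_all add: sum.tm_cmp ten.wh_cmp)
    moreover have ?b unfolding lbra_def using False o
      by (simp, intro iso_square[OF _ _ _ _ _ _ _ _ _ _ _ _ _ _ _ _ bra_delta(1)])
         (simp_all add: sum.tm_cmp ten.wh_cmp)
    ultimately show ?thesis ..
  qed (use o bra_delta in \<open>simp add: lbra_def\<close>)
  thus ?a ?b by auto
qed

definition ltr :: "nat \<times> bool \<Rightarrow> 'o list \<Rightarrow> 'm" where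
  "ltr x As = ten.wh (oten (take (fst x) As)) (lbra (snd x) (As ! fst x) (As ! Suc (fst x)))
     (oten (drop (Suc (Suc (fst x))) As))"

text \<open>
  The action of a braid word on a product of objects, from the product of \<open>As\<close> to the product of
  \<open>wact w As\<close>.
\<close>

primrec ev :: "braid_word \<Rightarrow> 'o list \<Rightarrow> 'm" where
  "ev [] As = \<iota> (oten As)"
| "ev (x # w) As = ltr x (wact w As) \<cdot> ev w As"

lemma ltr_split:
  "length L = i \<Longrightarrow> ltr (i, e) (L @ A # B # S) = ten.wh (oten L) (lbra e A B) (oten S)"
  by (auto simp: ltr_def nth_append)

lemma split_letter:
  assumes "Suc (fst x) < length xs"
  obtains L a b S e where "x = (length L, e)" "xs = L @ a # b # S"
  using split_two[OF assms] by (metis prod.collapse)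

lemma ltr_simps [simp]:
  assumes "Suc (fst x) < length As" "set As \<subseteq> ob C"
  shows "ltr x As \<in> arr C" "src C (ltr x As) = oten As" "tgt C (ltr x As) = oten (swap_at (fst x) As)"
proof -
  obtain L a b S e where "x = (length L, e)" "As = L @ a # b # S"
    by (rule split_letter[OF assms(1)])
  thus "ltr x As \<in> arr C" "src C (ltr x As) = oten As" "tgt C (ltr x As) = oten (swap_at (fst x) As)"
    using assms by (auto simp: ltr_split)
qed

lemma ev_simps [simp]:
  assumes "w \<in> braid_words (length As)" "set As \<subseteq> ob C"
  shows "ev w As \<in> arr C" "src C (ev w As) = oten As" "tgt C (ev w As) = oten (wact w As)"
proof -
  have "ev w As \<in> arr C \<and> src C (ev w As) = oten As \<and> tgt C (ev w As) = oten (wact w As)"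
    using assms(1)
  proof (induction w)
    case (Cons x w)
    thus ?case using assms(2) ltr_simps[of x "wact w As"] by simp
  qed (use assms in simp)
  thus "ev w As \<in> arr C" "src C (ev w As) = oten As" "tgt C (ev w As) = oten (wact w As)" by auto
qed

lemma ev_append:
  assumes "u \<in> braid_words (length As)" "v \<in> braid_words (length As)" "set As \<subseteq> ob C"
  shows "ev (u @ v) As = ev u (wact v As) \<cdot> ev v As"
  using assms(1)
proof (induction u)
  case Nil
  thus ?case using assms by simp
next
  case (Cons x u)
  thus ?case using assms by (simp add: wact_append cmp_assoc')
qed

lemma ev_cancel:
  assumes "Suc i < length As" "set As \<subseteq> ob C"
  shows "ev [(i, e), (i, \<not> e)] As = \<iota> (oten As)"
  using assms(1)
proof (rule split_two)
  fix L a b S assume s: "As = L @ a # b # S" "length L = i"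
  hence "a \<in> ob C" "b \<in> ob C" "set L \<subseteq> ob C" "set S \<subseteq> ob C" using assms by auto
  thus ?thesis unfolding s(1) s(2)[symmetric] by (simp add: ltr_split ten.wh_cmp)
qed

lemma ev_far:
  assumes "Suc i < j" "Suc j < length As" "set As \<subseteq> ob C"
  shows "ev [(i, e), (j, e')] As = ev [(j, e'), (i, e)] As"
proof -
  obtain K c d S where K: "As = K @ c # d # S" "length K = j"
    by (rule split_two[OF assms(2)])
  have "Suc i < length K" using assms K by simp
  then obtain L a b M where L: "K = L @ a # b # M" "length L = i"
    by (rule split_two)
  have As: "As = L @ a # b # M @ c # d # S" using K L by simp
  have j: "length (L @ x # y # M) = j" for x y using K L by simp
  have sj: "swap_at j (L @ x # y # M @ c # d # S) = L @ x # y # M @ d # c # S"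
     "ltr (j, e') (L @ x # y # M @ c # d # S) = ten.wh (oten (L @ x # y # M)) (lbra e' c d) (oten S)" for x y
    using swap_at_append[of "L @ x # y # M" c d S] ltr_split[OF j[of x y], of e' c d S]
    unfolding j by simp_all
  have si: "swap_at i (L @ a # b # X) = L @ b # a # X"
    "ltr (i, e) (L @ a # b # X) = ten.wh (oten L) (lbra e a b) (oten X)" for X
    using swap_at_append[of L a b X] ltr_split[OF L(2)] unfolding L(2) by simp_all
  have o: "a \<in> ob C" "b \<in> ob C" "c \<in> ob C" "d \<in> ob C" "set L \<subseteq> ob C" "set M \<subseteq> ob C" "set S \<subseteq> ob C"
    using assms(3) unfolding As by auto
  show ?thesis
    using o ten.wh_far[of "lbra e a b" "lbra e' c d" "oten L" "oten M" "oten S"]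
    unfolding As by (simp add: si sj)
qed

text \<open>
  Naturality of the braiding of \<open>A\<close> with respect to the braiding of \<open>B\<close> and \<open>D\<close>, both sides expanded
  by the hexagon.
\<close>

lemma bra_yang_baxter:
  assumes "A \<in> ob C" "B \<in> ob C" "D \<in> ob C"
  shows "(bra R B D \<diamondop> \<iota> A) \<cdot> ((\<iota> B \<diamondop> bra R A D) \<cdot> (bra R A B \<diamondop> \<iota> D)) =
    (\<iota> D \<diamondop> bra R A B) \<cdot> ((bra R A D \<diamondop> \<iota> B) \<cdot> (\<iota> A \<diamondop> bra R B D))"
proof -
  have "(bra R B D \<diamondop> \<iota> A) \<cdot> bra R A (B \<star> D) = bra R A (D \<star> B) \<cdot> (\<iota> A \<diamondop> bra R B D)"
    using assms bra_natural[of "\<iota> A" "bra R B D"] by simp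
  thus ?thesis using assms by (simp add: bra_hexagon cmp_assoc')
qed

lemma ev_near:
  assumes "Suc (Suc i) < length As" "set As \<subseteq> ob C"
  shows "ev [(i, True), (Suc i, True), (i, True)] As = ev [(Suc i, True), (i, True), (Suc i, True)] As"
proof -
  obtain L a b S' where s: "As = L @ a # b # S'" "length L = i"
    by (rule split_two[OF Suc_lessD[OF assms(1)]])
  then obtain c S where c: "S' = c # S" using assms by (cases S') auto
  have o: "a \<in> ob C" "b \<in> ob C" "c \<in> ob C" "oten L \<in> ob C" "oten S \<in> ob C" "set L \<subseteq> ob C" "set S \<subseteq> ob C"
    using assms s c by auto
  have l1: "ltr (i, True) (L @ x # y # z # S) = ten.wh (oten L) (bra R x y \<diamondop> \<iota> z) (oten S)"
    "ltr (Suc i, True) (L @ x # y # z # S) = ten.wh (oten L) (\<iota> x \<diamondop> bra R y z) (oten S)"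
    if "x \<in> ob C" "y \<in> ob C" "z \<in> ob C" for x y z
    using that o s(2) ltr_split[of "L @ [x]" "Suc i" True y z S]
    by (simp_all add: ltr_split lbra_def ten.wh_tm)
  show ?thesis
    using o arg_cong[OF bra_yang_baxter[of a b c], of "\<lambda>f. ten.wh (oten L) f (oten S)"]
    unfolding s(1) c s(2)[symmetric]
    by (simp add: l1[unfolded s(2)[symmetric]] ten.wh_cmp)
qed

text \<open>
  The relations hold by cancellation, by the interchange law and by the Yang-Baxter equation. Hence braids,
  and not only words, act on products.
\<close>

lemma ev_cong:
  "\<lbrakk>braid_eq k u v; length As = k; set As \<subseteq> ob C\<rbrakk> \<Longrightarrow> ev u As = ev v As"
proof (induction arbitrary: As rule: braid_eq.induct)
  have ctx: "ev (u @ a @ v) As = ev (u @ b @ v) As"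
    if "u \<in> braid_words k" "v \<in> braid_words k" "braid_eq k a b" "length As = k" "set As \<subseteq> ob C"
      "ev a (wact v As) = ev b (wact v As)" for u v a b As
    using that braid_eq_words[OF that(3)] wact_cong[OF that(3), of "wact v As"]
    by (simp add: ev_append wact_append)
  {
    case (cancel u v i e)
    thus ?case using ctx[of u v "[(i, e), (i, \<not> e)]" "[]" As] braid_eq.cancel[of "[]" k "[]" i e]
        ev_cancel[of i "wact v As" e] by simp
  next
    case (far u v i j)
    thus ?case using ctx[of u v "[(i, True), (j, True)]" "[(j, True), (i, True)]" As]
        braid_eq.far[of "[]" k "[]" i j] ev_far[of i j "wact v As" True True] by simp
  next
    case (near u v i)
    thus ?case using ctx[of u v "[(i, True), (Suc i, True), (i, True)]" "[(Suc i, True), (i, True), (Suc i, True)]" As]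
        braid_eq.near[of "[]" k "[]" i] ev_near[of i "wact v As"] by simp
  }
qed auto

lemma ltr_natural:
  assumes "Suc (fst x) < length fs" "set fs \<subseteq> arr C"
  shows "ltr x (map (tgt C) fs) \<cdot> mten fs = mten (swap_at (fst x) fs) \<cdot> ltr x (map (src C) fs)"
proof -
  obtain L f g S e where s: "x = (length L, e)" "fs = L @ f # g # S"
    by (rule split_letter[OF assms(1)])
  have o: "f \<in> arr C" "g \<in> arr C" "set L \<subseteq> arr C" "set S \<subseteq> arr C" using assms s by auto
  have l: "ltr (length L, e) (map h L @ a # b # map h S) = ten.wh (oten (map h L)) (lbra e a b) (oten (map h S))" for h a b
    by (simp add: ltr_split)
  have "ten.wh (oten (map (tgt C) L)) (lbra e (tgt C f) (tgt C g)) (oten (map (tgt C) S)) \<cdot> (mten L \<diamondop> (f \<diamondop> g) \<diamondop> mten S) =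
     mten L \<diamondop> (lbra e (tgt C f) (tgt C g) \<cdot> (f \<diamondop> g)) \<diamondop> mten S"
    using o by (simp add: ten.wh_def ten.tm_cmp del: ten.tm_simps(4))
  also have "\<dots> = mten L \<diamondop> ((g \<diamondop> f) \<cdot> lbra e (src C f) (src C g)) \<diamondop> mten S"
    using o by (simp add: lbra_natural)
  also have "\<dots> = (mten L \<diamondop> (g \<diamondop> f) \<diamondop> mten S) \<cdot> ten.wh (oten (map (src C) L)) (lbra e (src C f) (src C g)) (oten (map (src C) S))"
    using o by (simp add: ten.wh_def ten.tm_cmp del: ten.tm_simps(4))
  finally show ?thesis using o by (simp add: s l)
qed

lemma ev_natural:
  assumes "w \<in> braid_words (length fs)" "set fs \<subseteq> arr C"
  shows "ev w (map (tgt C) fs) \<cdot> mten fs = mten (wact w fs) \<cdot> ev w (map (src C) fs)"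
  using assms(1)
proof (induction w)
  case (Cons x w)
  have "ev (x # w) (map (tgt C) fs) \<cdot> mten fs = ltr x (map (tgt C) (wact w fs)) \<cdot> (ev w (map (tgt C) fs) \<cdot> mten fs)"
    using Cons.prems assms by (simp add: cmp_assoc' map_wact)
  also have "\<dots> = (ltr x (map (tgt C) (wact w fs)) \<cdot> mten (wact w fs)) \<cdot> ev w (map (src C) fs)"
    using Cons assms by (simp add: cmp_assoc' map_wact)
  also have "\<dots> = mten (wact (x # w) fs) \<cdot> (ltr x (map (src C) (wact w fs)) \<cdot> ev w (map (src C) fs))"
    using Cons.prems assms by (simp add: ltr_natural) (simp add: cmp_assoc' map_wact map_swap_at)
  finally show ?case using Cons.prems by (simp add: map_wact)
qed (use assms in simp)

lemma ltr_zero: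
  assumes "Suc (fst x) < length As" "set As \<subseteq> ob C" "\<zero> \<in> set As"
  shows "ltr x As = \<iota> \<zero>"
proof -
  obtain L a b S e where s: "x = (length L, e)" "As = L @ a # b # S"
    by (rule split_letter[OF assms(1)])
  have "oten L = \<zero> \<or> a = \<zero> \<or> b = \<zero> \<or> oten S = \<zero>"
    using assms s oten_zero[of L] oten_zero[of S] by auto
  thus ?thesis using assms(2) by (auto simp: s ltr_split ten.wh_def lbra_zero)
qed

lemma ev_zero:
  "\<lbrakk>w \<in> braid_words (length As); set As \<subseteq> ob C; \<zero> \<in> set As\<rbrakk> \<Longrightarrow> ev w As = \<iota> \<zero>"
proof (induction w)
  case (Cons x w)
  thus ?case using ltr_zero[of x "wact w As"] by simp
qed (simp add: oten_zero)

end

context smon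
begin

lemma wh_left: "\<lbrakk>f \<in> arr C; P \<in> ob C; Q \<in> ob C; S \<in> ob C\<rbrakk> \<Longrightarrow> tm (idm C P) (wh Q f S) = wh (to P Q) f S"
  by (simp add: wh_def flip: tm_simps(4,7))

lemma wh_right: "\<lbrakk>f \<in> arr C; T \<in> ob C; Q \<in> ob C; S \<in> ob C\<rbrakk> \<Longrightarrow> tm (wh Q f S) (idm C T) = wh Q f (to S T)"
  by (simp add: wh_def flip: tm_simps(7))

end

context braided_ring_category
begin

text \<open>
  A variable away from the crossing only needs naturality of \<open>delta\<close> in its outer factors. A variable
  on one of the two crossing strands needs the compatibility of the braiding with \<open>delta\<close>.
\<close>

lemma ltr_lin:
  assumes "Suc (fst x) < length As" "set As \<subseteq> ob C" "j < length As" "A' \<in> ob C"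
  shows "ltr x (As[j := As ! j \<oplus> A']) \<cdot> linten j As A' =
    linten (transpose (fst x) (Suc (fst x)) j) (swap_at (fst x) As) A' \<cdot> (ltr x As \<boxplus> ltr x (As[j := A']))"
proof -
  obtain L a b S e where s: "x = (length L, e)" "As = L @ a # b # S"
    by (rule split_letter[OF assms(1)])
  have o: "a \<in> ob C" "b \<in> ob C" "set L \<subseteq> ob C" "set S \<subseteq> ob C" "oten L \<in> ob C" "oten S \<in> ob C"
    using assms s by auto
  consider "j < length L" | "j = length L" | "j = Suc (length L)" | "Suc (length L) < j" by linarith
  thus ?thesis
  proof cases
    case 1
    then obtain L1 c L2 where L: "L = L1 @ c # L2" "length L1 = j" by (rule split_one)
    have o': "c \<in> ob C" "set L1 \<subseteq> ob C" "set L2 \<subseteq> ob C" using o L by auto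
    have l: "length (L1 @ y # L2) = length L" for y using L by simp
    have sw: "swap_at (length L) (L1 @ y # L2 @ a # b # S) = L1 @ y # L2 @ b # a # S"
      "ltr (length L, e) (L1 @ y # L2 @ a # b # S) = ten.wh (oten (L1 @ y # L2)) (lbra e a b) (oten S)" for y
      using swap_at_append[of "L1 @ y # L2" a b S] ltr_split[OF l[of y], of e a b S] unfolding l by simp_all
    have up: "(L1 @ y # Z)[j := z] = L1 @ z # Z" "(L1 @ y # Z) ! j = y"
      "linten j (L1 @ y # Z) A' = delta (oten L1) y A' (oten Z)" for y z Z
      using L(2) by (auto simp: linten_split)
    have As: "As = L1 @ c # L2 @ a # b # S" using s L by simp
    have tr: "transpose (length L) (Suc (length L)) j = j" using 1 by (simp add: transpose_def)
    show ?thesis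
      unfolding s(1) fst_conv tr As using o o' assms(4)
        delta_natural[of "\<iota> (oten L1)" "\<iota> c" "\<iota> A'" "ten.wh (oten L2) (lbra e a b) (oten S)"]
      by (simp add: sw up ten.wh_left)
  next
    case 2
    have tr: "transpose (length L) (Suc (length L)) j = Suc (length L)" using 2 by simp
    have up: "linten (Suc (length L)) (L @ b # a # S) A' = delta (oten L \<star> b) a A' (oten S)"
      using linten_split[of "L @ [b]" "Suc (length L)" a S A'] o by simp
    show ?thesis
      unfolding s fst_conv tr using o assms(4) lbra_delta(1)[of "oten L" a A' b "oten S" e]
      by (simp add: 2 up ltr_split linten_split)
  next
    case 3
    have tr: "transpose (length L) (Suc (length L)) j = length L" using 3 by simp
    have up: "(L @ a # b # S)[Suc (length L) := z] = L @ a # z # S" "(L @ a # b # S) ! Suc (length L) = b"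
      "linten (Suc (length L)) (L @ a # b # S) A' = delta (oten L \<star> a) b A' (oten S)" for z
      using linten_split[of "L @ [a]" "Suc (length L)" b S A'] o
        list_update_length[of "L @ [a]" b S z] nth_append_length[of "L @ [a]" b S] by simp_all
    show ?thesis
      unfolding s fst_conv tr 3 using o assms(4) lbra_delta(2)[of "oten L" b A' a "oten S" e]
      by (simp add: up ltr_split linten_split)
  next
    case 4
    define i where "i = j - Suc (Suc (length L))"
    have i: "j = length L + Suc (Suc i)" "i < length S" using 4 assms(3) s by (auto simp: i_def)
    obtain S1 c S2 where S: "S = S1 @ c # S2" "length S1 = i" by (rule split_one[OF i(2)])
    have o': "c \<in> ob C" "set S1 \<subseteq> ob C" "set S2 \<subseteq> ob C" using o S by auto
    have l: "length (L @ p # q # S1) = j" for p q using S i by simp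
    have up: "(L @ p # q # S1 @ y # S2)[j := z] = L @ p # q # S1 @ z # S2" "(L @ p # q # S1 @ y # S2) ! j = y"
      "linten j (L @ p # q # S1 @ y # S2) A' = delta (oten (L @ p # q # S1)) y A' (oten S2)" for p q y z
      using list_update_length[of "L @ p # q # S1" y S2 z] nth_append_length[of "L @ p # q # S1" y S2]
       linten_split[OF l[of p q], of y S2 A'] unfolding l by simp_all
    have tr: "transpose (length L) (Suc (length L)) j = j" using 4 by (simp add: transpose_def)
    show ?thesis
      unfolding s S fst_conv tr using o o' assms(4)
        delta_natural[of "ten.wh (oten L) (lbra e a b) (oten S1)" "\<iota> c" "\<iota> A'" "\<iota> (oten S2)"]
      by (simp add: up ltr_split ten.wh_right)
  qed
qed

lemma ev_lin:
  assumes "w \<in> braid_words (length As)" "set As \<subseteq> ob C" "j < length As" "A' \<in> ob C"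
  shows "ev w (As[j := As ! j \<oplus> A']) \<cdot> linten j As A' =
    linten (word_perm w j) (wact w As) A' \<cdot> (ev w As \<boxplus> ev w (As[j := A']))"
  using assms(1)
proof (induction w)
  case Nil
  thus ?case using assms set_update_subset[of As "ob C"] by (simp add: nth_mem subset_iff)
next
  case (Cons x w)
  let ?Bs = "wact w As" and ?q = "word_perm w j"
  have w: "w \<in> braid_words (length As)" "Suc (fst x) < length ?Bs" using Cons.prems by auto
  have q: "?q < length As" using permutes_bounds(2)[OF word_perm_permutes[OF w(1)]] assms(3) by simp
  have n: "?Bs ! ?q = As ! j" "As ! j \<in> ob C" using w assms by (auto simp: wact_nth)
  have Bs: "set ?Bs \<subseteq> ob C" using w assms by simp
  have up: "wact w (As[j := a]) = ?Bs[?q := a]" for a using w(1) by (rule wact_update)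
  have us: "set (As[j := a]) \<subseteq> ob C" if "a \<in> ob C" for a using assms(2) that by (rule set_update_subset)
  have ub: "set (?Bs[?q := a]) \<subseteq> ob C" if "a \<in> ob C" for a using Bs that by (rule set_update_subset)
  note t = ev_simps[of w "As[j := As ! j \<oplus> A']"] ev_simps[of w "As[j := A']"]
  have "ev (x # w) (As[j := As ! j \<oplus> A']) \<cdot> linten j As A' =
      ltr x (?Bs[?q := ?Bs ! ?q \<oplus> A']) \<cdot> (ev w (As[j := As ! j \<oplus> A']) \<cdot> linten j As A')"
    using assms w q n us ub by (simp add: up cmp_assoc')
  also have "\<dots> = (ltr x (?Bs[?q := ?Bs ! ?q \<oplus> A']) \<cdot> linten ?q ?Bs A') \<cdot> (ev w As \<boxplus> ev w (As[j := A']))"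
    unfolding Cons.IH[OF w(1)] using assms w q n us ub Bs by (subst cmp_assoc') (simp_all add: up)
  also have "ltr x (?Bs[?q := ?Bs ! ?q \<oplus> A']) \<cdot> linten ?q ?Bs A' =
      linten (transpose (fst x) (Suc (fst x)) ?q) (swap_at (fst x) ?Bs) A' \<cdot> (ltr x ?Bs \<boxplus> ltr x (?Bs[?q := A']))"
    using w q Bs assms by (intro ltr_lin) auto
  also have "\<dots> \<cdot> (ev w As \<boxplus> ev w (As[j := A'])) =
      linten (transpose (fst x) (Suc (fst x)) ?q) (swap_at (fst x) ?Bs) A' \<cdot>
        ((ltr x ?Bs \<boxplus> ltr x (?Bs[?q := A'])) \<cdot> (ev w As \<boxplus> ev w (As[j := A'])))"
  proof (rule cmp_assoc')
    have q': "transpose (fst x) (Suc (fst x)) ?q < length As"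
      using w q by (auto simp: transpose_def)
    have e: "(swap_at (fst x) ?Bs)[transpose (fst x) (Suc (fst x)) ?q := A'] = swap_at (fst x) (?Bs[?q := A'])"
      using wact_update[of "[x]" ?Bs ?q A'] w by simp
    show "linten (transpose (fst x) (Suc (fst x)) ?q) (swap_at (fst x) ?Bs) A' \<in> arr C"
      "src C (linten (transpose (fst x) (Suc (fst x)) ?q) (swap_at (fst x) ?Bs) A') = tgt C (ltr x ?Bs \<boxplus> ltr x (?Bs[?q := A']))"
      using q' w Bs assms ub by (simp_all add: e)
  qed (use assms w us ub Bs in \<open>simp_all add: up\<close>)
  also have "(ltr x ?Bs \<boxplus> ltr x (?Bs[?q := A'])) \<cdot> (ev w As \<boxplus> ev w (As[j := A'])) = ev (x # w) As \<boxplus> ev (x # w) (As[j := A'])"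
    using assms w us ub Bs by (simp add: up sum.tm_cmp)
  finally show ?case by simp
qed

lemma ltr_append:
  assumes "Suc (fst x) < length Xs" "set Xs \<subseteq> ob C" "set Ys \<subseteq> ob C"
  shows "ltr x (Xs @ Ys) = ltr x Xs \<diamondop> \<iota> (oten Ys)"
    "ltr (length Ys + fst x, snd x) (Ys @ Xs) = \<iota> (oten Ys) \<diamondop> ltr x Xs"
proof -
  obtain L a b S e where s: "x = (length L, e)" "Xs = L @ a # b # S"
    by (rule split_letter[OF assms(1)])
  have o: "a \<in> ob C" "b \<in> ob C" "set L \<subseteq> ob C" "set S \<subseteq> ob C" "set Ys \<subseteq> ob C" using assms s by auto
  show "ltr x (Xs @ Ys) = ltr x Xs \<diamondop> \<iota> (oten Ys)"
    using o ltr_split[of L "length L" e a b "S @ Ys"] by (simp add: s ltr_split ten.wh_right)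
  show "ltr (length Ys + fst x, snd x) (Ys @ Xs) = \<iota> (oten Ys) \<diamondop> ltr x Xs"
    using o ltr_split[of "Ys @ L" "length Ys + length L" e a b S] by (simp add: s ltr_split ten.wh_left)
qed

lemma ev_left:
  assumes "w \<in> braid_words (length Xs)" "set Xs \<subseteq> ob C" "set Ys \<subseteq> ob C"
  shows "ev w (Xs @ Ys) = ev w Xs \<diamondop> \<iota> (oten Ys)"
  using assms(1)
proof (induction w)
  case (Cons x w)
  thus ?case using assms by (simp add: wact_append_left ltr_append ten.tm_cmp)
qed (use assms in simp)

lemma ev_shift:
  assumes "w \<in> braid_words (length Ys)" "set Xs \<subseteq> ob C" "set Ys \<subseteq> ob C"
  shows "ev (shift_word (length Xs) w) (Xs @ Ys) = \<iota> (oten Xs) \<diamondop> ev w Ys"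
  using assms(1)
proof (induction w)
  case (Cons x w)
  thus ?case using assms by (simp add: wact_shift ltr_append ten.tm_cmp)
qed (use assms in simp)

lemma ev_juxt:
  "\<lbrakk>list_all2 (\<lambda>Xs w. w \<in> braid_words (length Xs)) Xss ws; \<forall>Xs \<in> set Xss. set Xs \<subseteq> ob C\<rbrakk> \<Longrightarrow>
    ev (word_juxt (map length Xss) ws) (concat Xss) = mten (map2 ev ws Xss)"
proof (induction rule: list_all2_induct)
  case (Cons X Xss w ws)
  let ?J = "word_juxt (map length Xss) ws" and ?Y = "concat Xss"
  have o: "set X \<subseteq> ob C" "set ?Y \<subseteq> ob C" using Cons.prems by auto
  have J: "?J \<in> braid_words (length ?Y)"
    using Cons.hyps(2) word_juxt_in[of "map length Xss" ws] by (simp add: list_all2_map1 length_concat)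
  have w: "w \<in> braid_words (length (X @ ?Y))" "shift_word (length X) ?J \<in> braid_words (length (X @ ?Y))"
    using Cons.hyps(1) J by (auto intro: braid_words_mono shift_word_in)
  have "ev (w @ shift_word (length X) ?J) (X @ ?Y) = ev w (X @ wact ?J ?Y) \<cdot> ev (shift_word (length X) ?J) (X @ ?Y)"
    using w o J by (simp add: ev_append wact_shift)
  also have "\<dots> = (ev w X \<diamondop> \<iota> (oten (wact ?J ?Y))) \<cdot> (\<iota> (oten X) \<diamondop> ev ?J ?Y)"
    using w o J Cons.hyps(1) by (simp add: ev_left ev_shift)
  also have "\<dots> = ev w X \<diamondop> ev ?J ?Y"
    using w o J Cons.hyps(1) ten.tm_interchange(1)[of "ev w X" "ev ?J ?Y"] by simp
  finally show ?case using Cons.IH Cons.prems by simp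
qed simp

text \<open>
  A hexagon with two unit factors says that this isomorphism is idempotent.
\<close>

lemma bra_one: assumes "A \<in> ob C" shows "bra R A (oone R) = \<iota> A" "bra R (oone R) A = \<iota> A"
proof -
  have one: "oone R \<in> ob C" by simp
  have "bra R A (oone R) \<cdot> bra R A (oone R) = bra R A (oone R \<star> oone R)"
    unfolding bra_hexagon(1)[OF assms one one] using assms by simp
  also have "\<dots> = bra R A (oone R) \<cdot> \<iota> A" using assms by simp
  finally show "bra R A (oone R) = \<iota> A"
    by (rule iso_cancel[of "bra R A (oone R)" "ibra A (oone R)", rotated -1]) (simp_all add: assms)
  have "bra R (oone R) A \<cdot> bra R (oone R) A = bra R (oone R \<star> oone R) A"
    unfolding bra_hexagon(2)[OF one one assms] using assms by simp
  also have "\<dots> = bra R (oone R) A \<cdot> \<iota> A" using assms by simp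
  finally show "bra R (oone R) A = \<iota> A"
    by (rule iso_cancel[of "bra R (oone R) A" "ibra (oone R) A", rotated -1]) (simp_all add: assms)
qed

lemma ev_row:
  assumes "a \<in> ob C" "set L \<subseteq> ob C" "set Q \<subseteq> ob C" "set S \<subseteq> ob C"
  shows "ev (row_word (length L) (length Q)) (L @ a # Q @ S) = ten.wh (oten L) (bra R a (oten Q)) (oten S)"
  using assms(3,4)
proof (induction Q arbitrary: S rule: rev_induct)
  case (snoc b Q)
  have l: "ltr (length L + length Q, True) (L @ Q @ a # b # S) = ten.wh (oten L \<star> oten Q) (bra R a b) (oten S)"
    using ltr_split[of "L @ Q" "length L + length Q" True a b S] snoc.prems assms by (simp add: lbra_def)
  have "ev (row_word (length L) (length (Q @ [b]))) (L @ a # (Q @ [b]) @ S) =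
      ten.wh (oten L \<star> oten Q) (bra R a b) (oten S) \<cdot> ten.wh (oten L) (bra R a (oten Q)) (b \<star> oten S)"
    using snoc.IH[of "b # S"] snoc.prems wact_row_word[of L Q a "b # S"] by (simp add: l)
  also have "\<dots> = ten.wh (oten L) (bra R a (oten Q \<star> b)) (oten S)"
    using snoc.prems assms by (simp add: bra_hexagon(1) flip: ten.wh_cmp ten.wh_tm)
  finally show ?case using snoc.prems by simp
qed (use assms in \<open>simp add: bra_one\<close>)

text \<open>
  By the hexagons, applied strand by strand, the crossing of two blocks acts as the braiding of their
  products.
\<close>

lemma ev_cross:
  assumes "set L \<subseteq> ob C" "set P \<subseteq> ob C" "set Q \<subseteq> ob C" "set S \<subseteq> ob C"
  shows "ev (cross_word (length L) (length P) (length Q)) (L @ P @ Q @ S) =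
    ten.wh (oten L) (bra R (oten P) (oten Q)) (oten S)"
  using assms(1,2)
proof (induction P arbitrary: L)
  case (Cons a P)
  let ?r = "row_word (length L) (length Q)" and ?c = "cross_word (Suc (length L)) (length P) (length Q)"
    and ?X = "L @ a # P @ Q @ S"
  have w: "?r \<in> braid_words (length ?X)" "?c \<in> braid_words (length ?X)"
    by (intro row_word_in cross_word_in; simp)+
  have o: "set L \<subseteq> ob C" "a \<in> ob C" "set P \<subseteq> ob C" "set Q \<subseteq> ob C" "set S \<subseteq> ob C" "set ?X \<subseteq> ob C"
    using Cons.prems assms by auto
  have "ev (?r @ ?c) ?X = ev ?r (L @ a # Q @ P @ S) \<cdot> ev ?c ?X"
    using w o wact_cross_word[of "L @ [a]" P Q S] by (subst ev_append) auto
  also have "ev ?c ?X = ten.wh (oten L \<star> a) (bra R (oten P) (oten Q)) (oten S)"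
    using Cons.IH[of "L @ [a]"] o by simp
  also have "ev ?r (L @ a # Q @ P @ S) = ten.wh (oten L) (bra R a (oten Q)) (oten P \<star> oten S)"
    using ev_row[of a L Q "P @ S"] o by simp
  also have "\<dots> \<cdot> ten.wh (oten L \<star> a) (bra R (oten P) (oten Q)) (oten S) =
      ten.wh (oten L) (bra R (a \<star> oten P) (oten Q)) (oten S)"
    using o by (simp add: bra_hexagon(2) flip: ten.wh_cmp ten.wh_tm)
  finally show ?case by simp
qed (use assms in \<open>simp add: bra_one\<close>)

lemma ev_inv_word:
  assumes "w \<in> braid_words (length Xs)" "set Xs \<subseteq> ob C"
  shows "ev (inv_word w) (wact w Xs) \<cdot> ev w Xs = \<iota> (oten Xs)"
proof -
  have i: "inv_word w \<in> braid_words (length Xs)" using assms by simp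
  show ?thesis
    using ev_append[OF i assms] ev_cong[OF inv_word_left[OF assms(1)] HOL.refl assms(2)] by (metis ev.simps(1))
qed

lemma ev_inv_word_eqI:
  assumes "w \<in> braid_words (length Xs)" "set Xs \<subseteq> ob C" "g \<in> arr C" "src C g = oten (wact w Xs)"
    "tgt C g = oten Xs" "ev w Xs \<cdot> g = \<iota> (oten (wact w Xs))"
  shows "ev (inv_word w) (wact w Xs) = g"
  using assms ev_inv_word[OF assms(1,2)] wact_inv_word[OF assms(1)]
  by - (rule inverse_unique[of "ev w Xs"], simp_all)

lemma ev_block_letter:
  assumes "Suc (fst x) < length Xss" "\<forall>Xs \<in> set Xss. set Xs \<subseteq> ob C"
  shows "ev (block_letter (map length Xss) x) (concat Xss) = ltr x (map oten Xss)"
proof -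
  obtain L P Q S e where s: "x = (length L, e)" "Xss = L @ P # Q # S"
    by (rule split_letter[OF assms(1)])
  let ?L = "concat L" and ?S = "concat S"
  have o: "set ?L \<subseteq> ob C" "set P \<subseteq> ob C" "set Q \<subseteq> ob C" "set ?S \<subseteq> ob C" using assms s by auto
  have lS: "oten ?L = oten (map oten L)" "oten ?S = oten (map oten S)"
    using assms(2) s by (auto intro!: oten_concat)
  have sl: "sum_list (map length L) = length ?L" by (simp add: length_concat)
  have l: "ltr x (map oten Xss) = ten.wh (oten ?L) (lbra e (oten P) (oten Q)) (oten ?S)"
    using ltr_split[of "map oten L" "length L" e "oten P" "oten Q" "map oten S"] by (simp add: s lS)
  note bl = block_letter_split[of "map length L" "length P" "length Q" "map length S", unfolded length_map]
  show ?thesis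
  proof (cases e)
    case True
    thus ?thesis unfolding l using o bl(1) ev_cross[of ?L P Q ?S] by (simp add: s sl lbra_def)
  next
    case False
    let ?w = "cross_word (length ?L) (length Q) (length P)" and ?Y = "?L @ Q @ P @ ?S"
    have w: "?w \<in> braid_words (length ?Y)" by (intro cross_word_in) simp
    have wa: "wact ?w ?Y = ?L @ P @ Q @ ?S" by (rule wact_cross_word)
    have oY: "set ?Y \<subseteq> ob C" using o by simp
    have e: "ev ?w ?Y = ten.wh (oten ?L) (bra R (oten Q) (oten P)) (oten ?S)"
      using o by (intro ev_cross)
    have "ev (inv_word ?w) (wact ?w ?Y) = ten.wh (oten ?L) (ibra (oten Q) (oten P)) (oten ?S)"
    proof (rule ev_inv_word_eqI[OF w oY], unfold wa e)
    qed (use o in \<open>simp_all add: ten.wh_cmp\<close>)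
    hence "ev (inv_word ?w) (?L @ P @ Q @ ?S) = ten.wh (oten ?L) (ibra (oten Q) (oten P)) (oten ?S)"
      unfolding wa .
    thus ?thesis unfolding l using bl(2) False by (simp add: s sl lbra_def)
  qed
qed

lemma ev_block_word:
  assumes "w \<in> braid_words (length Xss)" "\<forall>Xs \<in> set Xss. set Xs \<subseteq> ob C"
  shows "ev (block_word (map length Xss) w) (concat Xss) = ev w (map oten Xss)"
  using assms(1)
proof (induction w)
  case Nil
  thus ?case using assms by (simp add: oten_concat)
next
  case (Cons x w)
  let ?ks = "map length Xss"
  have w: "w \<in> braid_words (length ?ks)" "Suc (fst x) < length ?ks" using Cons.prems by auto
  have m: "wact w ?ks = map length (wact w Xss)" "wact w (map oten Xss) = map oten (wact w Xss)"
    using w by (simp_all add: map_wact)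
  have sub: "\<forall>Xs \<in> set (wact w Xss). set Xs \<subseteq> ob C" using assms w by simp
  have bw: "block_word ?ks w \<in> braid_words (length (concat Xss))"
    using w by (simp add: block_word_in length_concat)
  have bl: "block_letter (wact w ?ks) x \<in> braid_words (length (concat Xss))"
    using w by (simp add: block_letter_in sum_list_wact length_concat)
  have "ev (block_word ?ks (x # w)) (concat Xss) = ev (block_letter (wact w ?ks) x) (wact (block_word ?ks w) (concat Xss)) \<cdot> ev (block_word ?ks w) (concat Xss)"
    using bw bl assms w by (simp add: block_word_Cons[of ?ks "length ?ks"] ev_append UN_subset_iff)
  also have "ev (block_letter (wact w ?ks) x) (wact (block_word ?ks w) (concat Xss)) = ltr x (wact w (map oten Xss))"
    using w sub by (simp add: wact_block_word m ev_block_letter)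
  finally show ?case using Cons w by simp
qed

end

section \<open>The multifunctor determined by a braided ring category\<close>

lemma Br_simps [simp]:
  "mob Br = UNIV" "mhom Br xs y = br_category (length xs)" "munit Br x = id"
  "mcomp1 Br xss ys z = br_comp (map length xss)" "mcomp2 Br xss ys z = br_comp2 (map length xss)"
  "mact1 Br xs y \<rho> \<sigma> = \<sigma> \<circ> \<rho>" "mact2 Br xs y \<rho> (\<sigma>, b, \<tau>) = (\<sigma> \<circ> \<rho>, b, \<tau> \<circ> \<rho>)"
  by (simp_all add: Br_def)

lemma PermCat_simps [simp]:
  "mob PermCat = {C. permutative_category C}" "mhom PermCat = ml_category" "munit PermCat = ml_unit"
  "mcomp1 PermCat = ml_comp" "mcomp2 PermCat = ml_comp2"
  "mact1 PermCat Cs D = ml_act Cs" "mact2 PermCat Cs D = ml_act2 Cs"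
  by (simp_all add: PermCat_def)

lemma br_mor_act: "mact2 Br xs y \<rho> (br_mor k \<sigma> w) = br_mor k (\<sigma> \<circ> \<rho>) w"
  by (simp add: br_mor_def comp_assoc)

context ring_category
begin

lemma obmap_chunks:
  assumes "map length Ass = ks" "length \<tau>s = length ks" "set (concat Ass) \<subseteq> ob C"
  shows "map2 obmap (map2 Ten ks \<tau>s) Ass = map oten (map2 place \<tau>s Ass)"
proof (rule nth_equalityI)
  fix i assume "i < length (map2 obmap (map2 Ten ks \<tau>s) Ass)"
  hence i: "i < length Ass" by simp
  have "length (Ass ! i) = ks ! i" using assms(1) i by auto
  moreover have "set (Ass ! i) \<subseteq> ob C" using assms(3) nth_mem[OF i] unfolding set_concat by blast
  ultimately show "map2 obmap (map2 Ten ks \<tau>s) Ass ! i = map oten (map2 place \<tau>s Ass) ! i"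
    using i assms by (auto simp: Ten_simps)
qed (use assms in auto)

end

context braided_ring_category
begin

definition evT :: "nat \<Rightarrow> (nat \<Rightarrow> nat) \<Rightarrow> braid_word \<Rightarrow> ('o, 'm) mltrans" where
  "evT k \<sigma> w = (Ten k \<sigma>, \<lambda>As \<in> ob (cat_list_prod (replicate k C)). ev w (place \<sigma> As), Ten k (word_perm w \<circ> \<sigma>))"

lemma evT_arr:
  assumes \<sigma>: "\<sigma> permutes {..<k}" and w: "w \<in> braid_words k"
  shows "evT k \<sigma> w \<in> arr (ml_category (replicate k C) C)"
proof -
  let ?\<alpha> = "\<lambda>As \<in> ob (cat_list_prod (replicate k C)). ev w (place \<sigma> As)"
  have \<tau>: "word_perm w \<circ> \<sigma> permutes {..<k}" using assms by (intro permutes_compose word_perm_permutes)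
  have "multilinear_transformation (replicate k C) C (Ten k \<sigma>) (Ten k (word_perm w \<circ> \<sigma>)) ?\<alpha>"
  proof
    show "nat_trans (cat_list_prod (replicate k C)) C (obmap (Ten k \<sigma>)) (armap (Ten k \<sigma>))
       (obmap (Ten k (word_perm w \<circ> \<sigma>))) (armap (Ten k (word_perm w \<circ> \<sigma>))) ?\<alpha>"
      unfolding nat_trans_def
    proof (intro conjI ballI)
      fix As assume "As \<in> ob (cat_list_prod (replicate k C))"
      hence As: "length As = k" "set As \<subseteq> ob C" by auto
      have "set (place \<sigma> As) \<subseteq> ob C" using As \<sigma> by simp
      thus "?\<alpha> As \<in> hom C (obmap (Ten k \<sigma>) As) (obmap (Ten k (word_perm w \<circ> \<sigma>)) As)"
        using As place_word_perm[OF \<sigma> w As(1)] w by (simp add: Ten_simps hom_def)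
    next
      fix fs assume "fs \<in> arr (cat_list_prod (replicate k C))"
      hence fs: "length fs = k" "set fs \<subseteq> arr C" by auto
      have "set (place \<sigma> fs) \<subseteq> arr C" using fs \<sigma> by simp
      thus "?\<alpha> (tgt (cat_list_prod (replicate k C)) fs) \<cdot> armap (Ten k \<sigma>) fs =
          armap (Ten k (word_perm w \<circ> \<sigma>)) fs \<cdot> ?\<alpha> (src (cat_list_prod (replicate k C)) fs)"
        using fs place_word_perm[OF \<sigma> w fs(1)] w \<sigma> ev_natural[of w "place \<sigma> fs"]
        by (simp add: Ten_simps place_map)
    qed
  next
    fix i As A' assume "(i, As, A') \<in> lin_dom (replicate k C)"
    hence i: "i < k" and As: "length As = k" "set As \<subseteq> ob C" "A' \<in> ob C" by auto
    have p: "set (place \<sigma> As) \<subseteq> ob C" using As \<sigma> by simp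
    have si: "\<sigma> i < k" using i permutes_bounds(2)[OF \<sigma>] by simp
    have n: "place \<sigma> As ! \<sigma> i = As ! i" "As ! i \<in> ob C" using As \<sigma> i by (auto simp: place_nth)
    have up: "place \<sigma> (As[i := a]) = (place \<sigma> As)[\<sigma> i := a]" for a using As \<sigma> by (simp add: place_update)
    have us: "set (As[i := a]) \<subseteq> ob C" if "a \<in> ob C" for a using As(2) that by (rule set_update_subset)
    have "ev w ((place \<sigma> As)[\<sigma> i := As ! i \<oplus> A']) \<cdot> linten (\<sigma> i) (place \<sigma> As) A' =
       linten (word_perm w (\<sigma> i)) (wact w (place \<sigma> As)) A' \<cdot> (ev w (place \<sigma> As) \<boxplus> ev w ((place \<sigma> As)[\<sigma> i := A']))"
      using ev_lin[of w "place \<sigma> As" "\<sigma> i" A'] w p si As n by simp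
    thus "?\<alpha> (As[i := As ! i \<oplus>\<^bsub>replicate k C ! i\<^esub> A']) \<cdot> lin (Ten k \<sigma>) i As A' =
        lin (Ten k (word_perm w \<circ> \<sigma>)) i As A' \<cdot> (?\<alpha> As \<boxplus> ?\<alpha> (As[i := A']))"
      using i As us n place_word_perm[OF \<sigma> w As(1)] by (simp add: Ten_simps up)
  next
    fix As j assume "As \<in> ob (cat_list_prod (replicate k C))" "j < length (replicate k C)" "As ! j = \<zero>\<^bsub>replicate k C ! j\<^esub>"
    hence "length As = k" "set As \<subseteq> ob C" "\<zero> \<in> set As" by (auto simp: in_set_conv_nth)
    thus "?\<alpha> As = \<iota> \<zero>" using ev_zero[of w "place \<sigma> As"] w \<sigma> by simp
  qed simp
  thus ?thesis using \<sigma> \<tau> by (simp add: ml_category_def evT_def multilinear_Ten)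
qed

text \<open>
  By \<open>evT_cong\<close> the choice of a word for a braid does not matter.
\<close>

definition ring_multifunctor ::
  "(unit, nat \<Rightarrow> nat, br_arr, ('o, 'm) permcat, ('o, 'm) mlfun, ('o, 'm) mltrans) mfun" where
  "ring_multifunctor =
    \<lparr>fob = (\<lambda>_. C),
     fop1 = (\<lambda>xs y \<sigma>. if \<sigma> permutes {..<length xs} then Ten (length xs) \<sigma> else undefined),
     fop2 = (\<lambda>xs y a. if a \<in> arr (br_category (length xs))
                       then evT (length xs) (fst a) (SOME w. w \<in> fst (snd a)) else undefined)\<rparr>"

lemma ring_multifunctor_simps [simp]:
  "fob ring_multifunctor x = C"
  "\<sigma> permutes {..<length xs} \<Longrightarrow> fop1 ring_multifunctor xs y \<sigma> = Ten (length xs) \<sigma>"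
  by (simp_all add: ring_multifunctor_def)

lemma evT_cong:
  assumes "braid_eq k u v" "\<sigma> permutes {..<k}"
  shows "evT k \<sigma> u = evT k \<sigma> v"
  using assms word_perm_cong[OF assms(1)] ev_cong[OF assms(1)] by (auto simp: evT_def intro!: restrict_ext)

lemma ring_multifunctor_br_mor:
  assumes "length xs = k" "\<sigma> permutes {..<k}" "w \<in> braid_words k"
  shows "fop2 ring_multifunctor xs y (br_mor k \<sigma> w) = evT k \<sigma> w"
proof -
  have "braid_eq k w (SOME v. v \<in> braid_class k w)"
    using someI[of "\<lambda>v. v \<in> braid_class k w" w] assms by (simp add: braid_eq.refl)
  hence "evT k \<sigma> (SOME v. v \<in> braid_class k w) = evT k \<sigma> w"
    using assms(2) by (metis evT_cong)
  thus ?thesis using br_mor_arr[OF assms(2,3)] assms(1) by (simp add: ring_multifunctor_def) (simp add: br_mor_def)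
qed

lemma evT_cmp:
  assumes "\<sigma> permutes {..<k}" "u \<in> braid_words k" "v \<in> braid_words k"
  shows "cmp (ml_category (replicate k C) C) (evT k (word_perm v \<circ> \<sigma>) u) (evT k \<sigma> v) = evT k \<sigma> (u @ v)"
proof -
  have "word_perm (u @ v) = word_perm u \<circ> word_perm v" by (induction u) (auto simp: comp_assoc)
  thus ?thesis using assms
    by (auto simp: ml_category_def evT_def comp_assoc place_word_perm ev_append intro!: restrict_ext)
qed

text \<open>
  The word of the composite first permutes inside the blocks and then moves the blocks. The first part
  acts as the product of the inner actions, the second part as the outer word on the products of the blocks; these
  are the two factors in the composition of multilinear transformations.
\<close>

lemma evT_comp2:
  assumes \<sigma>: "\<sigma> permutes {..<length ks}" and w: "w \<in> braid_words (length ks)"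
    and l: "length \<tau>s = length ks" "length ws = length ks"
    and \<tau>s: "\<And>i. i < length ks \<Longrightarrow> \<tau>s ! i permutes {..<ks ! i} \<and> ws ! i \<in> braid_words (ks ! i)"
  defines "v \<equiv> block_word (place \<sigma> ks) w @ word_juxt (place \<sigma> ks) (place \<sigma> ws)"
  shows "ml_comp2 (map (\<lambda>k. replicate k C) ks) (replicate (length ks) C) C (evT (length ks) \<sigma> w)
      (map (\<lambda>i. evT (ks ! i) (\<tau>s ! i) (ws ! i)) [0..<length ks]) =
    evT (sum_list ks) (br_comp ks \<sigma> \<tau>s) v"
proof -
  let ?n = "length ks" and ?N = "sum_list ks" and ?\<pi> = "br_comp ks \<sigma> \<tau>s"
  let ?\<tau>s' = "map2 (\<lambda>w \<tau>. word_perm w \<circ> \<tau>) ws \<tau>s"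
  let ?bs = "map (\<lambda>i. evT (ks ! i) (\<tau>s ! i) (ws ! i)) [0..<?n]"
  let ?\<beta>s = "map (fst \<circ> snd) ?bs"
  have ln: "map length (map (\<lambda>k. replicate k C) ks) = ks" by (simp add: o_def)
  have Gs: "map fst ?bs = map2 Ten ks \<tau>s" "map (snd \<circ> snd) ?bs = map2 Ten ks ?\<tau>s'"
    using l by (auto intro!: nth_equalityI simp: evT_def)
  have \<tau>s': "?\<tau>s' ! i permutes {..<ks ! i}" if "i < ?n" for i
    using \<tau>s[OF that] l that by (auto intro!: permutes_compose word_perm_permutes)
  have \<sigma>': "word_perm w \<circ> \<sigma> permutes {..<?n}" using \<sigma> w by (intro permutes_compose word_perm_permutes)
  have \<pi>': "word_perm v \<circ> ?\<pi> = br_comp ks (word_perm w \<circ> \<sigma>) ?\<tau>s'"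
    unfolding v_def
    by (rule br_comp2_br_mor(3)[where \<tau>s = \<tau>s and ws = ws and as = "map (\<lambda>i. br_mor (ks ! i) (\<tau>s ! i) (ws ! i)) [0..<?n]"];
        use \<sigma> w l \<tau>s in simp)
  have src: "ml_comp (map (\<lambda>k. replicate k C) ks) (replicate ?n C) C (Ten ?n \<sigma>) (map2 Ten ks \<tau>s) = Ten ?N ?\<pi>"
    using \<sigma> l \<tau>s by (intro ml_comp_Ten) auto
  have tgt: "ml_comp (map (\<lambda>k. replicate k C) ks) (replicate ?n C) C (Ten ?n (word_perm w \<circ> \<sigma>)) (map2 Ten ks ?\<tau>s')
      = Ten ?N (word_perm v \<circ> ?\<pi>)"
    unfolding \<pi>' using \<sigma>' l \<tau>s' by (intro ml_comp_Ten) auto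
  have main: "ev w (place \<sigma> (map oten (map2 place ?\<tau>s' Ass))) \<cdot> mten (place \<sigma> (map2 ev ws (map2 place \<tau>s Ass)))
      = ev v (place ?\<pi> (concat Ass))"
    if A: "map length Ass = ks" "set (concat Ass) \<subseteq> ob C" for Ass
  proof -
    have lA: "length Ass = ?n" using A(1) by auto
    have kn: "length (Ass ! i) = ks ! i" if "i < ?n" for i using A(1) that by auto
    have An: "set (Ass ! i) \<subseteq> ob C" if "i < ?n" for i using A(2) that nth_mem[of i Ass] unfolding set_concat lA by blast
    let ?Yss = "place \<sigma> (map2 place \<tau>s Ass)" and ?Zss = "place \<sigma> (map2 place ?\<tau>s' Ass)"
    let ?J = "word_juxt (place \<sigma> ks) (place \<sigma> ws)" and ?B = "block_word (place \<sigma> ks) w"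
    have my: "map length ?Yss = place \<sigma> ks" "map length ?Zss = place \<sigma> ks"
      using map_length_yss[of \<sigma> Ass \<tau>s] map_length_yss[of \<sigma> Ass ?\<tau>s'] A lA kn \<sigma> l \<tau>s \<tau>s' by simp_all
    have p: "place ?\<pi> (concat Ass) = concat ?Yss"
      using place_br_comp[of \<sigma> Ass \<tau>s] A lA kn \<sigma> l \<tau>s by simp
    note cw = composite_word_in[of \<sigma> Ass \<tau>s ws w] wact_composite_juxt[of \<sigma> Ass \<tau>s ws w]
    have J: "wact ?J (concat ?Yss) = concat ?Zss" "?J \<in> braid_words (length (concat Ass))" "?B \<in> braid_words (length (concat Ass))"
      using cw A lA kn \<sigma> l \<tau>s w by simp_all
    have lY: "length (concat ?Yss) = length (concat Ass)"
      using length_concat_yss[of \<sigma> Ass \<tau>s] lA kn \<sigma> l \<tau>s by simp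
    have sZ: "\<forall>Xs \<in> set ?Zss. set Xs \<subseteq> ob C" and sY: "\<forall>Xs \<in> set ?Yss. set Xs \<subseteq> ob C"
    proof -
      have "set (map2 place \<upsilon>s Ass ! i) \<subseteq> ob C" if "length \<upsilon>s = ?n" "\<And>i. i < ?n \<Longrightarrow> \<upsilon>s ! i permutes {..<ks ! i}" "i < ?n" for \<upsilon>s i
        using set_place[of "\<upsilon>s ! i" "Ass ! i"] that(1,3) that(2)[OF that(3)] kn[OF that(3)] An[OF that(3)] lA by simp
      hence *: "\<forall>Xs \<in> set (map2 place \<upsilon>s Ass). set Xs \<subseteq> ob C" if "length \<upsilon>s = ?n" "\<And>i. i < ?n \<Longrightarrow> \<upsilon>s ! i permutes {..<ks ! i}" for \<upsilon>s
        using that lA by (metis (no_types, lifting) in_set_conv_nth length_map length_zip min.idem)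
      show "\<forall>Xs \<in> set ?Zss. set Xs \<subseteq> ob C" "\<forall>Xs \<in> set ?Yss. set Xs \<subseteq> ob C"
        using *[of ?\<tau>s'] *[of \<tau>s] l \<tau>s \<tau>s' \<sigma> lA by (simp_all del: set_map set_zip)
    qed
    have all: "list_all2 (\<lambda>xs w. w \<in> braid_words (length xs)) ?Yss (place \<sigma> ws)"
      unfolding list_all2_conv_all_nth
    proof (intro conjI allI impI)
      fix q assume "q < length ?Yss"
      hence "q = \<sigma> (inv \<sigma> q)" "inv \<sigma> q < ?n"
        using permutes_bounds(3,5)[OF \<sigma>, of q] l lA by simp_all
      then obtain i where i: "q = \<sigma> i" "i < ?n" by blast
      show "place \<sigma> ws ! q \<in> braid_words (length (?Yss ! q))"
        using \<sigma> l lA \<tau>s kn i(2) unfolding i(1) by (simp add: place_nth)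
    qed (use l lA in simp)
    have "ev v (place ?\<pi> (concat Ass)) = ev ?B (concat ?Zss) \<cdot> ev ?J (concat ?Yss)"
      using J lY sY unfolding v_def p by (subst ev_append) (auto simp: UN_subset_iff)
    also have "ev ?B (concat ?Zss) = ev w (map oten ?Zss)"
      using ev_block_word[of w ?Zss] w lA l sZ my by simp
    also have "map oten ?Zss = place \<sigma> (map oten (map2 place ?\<tau>s' Ass))"
      using \<sigma> l lA by (intro place_map[symmetric]) simp
    also have "ev ?J (concat ?Yss) = mten (map2 ev (place \<sigma> ws) ?Yss)"
      using ev_juxt[OF all sY] my by simp
    also have "map2 ev (place \<sigma> ws) ?Yss = place \<sigma> (map2 ev ws (map2 place \<tau>s Ass))"
      using \<sigma> l lA by (intro place_map2[symmetric]) simp_all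
    finally show ?thesis ..
  qed
  have arrs: "map2 (\<lambda>\<beta> As'. \<beta> As') ?\<beta>s Ass = map2 ev ws (map2 place \<tau>s Ass)" 
    "set (map2 ev ws (map2 place \<tau>s Ass)) \<subseteq> arr C" "set (map oten (map2 place ?\<tau>s' Ass)) \<subseteq> ob C"
    if A: "map length Ass = ks" "set (concat Ass) \<subseteq> ob C" for Ass
  proof -
    have lA: "length Ass = ?n" using A(1) by auto
    have kn: "length (Ass ! i) = ks ! i" if "i < ?n" for i using A(1) that by auto
    have An: "set (Ass ! i) \<subseteq> ob C" if "i < ?n" for i using A(2) that nth_mem[of i Ass] unfolding set_concat lA by blast
    show "map2 (\<lambda>\<beta> As'. \<beta> As') ?\<beta>s Ass = map2 ev ws (map2 place \<tau>s Ass)"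
      using l lA kn An by (intro nth_equalityI) (auto simp: evT_def)
    have P: "set (place (\<upsilon>s ! i) (Ass ! i)) \<subseteq> ob C" if "\<upsilon>s ! i permutes {..<ks ! i}" "i < ?n" for \<upsilon>s i
      using set_place[of "\<upsilon>s ! i" "Ass ! i"] that kn An by simp
    show "set (map2 ev ws (map2 place \<tau>s Ass)) \<subseteq> arr C"
    proof
      fix f assume "f \<in> set (map2 ev ws (map2 place \<tau>s Ass))"
      then obtain i where i: "i < ?n" "f = ev (ws ! i) (place (\<tau>s ! i) (Ass ! i))" 
        using l lA by (auto simp: in_set_conv_nth)
      show "f \<in> arr C" unfolding i(2) using P[of \<tau>s i] i(1) \<tau>s kn by (intro ev_simps) auto
    qed
    show "set (map oten (map2 place ?\<tau>s' Ass)) \<subseteq> ob C"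
    proof
      fix X assume "X \<in> set (map oten (map2 place ?\<tau>s' Ass))"
      then obtain i where i: "i < ?n" "X = oten (place (?\<tau>s' ! i) (Ass ! i))" 
        using l lA by (auto simp: in_set_conv_nth)
      show "X \<in> ob C" unfolding i(2) using P[of ?\<tau>s' i] i(1) \<tau>s' by (intro oten_ob) auto
    qed
  qed
  let ?L = "\<lambda>As. (\<lambda>As \<in> ob (cat_list_prod (replicate ?n C)). ev w (place \<sigma> As)) (map2 obmap (map2 Ten ks ?\<tau>s') (chunks ks As)) \<cdot>
          armap (Ten ?n \<sigma>) (map2 (\<lambda>\<beta> As'. \<beta> As') ?\<beta>s (chunks ks As))"
  have mid: "(\<lambda>As \<in> ob (cat_list_prod (replicate ?N C)). ?L As) = (\<lambda>As \<in> ob (cat_list_prod (replicate ?N C)). ev v (place ?\<pi> As))"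
  proof (rule restrict_ext)
    fix As assume "As \<in> ob (cat_list_prod (replicate ?N C))"
    hence As: "length As = ?N" "set As \<subseteq> ob C" by auto
    let ?Ass = "chunks ks As"
    have A: "map length ?Ass = ks" "set (concat ?Ass) \<subseteq> ob C" "concat ?Ass = As"
      using As by (simp_all add: map_length_chunks concat_chunks)
    note ar = arrs[OF A(1,2)]
    have o: "map2 obmap (map2 Ten ks ?\<tau>s') ?Ass = map oten (map2 place ?\<tau>s' ?Ass)"
      using A l by (intro obmap_chunks) auto
    have "(\<lambda>As \<in> ob (cat_list_prod (replicate ?n C)). ev w (place \<sigma> As)) (map oten (map2 place ?\<tau>s' ?Ass)) =
        ev w (place \<sigma> (map oten (map2 place ?\<tau>s' ?Ass)))"
      using ar(3) l by (intro restrict_apply') (simp del: set_map)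
    moreover have "armap (Ten ?n \<sigma>) (map2 ev ws (map2 place \<tau>s ?Ass)) = mten (place \<sigma> (map2 ev ws (map2 place \<tau>s ?Ass)))"
      using ar(2) l by (intro Ten_simps(2)) simp_all
    ultimately show "?L As = ev v (place ?\<pi> As)"
      unfolding o ar(1) using main[OF A(1,2)] unfolding A(3) by (simp only:)
  qed
  show ?thesis
    unfolding ml_comp2_def Let_def evT_def[of ?n] case_prod_conv Gs src tgt ln concat_replicates mid
    unfolding evT_def ..
qed

lemma evT_act:
  assumes "\<sigma> permutes {..<k}" "\<rho> permutes {..<k}" "w \<in> braid_words k"
  shows "ml_act2 (replicate k C) \<rho> (evT k \<sigma> w) = evT k (\<sigma> \<circ> \<rho>) w"
proof -
  have "word_perm w \<circ> \<sigma> permutes {..<k}" using assms by (intro permutes_compose word_perm_permutes)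
  thus ?thesis using assms
    by (auto simp: ml_act2_def evT_def ml_act_Ten comp_assoc place_comp intro!: restrict_ext)
qed

lemma map_fob_ring_multifunctor:
  "map (fob ring_multifunctor) xs = replicate (length xs) C"
  "map (map (fob ring_multifunctor)) xss = map (\<lambda>k. replicate k C) (map length xss)"
  by (auto simp: map_replicate_const intro!: nth_equalityI)

lemma multifunctor_ring_multifunctor: "multifunctor Br PermCat ring_multifunctor" (is "multifunctor _ _ ?F")
proof
  show "fob ?F \<in> extensional (mob Br)" by simp
  show "(\<lambda>(xs, y, p). fop1 ?F xs y p) \<in> extensional {(xs, y, p). xs \<in> lists (mob Br) \<and> y \<in> mob Br \<and> p \<in> ob (mhom Br xs y)}"
    by (auto simp: extensional_def ring_multifunctor_def)
  show "(\<lambda>(xs, y, a). fop2 ?F xs y a) \<in> extensional {(xs, y, a). xs \<in> lists (mob Br) \<and> y \<in> mob Br \<and> a \<in> arr (mhom Br xs y)}"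
    by (auto simp: extensional_def ring_multifunctor_def)
  show "fob ?F x \<in> mob PermCat" for x by simp unfold_locales
  show "fop1 ?F [x] x (munit Br x) = munit PermCat (fob ?F x)" for x
    by (simp add: permutes_id ml_unit_Ten)
next
  fix xs :: "unit list" and y :: unit
  let ?k = "length xs"
  show "is_functor (mhom Br xs y) (mhom PermCat (map (fob ?F) xs) (fob ?F y)) (fop1 ?F xs y) (fop2 ?F xs y)"
    unfolding is_functor_def map_fob_ring_multifunctor Br_simps PermCat_simps ring_multifunctor_simps
  proof (intro conjI ballI impI)
    fix \<sigma> assume "\<sigma> \<in> ob (br_category ?k)"
    hence \<sigma>: "\<sigma> permutes {..<?k}" by simp
    thus "fop1 ?F xs y \<sigma> \<in> ob (ml_category (replicate ?k C) C)"
      by (simp add: ml_category_def multilinear_Ten)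
    show "fop2 ?F xs y (idm (br_category ?k) \<sigma>) = idm (ml_category (replicate ?k C) C) (fop1 ?F xs y \<sigma>)"
      using \<sigma> by (auto simp: ring_multifunctor_br_mor evT_def ml_category_def Ten_simps intro!: restrict_ext)
  next
    fix a assume "a \<in> arr (br_category ?k)"
    then obtain \<sigma> w where a: "\<sigma> permutes {..<?k}" "w \<in> braid_words ?k" "a = br_mor ?k \<sigma> w"
      by (rule br_arr_cases)
    hence "word_perm w \<circ> \<sigma> permutes {..<?k}" by (intro permutes_compose word_perm_permutes)
    thus "fop2 ?F xs y a \<in> hom (ml_category (replicate ?k C) C) (fop1 ?F xs y (src (br_category ?k) a))
        (fop1 ?F xs y (tgt (br_category ?k) a))"
      using a evT_arr[OF a(1,2)] by (simp add: ring_multifunctor_br_mor hom_def)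
        (simp add: br_mor_def evT_def ml_category_def)
  next
    fix a b assume aa: "a \<in> arr (br_category ?k)" and bb: "b \<in> arr (br_category ?k)"
      and eq: "src (br_category ?k) b = tgt (br_category ?k) a"
    obtain \<sigma> w where a: "\<sigma> permutes {..<?k}" "w \<in> braid_words ?k" "a = br_mor ?k \<sigma> w"
      by (rule br_arr_cases[OF aa])
    obtain \<tau> v where b: "\<tau> permutes {..<?k}" "v \<in> braid_words ?k" "b = br_mor ?k \<tau> v"
      by (rule br_arr_cases[OF bb])
    have \<tau>: "\<tau> = word_perm w \<circ> \<sigma>" using eq a(3) b(3) by (simp add: br_mor_def)
    show "fop2 ?F xs y (cmp (br_category ?k) b a) = cmp (ml_category (replicate ?k C) C) (fop2 ?F xs y b) (fop2 ?F xs y a)"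
      using a b \<tau> by (simp add: br_mor_cmp ring_multifunctor_br_mor evT_cmp)
  qed
next
  fix xss :: "unit list list" and ys z p and qs :: "(nat \<Rightarrow> nat) list"
  assume l: "length xss = length ys" "length qs = length ys" and p: "p \<in> ob (mhom Br ys z)"
    and qs: "\<forall>i<length ys. qs ! i \<in> ob (mhom Br (xss ! i) (ys ! i))"
  have "map (\<lambda>i. fop1 ?F (xss ! i) (ys ! i) (qs ! i)) [0..<length ys] = map2 Ten (map length xss) qs"
    using l qs by (intro nth_equalityI) auto
  moreover have "br_comp (map length xss) p qs permutes {..<length (concat xss)}"
    using br_comp_permutes[of p "map length xss" qs] p l qs by (simp add: length_concat)
  ultimately show "fop1 ?F (concat xss) z (mcomp1 Br xss ys z p qs) =
     mcomp1 PermCat (map (map (fob ?F)) xss) (map (fob ?F) ys) (fob ?F z) (fop1 ?F ys z p)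
       (map (\<lambda>i. fop1 ?F (xss ! i) (ys ! i) (qs ! i)) [0..<length ys])"
    using ml_comp_Ten[of p "map length xss" qs] p l qs
    by (simp add: map_fob_ring_multifunctor length_concat o_def)
next
  fix xss :: "unit list list" and ys z a and bs :: "br_arr list"
  assume l: "length xss = length ys" "length bs = length ys" and a: "a \<in> arr (mhom Br ys z)"
    and bs: "\<forall>i<length ys. bs ! i \<in> arr (mhom Br (xss ! i) (ys ! i))"
  define ks where "ks = map length xss"
  have n: "length ks = length ys" "sum_list ks = length (concat xss)" using l by (simp_all add: ks_def length_concat)
  obtain \<sigma> w where aw: "\<sigma> permutes {..<length ys}" "w \<in> braid_words (length ys)" "a = br_mor (length ys) \<sigma> w"
    using a unfolding Br_simps by (rule br_arr_cases)
  have "\<forall>i. \<exists>\<tau> w. i < length ys \<longrightarrow> \<tau> permutes {..<ks ! i} \<and> w \<in> braid_words (ks ! i) \<and> bs ! i = br_mor (ks ! i) \<tau> w"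
  proof (intro allI)
    fix i show "\<exists>\<tau> w. i < length ys \<longrightarrow> \<tau> permutes {..<ks ! i} \<and> w \<in> braid_words (ks ! i) \<and> bs ! i = br_mor (ks ! i) \<tau> w"
    proof (cases "i < length ys")
      case True
      hence "bs ! i \<in> arr (br_category (ks ! i))" using bs l by (simp add: ks_def)
      thus ?thesis by (rule br_arr_cases) blast
    qed simp
  qed
  then obtain t v where tv: "\<And>i. i < length ys \<Longrightarrow> t i permutes {..<ks ! i} \<and> v i \<in> braid_words (ks ! i) \<and> bs ! i = br_mor (ks ! i) (t i) (v i)"
    by metis
  define \<tau>s where "\<tau>s = map t [0..<length ys]"
  define ws where "ws = map v [0..<length ys]"
  let ?v = "block_word (place \<sigma> ks) w @ word_juxt (place \<sigma> ks) (place \<sigma> ws)"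
  have comp: "br_comp2 ks (br_mor (length ks) \<sigma> w) bs = br_mor (sum_list ks) (br_comp ks \<sigma> \<tau>s) ?v" "?v \<in> braid_words (sum_list ks)"
    by (rule br_comp2_br_mor[where \<tau>s = \<tau>s and ws = ws and as = bs];
        use aw tv l n in \<open>simp add: \<tau>s_def ws_def\<close>)+
  have perm: "br_comp ks \<sigma> \<tau>s permutes {..<sum_list ks}"
    using aw tv n by (intro br_comp_permutes) (auto simp: \<tau>s_def)
  have bs': "map (\<lambda>i. fop2 ?F (xss ! i) (ys ! i) (bs ! i)) [0..<length ys] = map (\<lambda>i. evT (ks ! i) (\<tau>s ! i) (ws ! i)) [0..<length ks]"
    using tv l n by (intro nth_equalityI) (auto simp: ring_multifunctor_br_mor \<tau>s_def ws_def ks_def)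
  have "fop2 ?F (concat xss) z (br_comp2 ks a bs) = evT (sum_list ks) (br_comp ks \<sigma> \<tau>s) ?v"
    using comp perm n aw(3) by (simp add: ring_multifunctor_br_mor)
  also have "\<dots> = ml_comp2 (map (\<lambda>k. replicate k C) ks) (replicate (length ks) C) C (evT (length ks) \<sigma> w)
      (map (\<lambda>i. evT (ks ! i) (\<tau>s ! i) (ws ! i)) [0..<length ks])"
    using aw tv n by (intro evT_comp2[symmetric]) (auto simp: \<tau>s_def ws_def)
  finally show "fop2 ?F (concat xss) z (mcomp2 Br xss ys z a bs) =
     mcomp2 PermCat (map (map (fob ?F)) xss) (map (fob ?F) ys) (fob ?F z) (fop2 ?F ys z a)
       (map (\<lambda>i. fop2 ?F (xss ! i) (ys ! i) (bs ! i)) [0..<length ys])"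
    unfolding map_fob_ring_multifunctor Br_simps PermCat_simps ring_multifunctor_simps bs' ks_def[symmetric]
    using aw n by (simp add: ring_multifunctor_br_mor)
next
  fix xs :: "unit list" and y :: unit and \<rho> p
  assume "\<rho> permutes {..<length xs}" "p \<in> ob (mhom Br xs y)"
  thus "fop1 ?F (permute_list \<rho> xs) y (mact1 Br xs y \<rho> p) = mact1 PermCat (map (fob ?F) xs) (fob ?F y) \<rho> (fop1 ?F xs y p)"
    by (simp add: map_fob_ring_multifunctor ml_act_Ten permutes_compose)
next
  fix xs :: "unit list" and y :: unit and \<rho> a
  assume \<rho>: "\<rho> permutes {..<length xs}" and "a \<in> arr (mhom Br xs y)"
  hence "a \<in> arr (br_category (length xs))" by simp
  then obtain \<sigma> w where a: "\<sigma> permutes {..<length xs}" "w \<in> braid_words (length xs)" "a = br_mor (length xs) \<sigma> w"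
    by (rule br_arr_cases)
  show "fop2 ?F (permute_list \<rho> xs) y (mact2 Br xs y \<rho> a) = mact2 PermCat (map (fob ?F) xs) (fob ?F y) \<rho> (fop2 ?F xs y a)"
    unfolding a(3) br_mor_act using a(1,2) \<rho>
    by (simp add: map_fob_ring_multifunctor ring_multifunctor_br_mor evT_act permutes_compose)
qed

end

lemma extensional_pair: "\<lbrakk>(\<lambda>(A, B). f A B) \<in> extensional (S \<times> T); \<not> (A \<in> S \<and> B \<in> T)\<rbrakk> \<Longrightarrow> f A B = undefined"
  by (auto simp: extensional_def)

lemma extensional_triple: 
  "\<lbrakk>(\<lambda>(A, B, D). f A B D) \<in> extensional (S \<times> T \<times> U); \<not> (A \<in> S \<and> B \<in> T \<and> D \<in> U)\<rbrakk> \<Longrightarrow> f A B D = undefined"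
  by (auto simp: extensional_def)

lemma braided_ring_of_ring_multifunctor:
  fixes R :: "('o, 'm) braided_ring_structure"
  assumes "braided_ring_category C R"
  shows "braided_ring_of (braided_ring_category.ring_multifunctor C R) = R"
proof -
  interpret braided_ring_category C R by fact
  have T: "fop1 ring_multifunctor [(), ()] () id = Ten (Suc (Suc 0)) id" "fop1 ring_multifunctor [] () id = Ten 0 id"
    by (simp_all add: permutes_id)
  have "(id, braid_class 2 [(0, True)], transpose 0 1) = br_mor (Suc (Suc 0)) id [(0, True)]"
    by (simp add: br_mor_def numeral_2_eq_2)
  moreover have "fop2 ring_multifunctor [(), ()] () (br_mor (Suc (Suc 0)) id [(0, True)]) = evT (Suc (Suc 0)) id [(0, True)]"
    by (rule ring_multifunctor_br_mor) (auto simp: permutes_id)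
  ultimately have B: "fop2 ring_multifunctor [(), ()] () (id, braid_class 2 [(0, True)], transpose 0 1) =
     evT (Suc (Suc 0)) id [(0, True)]" by simp
  have p: "As \<in> ob (cat_list_prod (replicate (Suc (Suc 0)) C)) \<longleftrightarrow> length As = Suc (Suc 0) \<and> set As \<subseteq> ob C"
    "fs \<in> arr (cat_list_prod (replicate (Suc (Suc 0)) C)) \<longleftrightarrow> length fs = Suc (Suc 0) \<and> set fs \<subseteq> arr C" for As fs
    by (rule ob_power arr_power)+
  have d: "(i, As, A') \<in> lin_dom (replicate (Suc (Suc 0)) C) \<longleftrightarrow> i < Suc (Suc 0) \<and> length As = Suc (Suc 0) \<and> set As \<subseteq> ob C \<and> A' \<in> ob C" for i As A'
    by (rule lin_dom_power)
  note defs = Ten_def T B B[unfolded One_nat_def] p d braided_ring_of_def Let_def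
  show ?thesis
  proof (rule braided_ring_structure.equality)
    show "otimes (braided_ring_of ring_multifunctor) = otimes R"
    proof (intro ext)
      fix A B show "otimes (braided_ring_of ring_multifunctor) A B = A \<star> B"
        using extensional_pair[OF otimes_ext, of A B]
        by (cases "A \<in> ob C \<and> B \<in> ob C") (auto simp: defs evT_def simp del: replicate.simps)
    qed
    show "mtimes (braided_ring_of ring_multifunctor) = mtimes R"
    proof (intro ext)
      fix f g show "mtimes (braided_ring_of ring_multifunctor) f g = f \<diamondop> g"
        using extensional_pair[OF mtimes_ext, of f g]
        by (cases "f \<in> arr C \<and> g \<in> arr C") (auto simp: defs evT_def simp del: replicate.simps)
    qed
    show "oone (braided_ring_of ring_multifunctor) = oone R"
      using ob_power[of "[]" 0 C] by (simp add: defs evT_def del: ob_power)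
    show "dl (braided_ring_of ring_multifunctor) = dl R"
    proof (intro ext)
      fix A B X show "dl (braided_ring_of ring_multifunctor) A B X = dl R A B X"
        using extensional_triple[OF dl_ext, of A B X]
        by (cases "A \<in> ob C \<and> B \<in> ob C \<and> X \<in> ob C")
           (auto simp: defs evT_def linten_def delta_one simp del: replicate.simps)
    qed
    show "dr (braided_ring_of ring_multifunctor) = dr R"
    proof (intro ext)
      fix A B X show "dr (braided_ring_of ring_multifunctor) A B X = dr R A B X"
        using extensional_triple[OF dr_ext, of A B X]
        by (cases "A \<in> ob C \<and> B \<in> ob C \<and> X \<in> ob C")
           (auto simp: defs evT_def linten_def delta_one simp del: replicate.simps)
    qed
    show "bra (braided_ring_of ring_multifunctor) = bra R"
    proof (intro ext)
      fix A B show "bra (braided_ring_of ring_multifunctor) A B = bra R A B"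
        using extensional_pair[OF bra_ext, of A B]
        by (cases "A \<in> ob C \<and> B \<in> ob C")
           (auto simp: defs evT_def ltr_def lbra_def simp del: replicate.simps)
    qed
  qed simp
qed

section \<open>The operations of a multifunctor on the braid operad\<close>

lemma unit_list: "xs = replicate (length xs) ()"
  by (induction xs) auto

lemma pair_power [simp]:
  "[A, B] \<in> ob (cat_list_prod [C, C]) \<longleftrightarrow> A \<in> ob C \<and> B \<in> ob C"
  "[f, g] \<in> arr (cat_list_prod [C, C]) \<longleftrightarrow> f \<in> arr C \<and> g \<in> arr C"
  "(i, [A, B], A') \<in> lin_dom [C, C] \<longleftrightarrow> i < Suc (Suc 0) \<and> A \<in> ob C \<and> B \<in> ob C \<and> A' \<in> ob C"
  "src (cat_list_prod [C, C]) [f, g] = [src C f, src C g]"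
  "tgt (cat_list_prod [C, C]) [f, g] = [tgt C f, tgt C g]"
  "idm (cat_list_prod [C, C]) [A, B] = [idm C A, idm C B]"
  "cmp (cat_list_prod [C, C]) [f', g'] [f, g] = [cmp C f' f, cmp C g' g]"
  by (auto simp: cat_list_prod_def set_Cons_def lin_dom_def nth_Cons split: nat.splits)

lemma less_two: "i < Suc (Suc 0) \<longleftrightarrow> i = 0 \<or> i = Suc 0"
  by auto

text \<open>
  A multifunctor from \<open>Br\<close> that sends the unique object to \<open>C\<close>. Every list of objects of \<open>Br\<close> is determined by
  its length, so \<open>op k \<sigma>\<close> and \<open>cpt k \<sigma> w\<close> are all the values of \<open>F\<close> on objects and, as multilinear
  transformations, on morphisms.
\<close>

locale br_algebra = permutative_category C + F: multifunctor Br PermCat F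
  for C :: "('o, 'm) permcat" (structure)
    and F :: "(unit, nat \<Rightarrow> nat, br_arr, ('o, 'm) permcat, ('o, 'm) mlfun, ('o, 'm) mltrans) mfun" +
  assumes fob: "fob F () = C"
begin

sublocale sum: smon C "osum C" "msum C" "ozero C"
  by unfold_locales (rule sum_strict_monoidal)

definition op :: "nat \<Rightarrow> (nat \<Rightarrow> nat) \<Rightarrow> ('o, 'm) mlfun" where
  "op k \<sigma> = fop1 F (replicate k ()) () \<sigma>"

definition cpt :: "nat \<Rightarrow> (nat \<Rightarrow> nat) \<Rightarrow> braid_word \<Rightarrow> 'o list \<Rightarrow> 'm" where
  "cpt k \<sigma> w = fst (snd (fop2 F (replicate k ()) () (br_mor k \<sigma> w)))"

lemma map_fob: "map (fob F) xs = replicate (length xs) C" 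
  "map (map (fob F)) xss = map (\<lambda>k. replicate k C) (map length xss)"
  by (auto simp: fob intro!: nth_equalityI)

lemma functor_F: "is_functor (br_category k) (ml_category (replicate k C) C) (op k) (fop2 F (replicate k ()) ())"
  using F.functorial[of "replicate k ()" "()"] by (simp add: map_fob fob op_def[abs_def] map_replicate_const)

lemma op_multilinear: "\<sigma> permutes {..<k} \<Longrightarrow> multilinear_functor (replicate k C) C (op k \<sigma>)"
  using functor_F[of k] by (auto simp: is_functor_def ml_category_def)

lemma fop2_br_mor:
  assumes "\<sigma> permutes {..<k}" "w \<in> braid_words k"
  shows "fop2 F (replicate k ()) () (br_mor k \<sigma> w) = (op k \<sigma>, cpt k \<sigma> w, op k (word_perm w \<circ> \<sigma>))"
    and cpt_transformation: "multilinear_transformation (replicate k C) C (op k \<sigma>) (op k (word_perm w \<circ> \<sigma>)) (cpt k \<sigma> w)"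
proof -
  have h: "fop2 F (replicate k ()) () (br_mor k \<sigma> w) \<in> hom (ml_category (replicate k C) C) (op k \<sigma>) (op k (word_perm w \<circ> \<sigma>))"
    using functor_F[of k] br_mor_arr[OF assms] by (force simp: is_functor_def br_mor_def)
  thus eq: "fop2 F (replicate k ()) () (br_mor k \<sigma> w) = (op k \<sigma>, cpt k \<sigma> w, op k (word_perm w \<circ> \<sigma>))"
    by (auto simp: hom_def ml_category_def cpt_def)
  show "multilinear_transformation (replicate k C) C (op k \<sigma>) (op k (word_perm w \<circ> \<sigma>)) (cpt k \<sigma> w)"
    using h unfolding eq by (auto simp: hom_def ml_category_def)
qed

lemma cpt_Nil:
  assumes "\<sigma> permutes {..<k}"
  shows "cpt k \<sigma> [] = (\<lambda>As \<in> ob (cat_list_prod (replicate k C)). idm C (obmap (op k \<sigma>) As))"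
proof -
  have "fop2 F (replicate k ()) () (br_mor k \<sigma> []) = idm (ml_category (replicate k C) C) (op k \<sigma>)"
    using functor_F[of k] assms by (auto simp: is_functor_def)
  thus ?thesis by (simp add: cpt_def ml_category_def)
qed

lemma cpt_append:
  assumes "\<sigma> permutes {..<k}" "u \<in> braid_words k" "v \<in> braid_words k"
  shows "cpt k \<sigma> (u @ v) = (\<lambda>As \<in> ob (cat_list_prod (replicate k C)). cpt k (word_perm v \<circ> \<sigma>) u As \<cdot> cpt k \<sigma> v As)"
proof -
  have \<tau>: "word_perm v \<circ> \<sigma> permutes {..<k}" using assms by (intro permutes_compose word_perm_permutes)
  have "fop2 F (replicate k ()) () (cmp (br_category k) (br_mor k (word_perm v \<circ> \<sigma>) u) (br_mor k \<sigma> v)) =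
     cmp (ml_category (replicate k C) C) (fop2 F (replicate k ()) () (br_mor k (word_perm v \<circ> \<sigma>) u)) (fop2 F (replicate k ()) () (br_mor k \<sigma> v))"
    using functor_F[of k] br_mor_arr[OF assms(1,3)] br_mor_arr[OF \<tau> assms(2)] 
    unfolding is_functor_def by (auto simp: br_mor_def)
  thus ?thesis
    using assms \<tau> by (simp add: br_mor_cmp fop2_br_mor) (simp add: cpt_def ml_category_def)
qed

lemma cpt_cong: "braid_eq k u v \<Longrightarrow> cpt k \<sigma> u = cpt k \<sigma> v"
  by (simp add: cpt_def br_mor_cong)

lemma op_one: "op (Suc 0) id = ml_unit C"
  using F.unit[of "()"] by (simp add: op_def fob)

lemma op_comp:
  assumes "p permutes {..<length ks}" "length qs = length ks" "\<And>i. i < length ks \<Longrightarrow> qs ! i permutes {..<ks ! i}"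
  shows "op (sum_list ks) (br_comp ks p qs) = ml_comp (map (\<lambda>k. replicate k C) ks) (replicate (length ks) C) C
    (op (length ks) p) (map2 op ks qs)"
proof -
  let ?xss = "map (\<lambda>k. replicate k ()) ks"
  have m: "map length ?xss = ks" by (simp add: o_def)
  have c: "concat ?xss = replicate (sum_list ks) ()" by (rule concat_replicates)
  have q: "map (\<lambda>i. fop1 F (?xss ! i) (replicate (length ks) () ! i) (qs ! i)) [0..<length ks] = map2 op ks qs"
    using assms(2) by (intro nth_equalityI) (auto simp: op_def)
  have "fop1 F (concat ?xss) () (mcomp1 Br ?xss (replicate (length ks) ()) () p qs) =
    mcomp1 PermCat (map (map (fob F)) ?xss) (map (fob F) (replicate (length ks) ())) (fob F ()) (fop1 F (replicate (length ks) ()) () p)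
      (map (\<lambda>i. fop1 F (?xss ! i) (replicate (length ks) () ! i) (qs ! i)) [0..<length (replicate (length ks) ())])"
    using assms by (intro F.comp1) auto
  thus ?thesis unfolding map_fob m c Br_simps PermCat_simps fob op_def length_replicate q[unfolded op_def] by simp
qed

lemma op_act:
  assumes "\<sigma> permutes {..<k}" "\<rho> permutes {..<k}"
  shows "op k (\<sigma> \<circ> \<rho>) = ml_act (replicate k C) \<rho> (op k \<sigma>)"
  using F.act1[of "replicate k ()" "()" \<rho> \<sigma>] assms by (simp add: op_def map_fob fob map_replicate_const)

lemma cpt_act:
  assumes "\<sigma> permutes {..<k}" "\<rho> permutes {..<k}" "w \<in> braid_words k"
  shows "cpt k (\<sigma> \<circ> \<rho>) w = (\<lambda>As \<in> ob (cat_list_prod (replicate k C)). cpt k \<sigma> w (place \<rho> As))"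
proof -
  have "fop2 F (permute_list \<rho> (replicate k ())) () (mact2 Br (replicate k ()) () \<rho> (br_mor k \<sigma> w)) =
      mact2 PermCat (map (fob F) (replicate k ())) (fob F ()) \<rho> (fop2 F (replicate k ()) () (br_mor k \<sigma> w))"
    using assms br_mor_arr[OF assms(1,3)] by (intro F.act2) auto
  hence "fop2 F (replicate k ()) () (br_mor k (\<sigma> \<circ> \<rho>) w) = ml_act2 (replicate k C) \<rho> (op k \<sigma>, cpt k \<sigma> w, op k (word_perm w \<circ> \<sigma>))"
    using assms unfolding br_mor_act by (simp add: fob fop2_br_mor)
  thus ?thesis using assms by (simp add: cpt_def[of k "\<sigma> \<circ> \<rho>"] ml_act2_def)
qed

lemma cpt_comp2:
  assumes "\<sigma> permutes {..<length ks}" "w \<in> braid_words (length ks)" "length \<tau>s = length ks" "length ws = length ks"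
    "\<forall>i < length ks. \<tau>s ! i permutes {..<ks ! i} \<and> ws ! i \<in> braid_words (ks ! i)"
  shows "cpt (sum_list ks) (br_comp ks \<sigma> \<tau>s) (block_word (place \<sigma> ks) w @ word_juxt (place \<sigma> ks) (place \<sigma> ws)) =
    (\<lambda>As \<in> ob (cat_list_prod (replicate (sum_list ks) C)).
      cpt (length ks) \<sigma> w (map2 obmap (map (\<lambda>i. op (ks ! i) (word_perm (ws ! i) \<circ> \<tau>s ! i)) [0..<length ks]) (chunks ks As)) \<cdot>
      armap (op (length ks) \<sigma>) (map2 (\<lambda>\<beta> As'. \<beta> As') (map (\<lambda>i. cpt (ks ! i) (\<tau>s ! i) (ws ! i)) [0..<length ks]) (chunks ks As)))"
proof -
  let ?xss = "map (\<lambda>k. replicate k ()) ks" and ?n = "length ks"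
  let ?v = "block_word (place \<sigma> ks) w @ word_juxt (place \<sigma> ks) (place \<sigma> ws)"
  let ?bs = "map (\<lambda>i. br_mor (ks ! i) (\<tau>s ! i) (ws ! i)) [0..<?n]"
  have m: "map length ?xss = ks" by (simp add: o_def)
  have c: "concat ?xss = replicate (sum_list ks) ()" by (rule concat_replicates)
  have arr: "br_mor (ks ! i) (\<tau>s ! i) (ws ! i) \<in> arr (br_category (ks ! i))" if "i < ?n" for i
    using assms(5) that by (intro br_mor_arr) auto
  have b: "br_comp2 ks (br_mor ?n \<sigma> w) ?bs = br_mor (sum_list ks) (br_comp ks \<sigma> \<tau>s) ?v"
    by (rule br_comp2_br_mor[where \<tau>s = \<tau>s and ws = ws]; use assms in simp)
  have bs: "map (\<lambda>i. fop2 F (?xss ! i) (replicate ?n () ! i) (?bs ! i)) [0..<?n] =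
     map (\<lambda>i. (op (ks ! i) (\<tau>s ! i), cpt (ks ! i) (\<tau>s ! i) (ws ! i), op (ks ! i) (word_perm (ws ! i) \<circ> \<tau>s ! i))) [0..<?n]"
    using assms(5) by (intro nth_equalityI) (auto simp: fop2_br_mor)
  have "fop2 F (concat ?xss) () (mcomp2 Br ?xss (replicate ?n ()) () (br_mor ?n \<sigma> w) ?bs) =
    mcomp2 PermCat (map (map (fob F)) ?xss) (map (fob F) (replicate ?n ())) (fob F ()) (fop2 F (replicate ?n ()) () (br_mor ?n \<sigma> w))
      (map (\<lambda>i. fop2 F (?xss ! i) (replicate ?n () ! i) (?bs ! i)) [0..<length (replicate ?n ())])"
    using assms arr br_mor_arr[OF assms(1,2)] by (intro F.comp2) auto
  hence "fop2 F (replicate (sum_list ks) ()) () (br_mor (sum_list ks) (br_comp ks \<sigma> \<tau>s) ?v) =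
    ml_comp2 (map (\<lambda>k. replicate k C) ks) (replicate ?n C) C (op ?n \<sigma>, cpt ?n \<sigma> w, op ?n (word_perm w \<circ> \<sigma>))
     (map (\<lambda>i. (op (ks ! i) (\<tau>s ! i), cpt (ks ! i) (\<tau>s ! i) (ws ! i), op (ks ! i) (word_perm (ws ! i) \<circ> \<tau>s ! i))) [0..<?n])"
    unfolding map_fob m c Br_simps PermCat_simps fob length_replicate b bs fop2_br_mor[OF assms(1,2)] .
  thus ?thesis
    by (simp add: cpt_def[of "sum_list ks"] ml_comp2_def Let_def concat_replicates o_def)
qed

section \<open>The ring category of a multifunctor\<close>

abbreviation R where "R \<equiv> braided_ring_of F"
abbreviation T where "T \<equiv> op (Suc (Suc 0)) id"

lemma R_simps:
  "otimes R = (\<lambda>A B. obmap T [A, B])" "mtimes R = (\<lambda>f g. armap T [f, g])" "oone R = obmap (op 0 id) []"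
  "dl R = (\<lambda>A B X. lin T 0 [A, X] B)" "dr R = (\<lambda>A B X. lin T (Suc 0) [A, B] X)"
  "bra R = (\<lambda>A B. cpt (Suc (Suc 0)) id [(0, True)] [A, B])"
proof -
  have "(id, braid_class 2 [(0, True)], transpose 0 1) = br_mor (Suc (Suc 0)) id [(0, True)]"
    by (simp add: br_mor_def numeral_2_eq_2)
  hence b: "fop2 F [(), ()] () (id, braid_class 2 [(0, True)], transpose 0 1) = (T, cpt (Suc (Suc 0)) id [(0, True)], op (Suc (Suc 0)) (transpose 0 1))"
    using fop2_br_mor[of id "Suc (Suc 0)" "[(0, True)]"] by (simp add: permutes_id)
  show "otimes R = (\<lambda>A B. obmap T [A, B])" "mtimes R = (\<lambda>f g. armap T [f, g])" "oone R = obmap (op 0 id) []"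
    "dl R = (\<lambda>A B X. lin T 0 [A, X] B)" "dr R = (\<lambda>A B X. lin T (Suc 0) [A, B] X)"
    "bra R = (\<lambda>A B. cpt (Suc (Suc 0)) id [(0, True)] [A, B])"
    by (simp_all add: braided_ring_of_def Let_def b b[unfolded One_nat_def] op_def)
qed

sublocale T: multilinear_functor "[C, C]" C T
  using op_multilinear[of id "Suc (Suc 0)"] by (simp add: permutes_id)

sublocale U: multilinear_functor "[]" C "op 0 id"
  using op_multilinear[of id 0] by (simp add: permutes_id)

lemma T_simps [simp]:
  "\<lbrakk>A \<in> ob C; B \<in> ob C\<rbrakk> \<Longrightarrow> obmap T [A, B] \<in> ob C"
  "\<lbrakk>f \<in> arr C; g \<in> arr C\<rbrakk> \<Longrightarrow> armap T [f, g] \<in> arr C"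
  "\<lbrakk>f \<in> arr C; g \<in> arr C\<rbrakk> \<Longrightarrow> src C (armap T [f, g]) = obmap T [src C f, src C g]"
  "\<lbrakk>f \<in> arr C; g \<in> arr C\<rbrakk> \<Longrightarrow> tgt C (armap T [f, g]) = obmap T [tgt C f, tgt C g]"
  "\<lbrakk>A \<in> ob C; B \<in> ob C\<rbrakk> \<Longrightarrow> armap T [idm C A, idm C B] = idm C (obmap T [A, B])"
proof -
  note f = T.functorial[unfolded is_functor_def]
  show "\<lbrakk>A \<in> ob C; B \<in> ob C\<rbrakk> \<Longrightarrow> obmap T [A, B] \<in> ob C" using f by auto
  show "\<lbrakk>f \<in> arr C; g \<in> arr C\<rbrakk> \<Longrightarrow> armap T [f, g] \<in> arr C"
    "\<lbrakk>f \<in> arr C; g \<in> arr C\<rbrakk> \<Longrightarrow> src C (armap T [f, g]) = obmap T [src C f, src C g]"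
    "\<lbrakk>f \<in> arr C; g \<in> arr C\<rbrakk> \<Longrightarrow> tgt C (armap T [f, g]) = obmap T [tgt C f, tgt C g]"
    using f[THEN conjunct2, THEN conjunct1, rule_format, of "[f, g]"] by (auto simp: hom_def)
  show "\<lbrakk>A \<in> ob C; B \<in> ob C\<rbrakk> \<Longrightarrow> armap T [idm C A, idm C B] = idm C (obmap T [A, B])"
    using f[THEN conjunct2, THEN conjunct2, THEN conjunct1, rule_format, of "[A, B]"] by simp
qed

lemma T_cmp:
  "\<lbrakk>f \<in> arr C; g \<in> arr C; f' \<in> arr C; g' \<in> arr C; src C f' = tgt C f; src C g' = tgt C g\<rbrakk> \<Longrightarrow>
    armap T [f' \<cdot> f, g' \<cdot> g] = armap T [f', g'] \<cdot> armap T [f, g]"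
  using T.functorial[unfolded is_functor_def, THEN conjunct2, THEN conjunct2, THEN conjunct2, rule_format, of "[f, g]" "[f', g']"]
  by simp

lemma T_lin:
  assumes "A \<in> ob C" "B \<in> ob C" "X \<in> ob C"
  shows "lin T 0 [A, X] B \<in> hom C (obmap T [A, X] \<oplus> obmap T [B, X]) (obmap T [A \<oplus> B, X])"
    "lin T (Suc 0) [A, B] X \<in> hom C (obmap T [A, B] \<oplus> obmap T [A, X]) (obmap T [A, B \<oplus> X])"
  using T.lin_natural[of 0, unfolded nat_trans_def, THEN conjunct1, rule_format, of "([A, X], B)"]
    T.lin_natural[of "Suc 0", unfolded nat_trans_def, THEN conjunct1, rule_format, of "([A, B], X)"] assms
  by (simp_all add: cat_prod_def)

lemma T_lin_simps [simp]:
  assumes "A \<in> ob C" "B \<in> ob C" "X \<in> ob C"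
  shows "lin T 0 [A, X] B \<in> arr C" "src C (lin T 0 [A, X] B) = obmap T [A, X] \<oplus> obmap T [B, X]"
    "tgt C (lin T 0 [A, X] B) = obmap T [A \<oplus> B, X]"
    "lin T (Suc 0) [A, B] X \<in> arr C" "src C (lin T (Suc 0) [A, B] X) = obmap T [A, B] \<oplus> obmap T [A, X]"
    "tgt C (lin T (Suc 0) [A, B] X) = obmap T [A, B \<oplus> X]"
  using T_lin[OF assms] by (auto simp: hom_def)

lemma T_lin_natural:
  assumes "f \<in> arr C" "g \<in> arr C" "h \<in> arr C"
  shows "lin T 0 [tgt C f, tgt C h] (tgt C g) \<cdot> (armap T [f, h] \<boxplus> armap T [g, h]) =
      armap T [f \<boxplus> g, h] \<cdot> lin T 0 [src C f, src C h] (src C g)"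
    "lin T (Suc 0) [tgt C f, tgt C g] (tgt C h) \<cdot> (armap T [f, g] \<boxplus> armap T [f, h]) =
      armap T [f, g \<boxplus> h] \<cdot> lin T (Suc 0) [src C f, src C g] (src C h)"
  using T.lin_natural[of 0, unfolded nat_trans_def, THEN conjunct2, rule_format, of "([f, h], g)"]
    T.lin_natural[of "Suc 0", unfolded nat_trans_def, THEN conjunct2, rule_format, of "([f, g], h)"] assms
  by (simp_all add: cat_prod_def)

lemma U_simps [simp]: "obmap (op 0 id) [] \<in> ob C" "armap (op 0 id) [] = idm C (obmap (op 0 id) [])"
  using U.functorial by (auto simp: is_functor_def cat_list_prod_def)

text \<open>
  Both sides are the value of \<open>F\<close> at the unit of \<open>\<Sigma>\<^sub>3\<close>, written as a composite for the blocks of lengths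
  \<open>2, 1\<close> and \<open>1, 2\<close>.
\<close>

lemma T_assoc: "ml_comp [[C, C], [C]] [C, C] C T [T, ml_unit C] = ml_comp [[C], [C, C]] [C, C] C T [ml_unit C, T]"
proof -
  have "op (sum_list ks) (br_comp ks id (replicate (length ks) id)) = ml_comp (map (\<lambda>k. replicate k C) ks) (replicate (length ks) C) C
    (op (length ks) id) (map2 op ks (replicate (length ks) id))" for ks
    by (intro op_comp) (auto simp: permutes_id)
  from this[of "[Suc (Suc 0), Suc 0]"] this[of "[Suc 0, Suc (Suc 0)]"] show ?thesis
    by (simp add: br_comp_ids op_one del: br_comp_ids) (simp add: br_comp_ids[of "[_, _]", simplified] op_one)
qed

text \<open>
  Both sides are the value of \<open>F\<close> at the unit of \<open>\<Sigma>\<^sub>1\<close>, written as a composite for the blocks of lengths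
  \<open>1, 0\<close> and \<open>0, 1\<close>.
\<close>

lemma T_unit: "ml_comp [[C], []] [C, C] C T [ml_unit C, op 0 id] = ml_unit C"
    "ml_comp [[], [C]] [C, C] C T [op 0 id, ml_unit C] = ml_unit C"
proof -
  have "op (sum_list ks) (br_comp ks id (replicate (length ks) id)) = ml_comp (map (\<lambda>k. replicate k C) ks) (replicate (length ks) C) C
    (op (length ks) id) (map2 op ks (replicate (length ks) id))" for ks
    by (intro op_comp) (auto simp: permutes_id)
  from this[of "[Suc 0, 0]"] this[of "[0, Suc 0]"] 
  show "ml_comp [[C], []] [C, C] C T [ml_unit C, op 0 id] = ml_unit C"
    "ml_comp [[], [C]] [C, C] C T [op 0 id, ml_unit C] = ml_unit C"
    by (simp_all add: br_comp_ids[of "[_, _]", simplified] op_one)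
qed

end

lemma small_power [simp]:
  "[A] \<in> ob (cat_list_prod [C]) \<longleftrightarrow> A \<in> ob C"
  "[f] \<in> arr (cat_list_prod [C]) \<longleftrightarrow> f \<in> arr C"
  "(i, [A], A') \<in> lin_dom [C] \<longleftrightarrow> i = 0 \<and> A \<in> ob C \<and> A' \<in> ob C"
  "[A, B, D] \<in> ob (cat_list_prod [C, C, C]) \<longleftrightarrow> A \<in> ob C \<and> B \<in> ob C \<and> D \<in> ob C"
  "[f, g, h] \<in> arr (cat_list_prod [C, C, C]) \<longleftrightarrow> f \<in> arr C \<and> g \<in> arr C \<and> h \<in> arr C"
  "(i, [A, B, D], A') \<in> lin_dom [C, C, C] \<longleftrightarrow> i < 3 \<and> A \<in> ob C \<and> B \<in> ob C \<and> D \<in> ob C \<and> A' \<in> ob C"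
  by (auto simp: cat_list_prod_def set_Cons_def lin_dom_def nth_Cons split: nat.splits)

context br_algebra
begin

text \<open>
  The comparison of the values and of the three linearity constraints gives associativity of \<open>\<otimes>\<close> and
  the axioms \<open>dl_otimes\<close>, \<open>dr_dl_otimes\<close> and \<open>dr_otimes\<close>.
\<close>

lemma T_assoc_simps:
  assumes "A \<in> ob C" "B \<in> ob C" "D \<in> ob C" "A' \<in> ob C"
  shows "obmap T [obmap T [A, B], D] = obmap T [A, obmap T [B, D]]"
    "armap T [lin T 0 [A, B] A', idm C D] \<cdot> lin T 0 [obmap T [A, B], D] (obmap T [A', B]) =
       lin T 0 [A, obmap T [B, D]] A'"
    "armap T [lin T (Suc 0) [A, B] A', idm C D] \<cdot> lin T 0 [obmap T [A, B], D] (obmap T [A, A']) =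
       armap T [idm C A, lin T 0 [B, D] A'] \<cdot> lin T (Suc 0) [A, obmap T [B, D]] (obmap T [A', D])"
    "lin T (Suc 0) [obmap T [A, B], D] A' =
       armap T [idm C A, lin T (Suc 0) [B, D] A'] \<cdot> lin T (Suc 0) [A, obmap T [B, D]] (obmap T [B, A'])"
  using assms arg_cong[OF T_assoc, of "\<lambda>G. obmap G [A, B, D]"]
    arg_cong[OF T_assoc, of "\<lambda>G. lin G 0 [A, B, D] A'"] arg_cong[OF T_assoc, of "\<lambda>G. lin G (Suc 0) [A, B, D] A'"]
    arg_cong[OF T_assoc, of "\<lambda>G. lin G (Suc (Suc 0)) [A, B, D] A'"]
  by (simp_all add: ml_comp_def ml_unit_def Let_def)

lemma T_assoc_arr:
  assumes "f \<in> arr C" "g \<in> arr C" "h \<in> arr C"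
  shows "armap T [armap T [f, g], h] = armap T [f, armap T [g, h]]"
  using assms arg_cong[OF T_assoc, of "\<lambda>G. armap G [f, g, h]"]
  by (simp add: ml_comp_def ml_unit_def Let_def)

lemma T_unit_simps:
  assumes "A \<in> ob C" "A' \<in> ob C"
  shows "obmap T [A, obmap (op 0 id) []] = A" "obmap T [obmap (op 0 id) [], A] = A"
    "lin T 0 [A, obmap (op 0 id) []] A' = idm C (A \<oplus> A')"
    "lin T (Suc 0) [obmap (op 0 id) [], A] A' = idm C (A \<oplus> A')"
  using assms arg_cong[OF T_unit(1), of "\<lambda>G. obmap G [A]"] arg_cong[OF T_unit(2), of "\<lambda>G. obmap G [A]"]
    arg_cong[OF T_unit(1), of "\<lambda>G. lin G 0 [A] A'"] arg_cong[OF T_unit(2), of "\<lambda>G. lin G 0 [A] A'"]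
  by (simp_all add: ml_comp_def ml_unit_def Let_def)

lemma T_unit_arr:
  assumes "f \<in> arr C"
  shows "armap T [f, idm C (obmap (op 0 id) [])] = f" "armap T [idm C (obmap (op 0 id) []), f] = f"
  using assms arg_cong[OF T_unit(1), of "\<lambda>G. armap G [f]"] arg_cong[OF T_unit(2), of "\<lambda>G. armap G [f]"]
  by (simp_all add: ml_comp_def ml_unit_def Let_def)

lemma ring_category_R: "ring_category C R"
proof
  show "(\<lambda>(A, B). otimes R A B) \<in> extensional (ob C \<times> ob C)"
    using T.obmap_ext by (auto simp: R_simps extensional_def)
  show "(\<lambda>(f, g). mtimes R f g) \<in> extensional (arr C \<times> arr C)"
    using T.armap_ext by (auto simp: R_simps extensional_def)
  show "(\<lambda>(A, B, X). dl R A B X) \<in> extensional (ob C \<times> ob C \<times> ob C)"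
    using T.lin_ext by (auto simp: R_simps extensional_def)
  show "(\<lambda>(A, B, X). dr R A B X) \<in> extensional (ob C \<times> ob C \<times> ob C)"
    using T.lin_ext by (auto simp: R_simps extensional_def)
  show "strict_monoidal C (otimes R) (mtimes R) (oone R)"
    unfolding strict_monoidal_def
  proof (intro conjI ballI)
    show "is_functor (C \<times>\<^sub>c C) C (\<lambda>(A, B). otimes R A B) (\<lambda>(f, g). mtimes R f g)"
      by (auto simp: is_functor_def cat_prod_def R_simps hom_def T_cmp)
  qed (auto simp: R_simps T_assoc_simps(1) T_assoc_arr T_unit_simps T_unit_arr)
  show "nat_trans (C \<times>\<^sub>c C \<times>\<^sub>c C) C
        (\<lambda>(A, B, X). otimes R A X \<oplus> otimes R B X) (\<lambda>(f, g, h). mtimes R f h \<boxplus> mtimes R g h)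
        (\<lambda>(A, B, X). otimes R (A \<oplus> B) X) (\<lambda>(f, g, h). mtimes R (f \<boxplus> g) h)
        (\<lambda>(A, B, X). dl R A B X)"
    by (auto simp: nat_trans_def cat_prod_def R_simps T_lin T_lin_natural)
  show "nat_trans (C \<times>\<^sub>c C \<times>\<^sub>c C) C
        (\<lambda>(A, B, X). otimes R A B \<oplus> otimes R A X) (\<lambda>(f, g, h). mtimes R f g \<boxplus> mtimes R f h)
        (\<lambda>(A, B, X). otimes R A (B \<oplus> X)) (\<lambda>(f, g, h). mtimes R f (g \<boxplus> h))
        (\<lambda>(A, B, X). dr R A B X)"
    by (auto simp: nat_trans_def cat_prod_def R_simps T_lin T_lin_natural)
  show "otimes R \<zero> A = \<zero>" "otimes R A \<zero> = \<zero>" if "A \<in> ob C" for A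
    using T.obmap_zero[of "[\<zero>, A]" 0] T.obmap_zero[of "[A, \<zero>]" "Suc 0"] that by (simp_all add: R_simps)
  show "mtimes R (idm C \<zero>) f = idm C \<zero>" "mtimes R f (idm C \<zero>) = idm C \<zero>" if "f \<in> arr C" for f
    using T.armap_zero[of "[idm C \<zero>, f]" 0] T.armap_zero[of "[f, idm C \<zero>]" "Suc 0"] that by (simp_all add: R_simps)
next
  fix A B X assume o: "A \<in> ob C" "B \<in> ob C" "X \<in> ob C"
  show "dl R A B X = idm C (otimes R (A \<oplus> B) X)" if "A = \<zero> \<or> B = \<zero> \<or> X = \<zero>"
  proof -
    have "(\<exists>j<length [C, C]. [A, X] ! j = \<zero>\<^bsub>[C, C] ! j\<^esub>) \<or> B = \<zero>\<^bsub>[C, C] ! 0\<^esub>"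
      using that by (auto simp: less_two intro: exI[of _ 0] exI[of _ "Suc 0"])
    thus ?thesis using T.lin_zero[of 0 "[A, X]" B] o by (simp add: R_simps)
  qed
  show "dr R A B X = idm C (otimes R A (B \<oplus> X))" if "A = \<zero> \<or> B = \<zero> \<or> X = \<zero>"
  proof -
    have "(\<exists>j<length [C, C]. [A, B] ! j = \<zero>\<^bsub>[C, C] ! j\<^esub>) \<or> X = \<zero>\<^bsub>[C, C] ! Suc 0\<^esub>"
      using that by (auto simp: less_two intro: exI[of _ 0] exI[of _ "Suc 0"])
    thus ?thesis using T.lin_zero[of "Suc 0" "[A, B]" X] o by (simp add: R_simps)
  qed
  show "dl R B A X \<cdot> \<zeta> (otimes R A X) (otimes R B X) = mtimes R (\<zeta> A B) (idm C X) \<cdot> dl R A B X"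
    using T.lin_sym[of 0 "[A, X]" B] o by (simp add: R_simps)
  show "dr R A X B \<cdot> \<zeta> (otimes R A B) (otimes R A X) = mtimes R (idm C A) (\<zeta> B X) \<cdot> dr R A B X"
    using T.lin_sym[of "Suc 0" "[A, B]" X] o by (simp add: R_simps)
next
  fix A B assume o: "A \<in> ob C" "B \<in> ob C"
  show "dl R A B (oone R) = idm C (A \<oplus> B)" "dr R (oone R) A B = idm C (A \<oplus> B)"
    using o T_unit_simps(3,4)[OF o] by (simp_all add: R_simps T_unit_simps)
next
  fix A B X Y assume o: "A \<in> ob C" "B \<in> ob C" "X \<in> ob C" "Y \<in> ob C"
  show "dl R (A \<oplus> B) X Y \<cdot> (dl R A B Y \<boxplus> idm C (otimes R X Y)) = dl R A (B \<oplus> X) Y \<cdot> (idm C (otimes R A Y) \<boxplus> dl R B X Y)"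
    using T.lin_assoc[of 0 "[A, Y]" B X] o by (simp add: R_simps)
  show "dr R A (B \<oplus> X) Y \<cdot> (dr R A B X \<boxplus> idm C (otimes R A Y)) = dr R A B (X \<oplus> Y) \<cdot> (idm C (otimes R A B) \<boxplus> dr R A X Y)"
    using T.lin_assoc[of "Suc 0" "[A, B]" X Y] o by (simp add: R_simps)
  show "dl R A B (otimes R X Y) = mtimes R (dl R A B X) (idm C Y) \<cdot> dl R (otimes R A X) (otimes R B X) Y"
    using T_assoc_simps(2)[of A X Y B] o by (simp add: R_simps)
  show "dr R (otimes R A B) X Y = mtimes R (idm C A) (dr R B X Y) \<cdot> dr R A (otimes R B X) (otimes R B Y)"
    using T_assoc_simps(4)[of A B X Y] o by (simp add: R_simps T_assoc_simps(1))
  show "mtimes R (dr R A B X) (idm C Y) \<cdot> dl R (otimes R A B) (otimes R A X) Y = mtimes R (idm C A) (dl R B X Y) \<cdot> dr R A (otimes R B Y) (otimes R X Y)"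
    using T_assoc_simps(3)[of A B Y X] o by (simp add: R_simps)
  show "dr R (A \<oplus> B) X Y \<cdot> (dl R A B X \<boxplus> dl R A B Y) \<cdot> (idm C (otimes R A X) \<boxplus> \<zeta> (otimes R A Y) (otimes R B X) \<boxplus> idm C (otimes R B Y))
      = dl R A B (X \<oplus> Y) \<cdot> (dr R A X Y \<boxplus> dr R B X Y)"
    \<comment> \<open>the condition on two variables of a bilinear functor, with the second variable taken first\<close>
    using T.lin_two[of "Suc 0" "[A, X]" Y 0 B] o by (simp add: R_simps)
qed

end

sublocale br_algebra \<subseteq> ring_category C "braided_ring_of F"
  by (rule ring_category_R)

context br_algebra
begin

lemma T_Ten: "T = Ten (Suc (Suc 0)) id"
proof (rule mlfun.equality)
  have p: "As \<in> ob (cat_list_prod (replicate (Suc (Suc 0)) C)) \<longleftrightarrow> length As = Suc (Suc 0) \<and> set As \<subseteq> ob C"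
    "fs \<in> arr (cat_list_prod (replicate (Suc (Suc 0)) C)) \<longleftrightarrow> length fs = Suc (Suc 0) \<and> set fs \<subseteq> arr C"
    "(i, As, A') \<in> lin_dom (replicate (Suc (Suc 0)) C) \<longleftrightarrow> i < Suc (Suc 0) \<and> length As = Suc (Suc 0) \<and> set As \<subseteq> ob C \<and> A' \<in> ob C"
    for As fs i A' by (rule ob_power arr_power lin_dom_power)+
  note q = p[simplified replicate.simps]
  have l: "length xs = Suc (Suc 0) \<longleftrightarrow> (\<exists>a b. xs = [a, b])" for xs :: "'x list"
    by (auto simp: length_Suc_conv)
  show "obmap T = obmap (Ten (Suc (Suc 0)) id)"
  proof
    fix As show "obmap T As = obmap (Ten (Suc (Suc 0)) id) As"
      using T.obmap_ext by (cases "As \<in> ob (cat_list_prod [C, C])")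
        (auto simp: Ten_def extensional_def p q l R_simps(1)[symmetric, THEN fun_cong, THEN fun_cong] simp del: replicate.simps)
  qed
  show "armap T = armap (Ten (Suc (Suc 0)) id)"
  proof
    fix fs show "armap T fs = armap (Ten (Suc (Suc 0)) id) fs"
      using T.armap_ext by (cases "fs \<in> arr (cat_list_prod [C, C])")
        (auto simp: Ten_def extensional_def p q l R_simps(2)[symmetric, THEN fun_cong, THEN fun_cong] simp del: replicate.simps)
  qed
  show "lin T = lin (Ten (Suc (Suc 0)) id)"
  proof (intro ext)
    fix i As A' show "lin T i As A' = lin (Ten (Suc (Suc 0)) id) i As A'"
    proof (cases "(i, As, A') \<in> lin_dom [C, C]")
      case True
      thus ?thesis
        by (auto simp: Ten_def p q l less_two linten_def delta_one R_simps(4,5)[symmetric, THEN fun_cong, THEN fun_cong, THEN fun_cong] simp del: replicate.simps)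
    next
      case False
      thus ?thesis using T.lin_ext by (auto simp: Ten_def extensional_def simp del: lin_dom_power)
    qed
  qed
qed simp

lemma U_Ten: "op 0 id = Ten 0 id"
proof (rule mlfun.equality)
  have p: "As \<in> ob (cat_list_prod []) \<longleftrightarrow> As = []" "fs \<in> arr (cat_list_prod []) \<longleftrightarrow> fs = []"
    "\<not> (i, Bs, A') \<in> lin_dom []" for As :: "'o list" and fs :: "'m list" and Bs :: "'o list" and i A'
    by (auto simp: cat_list_prod_def lin_dom_def)
  show "obmap (op 0 id) = obmap (Ten 0 id)"
    using U.obmap_ext by (auto simp: fun_eq_iff Ten_def p extensional_def R_simps(3))
  show "armap (op 0 id) = armap (Ten 0 id)"
    using U.armap_ext by (auto simp: fun_eq_iff Ten_def p extensional_def R_simps(3))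
  show "lin (op 0 id) = lin (Ten 0 id)"
    using U.lin_ext by (auto simp: fun_eq_iff Ten_def p extensional_def)
qed simp

text \<open>
  The unit of \<open>\<Sigma>\<^bsub>k+1\<^esub>\<close> is the composite of the unit of \<open>\<Sigma>\<^sub>2\<close> with those of \<open>\<Sigma>\<^sub>1\<close> and \<open>\<Sigma>\<^sub>k\<close>, and every
  permutation arises from a unit by the action.
\<close>

lemma op_Ten: "\<sigma> permutes {..<k} \<Longrightarrow> op k \<sigma> = Ten k \<sigma>"
proof -
  have step: "op (sum_list [Suc 0, k]) (br_comp [Suc 0, k] id [id, id]) = Ten (sum_list [Suc 0, k]) (br_comp [Suc 0, k] id [id, id])"
    if k: "op k id = Ten k id" for k
  proof -
    let ?ks = "[Suc 0, k]"
    \<comment> \<open>a first block of length one, so that the induction adds one factor on the left\<close>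
    have e: "op (sum_list ?ks) (br_comp ?ks id [id, id]) = ml_comp (map (\<lambda>k. replicate k C) ?ks)
        (replicate (length ?ks) C) C (op (length ?ks) id) (map2 op ?ks [id, id])"
      "ml_comp (map (\<lambda>k. replicate k C) ?ks) (replicate (length ?ks) C) C (Ten (length ?ks) id) (map2 Ten ?ks [id, id]) =
        Ten (sum_list ?ks) (br_comp ?ks id [id, id])"
      by (intro op_comp ml_comp_Ten; auto simp: permutes_id less_two nth_Cons split: nat.splits)+
    have "op (length ?ks) id = Ten (length ?ks) id" "map2 op ?ks [id, id] = map2 Ten ?ks [id, id]"
      using T_Ten k by (simp_all add: op_one ml_unit_Ten)
    thus ?thesis using e by (simp only:)
  qed
  have id: "op k id = Ten k id" for k
  proof (induction k)
    case (Suc k)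
    have b: "br_comp [Suc 0, k] id [id, id] = id" "sum_list [Suc 0, k] = Suc k"
      using br_comp_ids[of "[Suc 0, k]"] by simp_all
    show ?case using step[OF Suc.IH] unfolding b .
  qed (rule U_Ten)
  assume \<sigma>: "\<sigma> permutes {..<k}"
  have "op k (id \<circ> \<sigma>) = Ten k (id \<circ> \<sigma>)"
    using op_act[of id k \<sigma>] ml_act_Ten[of id k \<sigma>] \<sigma> by (simp add: permutes_id id)
  thus ?thesis by simp
qed

end

section \<open>The braiding of a multifunctor\<close>

context br_algebra
begin

abbreviation ot_R (infixr \<open>\<star>\<close> 70) where "A \<star> B \<equiv> otimes R A B"
abbreviation mt_R (infixr \<open>\<diamondop>\<close> 70) where "f \<diamondop> g \<equiv> mtimes R f g"

lemma cpt_simps [simp]: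
  assumes "\<sigma> permutes {..<k}" "w \<in> braid_words k" "length As = k" "set As \<subseteq> ob C"
  shows "cpt k \<sigma> w As \<in> arr C" "src C (cpt k \<sigma> w As) = oten (place \<sigma> As)"
    "tgt C (cpt k \<sigma> w As) = oten (wact w (place \<sigma> As))"
proof -
  have \<tau>: "word_perm w \<circ> \<sigma> permutes {..<k}" using assms by (intro permutes_compose word_perm_permutes)
  have "cpt k \<sigma> w As \<in> hom C (obmap (op k \<sigma>) As) (obmap (op k (word_perm w \<circ> \<sigma>)) As)"
    using multilinear_transformation.natural[OF cpt_transformation[OF assms(1,2)]] assms
    by (simp add: nat_trans_def)
  thus "cpt k \<sigma> w As \<in> arr C" "src C (cpt k \<sigma> w As) = oten (place \<sigma> As)"
    "tgt C (cpt k \<sigma> w As) = oten (wact w (place \<sigma> As))"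
    using assms \<tau> by (simp_all add: hom_def op_Ten Ten_simps place_word_perm)
qed

lemma cpt_Nil_apply:
  assumes "\<sigma> permutes {..<k}" "length As = k" "set As \<subseteq> ob C"
  shows "cpt k \<sigma> [] As = \<iota> (oten (place \<sigma> As))"
  using assms by (simp add: cpt_Nil op_Ten Ten_simps)

lemma cpt_place:
  assumes "\<sigma> permutes {..<k}" "w \<in> braid_words k" "length As = k" "set As \<subseteq> ob C"
  shows "cpt k \<sigma> w As = cpt k id w (place \<sigma> As)"
  using cpt_act[of id k \<sigma> w] assms by (simp add: permutes_id)

lemma cpt_Cons:
  assumes "\<sigma> permutes {..<k}" "x # w \<in> braid_words k" "length As = k" "set As \<subseteq> ob C"
  shows "cpt k \<sigma> (x # w) As = cpt k id [x] (wact w (place \<sigma> As)) \<cdot> cpt k \<sigma> w As"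
proof -
  have w: "[x] \<in> braid_words k" "w \<in> braid_words k" using assms(2) by auto
  have \<tau>: "word_perm w \<circ> \<sigma> permutes {..<k}" using assms(1) w by (intro permutes_compose word_perm_permutes)
  have "cpt k \<sigma> ([x] @ w) As = cpt k (word_perm w \<circ> \<sigma>) [x] As \<cdot> cpt k \<sigma> w As"
    unfolding cpt_append[OF assms(1) w] using assms by simp
  also have "cpt k (word_perm w \<circ> \<sigma>) [x] As = cpt k id [x] (wact w (place \<sigma> As))"
    using cpt_place[OF \<tau> w(1) assms(3,4)] place_word_perm[OF assms(1) w(2) assms(3)] by simp
  finally show ?thesis by simp
qed

lemma bra_R: "bra R A B = cpt (Suc (Suc 0)) id [(0, True)] [A, B]"
  by (simp add: R_simps)

lemma bra_R_simps:
  assumes "A \<in> ob C" "B \<in> ob C"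
  shows "bra R A B \<in> arr C" "src C (bra R A B) = A \<star> B" "tgt C (bra R A B) = B \<star> A"
  using assms by (simp_all add: bra_R permutes_id swap_at_def)

lemma permute_swap: "permute_list (transpose 0 (Suc 0)) [a, b] = [b, a]"
  by (simp add: permute_list_def)

text \<open>
  A positive letter is the juxtaposition of the generator of \<open>B\<^sub>2\<close> with identities on both sides, that is,
  the composite of the unit of \<open>\<Sigma>\<^sub>3\<close> with these three morphisms.
\<close>

lemma cpt_letter:
  assumes "set L \<subseteq> ob C" "a \<in> ob C" "b \<in> ob C" "set S \<subseteq> ob C" "k = length (L @ a # b # S)"
  shows "cpt k id [(length L, True)] (L @ a # b # S) = ten.wh (oten L) (bra R a b) (oten S)"
proof -
  let ?ks = "[length L, Suc (Suc 0), length S]" and ?ws = "[[], [(0, True)], []] :: braid_word list"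
  let ?As = "L @ a # b # S" and ?X = "[oten L, oten [b, a], oten S]"
  have i3: "[0..<length ?ks] = [0, Suc 0, Suc (Suc 0)]" by (simp add: upt_rec)
  have c: "chunks ?ks ?As = [L, [a, b], S]" by simp
  have k: "sum_list ?ks = k" using assms(5) by simp
  have id3: "br_comp ?ks id [id, id, id] = id" using br_comp_ids[of ?ks] by simp
  have w: "block_word (place id ?ks) [] @ word_juxt (place id ?ks) (place id ?ws) = [(length L, True)]" by simp
  have p: "transpose 0 (Suc 0) permutes {..<Suc (Suc 0)}" by (intro permutes_swap_id) auto
  have obs: "map2 obmap (map (\<lambda>i. op (?ks ! i) (word_perm (?ws ! i) \<circ> [id, id, id] ! i)) [0..<length ?ks]) (chunks ?ks ?As) = ?X"
    unfolding i3 c using assms p by (simp add: op_Ten[OF p] op_Ten[OF permutes_id] Ten_simps permute_swap)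
  have fs: "map2 (\<lambda>\<beta> As'. \<beta> As') (map (\<lambda>i. cpt (?ks ! i) ([id, id, id] ! i) (?ws ! i)) [0..<length ?ks]) (chunks ?ks ?As)
      = [\<iota> (oten L), bra R a b, \<iota> (oten S)]"
    unfolding i3 c using assms by (simp add: cpt_Nil_apply[OF permutes_id] bra_R)
  have prem: "[] \<in> braid_words (length ?ks)" "length [id, id, id] = length ?ks" "length ?ws = length ?ks"
    by simp_all
  have prems: "\<forall>i < length ?ks. [id, id, id] ! i permutes {..<?ks ! i} \<and> ?ws ! i \<in> braid_words (?ks ! i)"
    by (auto simp: permutes_id less_Suc_eq nth_Cons split: nat.splits)
  have As: "?As \<in> ob (cat_list_prod (replicate (sum_list ?ks) C))"
    using assms by (subst ob_power) simp
  \<comment> \<open>the composite for the blocks \<open>L\<close>, \<open>[a, b]\<close>, \<open>S\<close>; the outer braid is trivial\<close>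
  have "cpt k id [(length L, True)] ?As = cpt (length ?ks) id [] ?X \<cdot> armap (op (length ?ks) id) [\<iota> (oten L), bra R a b, \<iota> (oten S)]"
    using fun_cong[OF cpt_comp2[OF permutes_id prem prems], of ?As]
    unfolding restrict_apply'[OF As] obs fs unfolding k id3 w .
  also have "\<dots> = ten.wh (oten L) (bra R a b) (oten S)"
    using assms bra_R_simps[OF assms(2,3)]
    by (simp add: cpt_Nil_apply[OF permutes_id] op_Ten[OF permutes_id] Ten_simps ten.wh_def)
  finally show ?thesis .
qed

text \<open>
  The crossing of two blocks is the composite of the generator of \<open>B\<^sub>2\<close> with two identities.
\<close>

lemma bra_R_block:
  assumes "length Ass = Suc (Suc 0)" "set (concat Ass) \<subseteq> ob C"
  shows "cpt (length (concat Ass)) id (cross_word 0 (length (Ass ! 0)) (length (Ass ! Suc 0))) (concat Ass) =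
    bra R (oten (Ass ! 0)) (oten (Ass ! Suc 0))"
proof -
  obtain P Q where A: "Ass = [P, Q]" using assms(1) by (auto simp: length_Suc_conv)
  have o: "set P \<subseteq> ob C" "set Q \<subseteq> ob C" using assms(2) A by auto
  let ?ks = "[length P, length Q]" and ?ws = "[[], []] :: braid_word list"
  have i2: "[0..<length ?ks] = [0, Suc 0]" by (simp add: upt_rec)
  have c: "chunks ?ks (concat Ass) = [P, Q]" by (simp add: A)
  have k: "sum_list ?ks = length (concat Ass)" by (simp add: A)
  have id2: "br_comp ?ks id [id, id] = id" using br_comp_ids[of ?ks] by simp
  have w: "block_word (place id ?ks) [(0, True)] @ word_juxt (place id ?ks) (place id ?ws) = cross_word 0 (length P) (length Q)"
    by (simp add: block_word_Cons[of _ "Suc (Suc 0)"] block_letter.simps)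
  have obs: "map2 obmap (map (\<lambda>i. op (?ks ! i) (word_perm (?ws ! i) \<circ> [id, id] ! i)) [0..<length ?ks]) (chunks ?ks (concat Ass)) = [oten P, oten Q]"
    unfolding i2 c using o by (simp add: op_Ten[OF permutes_id] Ten_simps)
  have fs: "map2 (\<lambda>\<beta> As'. \<beta> As') (map (\<lambda>i. cpt (?ks ! i) ([id, id] ! i) (?ws ! i)) [0..<length ?ks]) (chunks ?ks (concat Ass))
      = [\<iota> (oten P), \<iota> (oten Q)]"
    unfolding i2 c using o by (simp add: cpt_Nil_apply[OF permutes_id])
  have prem: "[(0, True)] \<in> braid_words (length ?ks)" "length [id, id] = length ?ks" "length ?ws = length ?ks"
    by simp_all
  have prems: "\<forall>i < length ?ks. [id, id] ! i permutes {..<?ks ! i} \<and> ?ws ! i \<in> braid_words (?ks ! i)"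
    by (auto simp: permutes_id less_Suc_eq nth_Cons split: nat.splits)
  have As: "concat Ass \<in> ob (cat_list_prod (replicate (sum_list ?ks) C))"
    using assms(2) unfolding k by (subst ob_power) simp
  have "cpt (length (concat Ass)) id (cross_word 0 (length P) (length Q)) (concat Ass) =
      cpt (length ?ks) id [(0, True)] [oten P, oten Q] \<cdot> armap (op (length ?ks) id) [\<iota> (oten P), \<iota> (oten Q)]"
    using fun_cong[OF cpt_comp2[OF permutes_id prem prems], of "concat Ass"]
    unfolding restrict_apply'[OF As] obs fs unfolding k id2 w .
  also have "\<dots> = bra R (oten P) (oten Q)"
    using o bra_R_simps[of "oten P" "oten Q"]
    by (simp add: op_Ten[OF permutes_id] Ten_simps bra_R del: T_simps)
  finally show ?thesis by (simp add: A)
qed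

text \<open>
  The crossing of a block of one strand and a block of two strands has two letters. As a block braid it
  acts as the braiding with a product, letter by letter it acts as the composite of two braidings.
\<close>

lemma bra_R_hexagon:
  assumes "A \<in> ob C" "B \<in> ob C" "D \<in> ob C"
  shows "bra R A (B \<star> D) = (\<iota> B \<diamondop> bra R A D) \<cdot> (bra R A B \<diamondop> \<iota> D)"
    "bra R (A \<star> B) D = (bra R A D \<diamondop> \<iota> B) \<cdot> (\<iota> A \<diamondop> bra R B D)"
proof -
  let ?k = "Suc (Suc (Suc 0))"
  have l: "cpt ?k id [(0, True)] [X, Y, Z] = bra R X Y \<diamondop> \<iota> Z" "cpt ?k id [(Suc 0, True)] [X, Y, Z] = \<iota> X \<diamondop> bra R Y Z"
    if "X \<in> ob C" "Y \<in> ob C" "Z \<in> ob C" for X Y Z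
    using cpt_letter[of "[]" X Y "[Z]" ?k] cpt_letter[of "[X]" Y Z "[]" ?k] that bra_R_simps[of X Y] bra_R_simps[of Y Z]
    by (simp_all add: ten.wh_def)
  have "cpt ?k id ((Suc 0, True) # [(0, True)]) [A, B, D] = bra R A (B \<star> D)"
    using bra_R_block[of "[[A], [B, D]]"] assms by simp
  thus "bra R A (B \<star> D) = (\<iota> B \<diamondop> bra R A D) \<cdot> (bra R A B \<diamondop> \<iota> D)"
    using assms by (subst (asm) cpt_Cons) (simp_all add: permutes_id swap_at_def l)
  have "cpt ?k id ((0, True) # [(Suc 0, True)]) [A, B, D] = bra R (A \<star> B) D"
    using bra_R_block[of "[[A, B], [D]]"] assms by simp
  thus "bra R (A \<star> B) D = (bra R A D \<diamondop> \<iota> B) \<cdot> (\<iota> A \<diamondop> bra R B D)"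
    using assms by (subst (asm) cpt_Cons) (simp_all add: permutes_id swap_at_def l)
qed

lemma bra_R_iso:
  assumes "A \<in> ob C" "B \<in> ob C"
  shows "is_iso C (bra R A B)"
proof -
  let ?k = "Suc (Suc 0)"
  let ?g = "cpt ?k id [(0, False)] [B, A]"
  have g: "?g \<in> hom C (B \<star> A) (A \<star> B)" using assms by (simp add: hom_def permutes_id swap_at_def)
  have "cpt ?k id ((0, False) # [(0, True)]) [A, B] = cpt ?k id [] [A, B]"
    using braid_eq.cancel[of "[]" ?k "[]" 0 False] by (intro fun_cong[OF cpt_cong]) simp
  hence 1: "?g \<cdot> bra R A B = \<iota> (A \<star> B)"
    using assms by (subst (asm) cpt_Cons) (simp_all add: permutes_id swap_at_def bra_R cpt_Nil_apply)
  have "cpt ?k id ((0, True) # [(0, False)]) [B, A] = cpt ?k id [] [B, A]"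
    using braid_eq.cancel[of "[]" ?k "[]" 0 True] by (intro fun_cong[OF cpt_cong]) simp
  hence 2: "bra R A B \<cdot> ?g = \<iota> (B \<star> A)"
    using assms by (subst (asm) cpt_Cons) (simp_all add: permutes_id swap_at_def bra_R cpt_Nil_apply)
  show ?thesis unfolding is_iso_def using g 1 2 bra_R_simps[OF assms] by auto
qed

lemma braided_ring_category_R: "braided_ring_category C R"
proof
  let ?k = "Suc (Suc 0)" and ?s = "transpose 0 (Suc 0)"
  have id: "id permutes {..<?k}" by (rule permutes_id)
  have w: "[(0, True)] \<in> braid_words ?k" by simp
  have s: "?s permutes {..<?k}" by (intro permutes_swap_id) auto
  interpret b: multilinear_transformation "[C, C]" C "Ten ?k id" "Ten ?k ?s" "cpt ?k id [(0, True)]"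
    using cpt_transformation[OF id w] by (simp add: op_Ten[OF s] op_Ten[OF id])
  have T: "obmap (Ten ?k id) [A, B] = A \<star> B" "obmap (Ten ?k ?s) [A, B] = B \<star> A" if "A \<in> ob C" "B \<in> ob C" for A B
    using that by (simp_all add: Ten_simps permute_swap)
  have Ta: "armap (Ten ?k id) [f, g] = f \<diamondop> g" "armap (Ten ?k ?s) [f, g] = g \<diamondop> f" if "f \<in> arr C" "g \<in> arr C" for f g
    using that by (simp_all add: Ten_simps permute_swap)
  have Tl: "lin (Ten ?k id) 0 [A, X] B = dl R A B X" "lin (Ten ?k id) (Suc 0) [A, B] X = dr R A B X"
    "lin (Ten ?k ?s) 0 [A, X] B = dr R X A B" "lin (Ten ?k ?s) (Suc 0) [A, B] X = dl R B X A"
    if "A \<in> ob C" "B \<in> ob C" "X \<in> ob C" for A B X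
    using that by (simp_all add: Ten_simps permute_swap linten_def delta_one)
  show "(\<lambda>(A, B). bra R A B) \<in> extensional (ob C \<times> ob C)"
    using b.ext by (auto simp: bra_R extensional_def)
  show "is_braiding C (otimes R) (mtimes R) (bra R)"
    unfolding is_braiding_def
  proof (intro conjI ballI)
    show "nat_trans (C \<times>\<^sub>c C) C (\<lambda>(A, B). A \<star> B) (\<lambda>(f, g). f \<diamondop> g) (\<lambda>(A, B). B \<star> A) (\<lambda>(f, g). g \<diamondop> f) (\<lambda>(A, B). bra R A B)"
      unfolding nat_trans_def
    proof (intro conjI ballI; clarsimp simp: cat_prod_def)
      fix A B assume "A \<in> ob C" "B \<in> ob C"
      thus "bra R A B \<in> hom C (A \<star> B) (B \<star> A)" by (simp add: hom_def bra_R_simps)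
    next
      fix f g assume "f \<in> arr C" "g \<in> arr C"
      thus "bra R (tgt C f) (tgt C g) \<cdot> (f \<diamondop> g) = (g \<diamondop> f) \<cdot> bra R (src C f) (src C g)"
        using b.natural[unfolded nat_trans_def, THEN conjunct2, rule_format, of "[f, g]"] by (simp add: Ta bra_R)
    qed
  qed (auto simp: bra_R_iso bra_R_hexagon)
  show "bra R A \<zero> = \<iota> \<zero>" "bra R \<zero> A = \<iota> \<zero>" if "A \<in> ob C" for A
    using b.zero[of "[A, \<zero>]" "Suc 0"] b.zero[of "[\<zero>, A]" 0] that by (simp_all add: bra_R)
  show "bra R (A \<oplus> B) X \<cdot> dl R A B X = dr R X A B \<cdot> (bra R A X \<boxplus> bra R B X)"
    "bra R A (B \<oplus> X) \<cdot> dr R A B X = dl R B X A \<cdot> (bra R A B \<boxplus> bra R A X)"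
    if "A \<in> ob C" "B \<in> ob C" "X \<in> ob C" for A B X
    using b.lin_compat[of 0 "[A, X]" B] b.lin_compat[of "Suc 0" "[A, B]" X] that by (simp_all add: bra_R Tl)
qed

end

section \<open>A multifunctor is determined by its braided ring category\<close>

sublocale br_algebra \<subseteq> braided_ring_category C "braided_ring_of F"
  by (rule braided_ring_category_R)

context br_algebra
begin

text \<open>
  For a negative letter both morphisms are inverse to the action of the corresponding positive letter.
\<close>

lemma cpt_single:
  assumes "Suc (fst x) < length As" "set As \<subseteq> ob C"
  shows "cpt (length As) id [x] As = ltr x As"
proof -
  have pos: "cpt (length As) id [(i, True)] As = ltr (i, True) As" if "Suc i < length As" "set As \<subseteq> ob C" for i As
    using that(1)
  proof (rule split_two)
    fix L a b S assume s: "As = L @ a # b # S" "length L = i"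
    thus ?thesis using that cpt_letter[of L a b S] by (auto simp: ltr_split lbra_def)
  qed
  obtain i e where x: "x = (i, e)" by (cases x)
  show ?thesis
  proof (cases e)
    case True
    thus ?thesis using pos[of i As] assms x by simp
  next
    case False
    let ?Bs = "swap_at i As" and ?k = "length As"
    have i: "Suc i < ?k" using assms x by simp
    have B: "set ?Bs \<subseteq> ob C" "length ?Bs = ?k" using assms i by simp_all
    have "swap_at i ?Bs = As" using wact_cong[OF braid_eq.cancel[of "[]" ?k "[]" i True], of As] i by simp
    hence 1: "ltr (i, False) As \<cdot> ltr (i, True) ?Bs = \<iota> (oten ?Bs)"
      using ev_cancel[of i ?Bs False] i B by simp
    have "cpt ?k id ((i, True) # [(i, False)]) As = cpt ?k id [] As"
      using braid_eq.cancel[of "[]" ?k "[]" i True] i by (intro fun_cong[OF cpt_cong]) simp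
    hence 2: "ltr (i, True) ?Bs \<cdot> cpt ?k id [(i, False)] As = \<iota> (oten As)"
      using assms i B pos[of i ?Bs] by (subst (asm) cpt_Cons) (simp_all add: permutes_id cpt_Nil_apply)
    have "ltr (i, False) As = cpt ?k id [(i, False)] As"
      by (rule inverse_unique[of "ltr (i, True) ?Bs"])
         (use 1 2 i assms B \<open>swap_at i ?Bs = As\<close> in \<open>simp_all add: permutes_id\<close>)
    thus ?thesis using x False by simp
  qed
qed

lemma cpt_ev:
  assumes "\<sigma> permutes {..<k}" "w \<in> braid_words k" "length As = k" "set As \<subseteq> ob C"
  shows "cpt k \<sigma> w As = ev w (place \<sigma> As)"
  using assms(2)
proof (induction w)
  case Nil
  thus ?case using assms by (simp add: cpt_Nil_apply)
next
  case (Cons x w)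
  have "cpt k id [x] (wact w (place \<sigma> As)) = ltr x (wact w (place \<sigma> As))"
    using cpt_single[of x "wact w (place \<sigma> As)"] Cons.prems assms by simp
  moreover have "cpt k \<sigma> w As = ev w (place \<sigma> As)" using Cons by simp
  ultimately show ?case using cpt_Cons[OF assms(1) Cons.prems assms(3,4)] by (simp only: ev.simps)
qed

text \<open>
  Both multifunctors agree by \<open>op_Ten\<close> and \<open>cpt_ev\<close>, and outside their domains all values are
  \<open>undefined\<close>.
\<close>

lemma ring_multifunctor_R: "ring_multifunctor = F"
proof (rule mfun.equality)
  show "fob ring_multifunctor = fob F" by (auto simp: fob)
  show "fop1 ring_multifunctor = fop1 F"
  proof (intro ext)
    fix xs :: "unit list" and y \<sigma>
    have xs: "xs = replicate (length xs) ()" by (rule unit_list)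
    show "fop1 ring_multifunctor xs y \<sigma> = fop1 F xs y \<sigma>"
    proof (cases "\<sigma> permutes {..<length xs}")
      case True
      thus ?thesis using op_Ten[OF True] xs by (simp add: op_def)
    next
      case False
      thus ?thesis using F.fop1_ext by (auto simp: extensional_def ring_multifunctor_def)
    qed
  qed
  show "fop2 ring_multifunctor = fop2 F"
  proof (intro ext)
    fix xs :: "unit list" and y a
    have xs: "xs = replicate (length xs) ()" by (rule unit_list)
    show "fop2 ring_multifunctor xs y a = fop2 F xs y a"
    proof (cases "a \<in> arr (br_category (length xs))")
      case True
      then obtain \<sigma> w where a: "\<sigma> permutes {..<length xs}" "w \<in> braid_words (length xs)" "a = br_mor (length xs) \<sigma> w"
        by (rule br_arr_cases)
      have \<tau>: "word_perm w \<circ> \<sigma> permutes {..<length xs}" using a by (intro permutes_compose word_perm_permutes)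
      have "cpt (length xs) \<sigma> w = (\<lambda>As \<in> ob (cat_list_prod (replicate (length xs) C)). ev w (place \<sigma> As))"
      proof
        fix As show "cpt (length xs) \<sigma> w As = (\<lambda>As \<in> ob (cat_list_prod (replicate (length xs) C)). ev w (place \<sigma> As)) As"
          using multilinear_transformation.ext[OF cpt_transformation[OF a(1,2)]] cpt_ev[OF a(1,2), of As]
          by (auto simp: extensional_def)
      qed
      hence "evT (length xs) \<sigma> w = fop2 F (replicate (length xs) ()) () (br_mor (length xs) \<sigma> w)"
        by (simp add: evT_def fop2_br_mor[OF a(1,2)] op_Ten[OF a(1)] op_Ten[OF \<tau>])
      thus ?thesis using a xs by (simp add: ring_multifunctor_br_mor)
    next
      case False
      thus ?thesis using F.fop2_ext by (cases a) (auto simp: extensional_def ring_multifunctor_def)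
    qed
  qed
qed simp

end

section \<open>The correspondence\<close>

theorem mainTheorem15:
  fixes C :: "('o, 'm) permcat"
  assumes "permutative_category C"
  shows "bij_betw braided_ring_of
    {F. multifunctor Br PermCat F \<and> fob F () = C}
    {R. braided_ring_category C R}"
proof (rule bij_betw_byWitness[where f' = "braided_ring_category.ring_multifunctor C"])
  have alg: "br_algebra C F" if "multifunctor Br PermCat F" "fob F () = C" for F
    using assms that by (simp add: br_algebra_def br_algebra_axioms_def)
  show "\<forall>F \<in> {F. multifunctor Br PermCat F \<and> fob F () = C}.
      braided_ring_category.ring_multifunctor C (braided_ring_of F) = F"
    using br_algebra.ring_multifunctor_R[OF alg] by blast
  show "\<forall>R \<in> {R. braided_ring_category C R}. braided_ring_of (braided_ring_category.ring_multifunctor C R) = R"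
    by (simp add: braided_ring_of_ring_multifunctor)
  show "braided_ring_of ` {F. multifunctor Br PermCat F \<and> fob F () = C} \<subseteq> {R. braided_ring_category C R}"
    using br_algebra.braided_ring_category_R[OF alg] by blast
  show "braided_ring_category.ring_multifunctor C ` {R. braided_ring_category C R}
      \<subseteq> {F. multifunctor Br PermCat F \<and> fob F () = C}"
    by (auto simp: braided_ring_category.multifunctor_ring_multifunctor braided_ring_category.ring_multifunctor_simps)
qed

end
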